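(* Let $W:\mathbb{C}\to\mathbb{R}$ be of class $C^2$ with $W(e^{i\vartheta}\psi)=W(\psi)$ for all $\vartheta\in\mathbb{R}$, $\psi\in\mathbb{C}$. For real arguments $s$ write $W(s)$, $W'(s)$, $W''(s)$ for the restriction of $W$ to $\mathbb{R}$ and its derivatives. Assume: $W_1)$ $W\ge0$ and $W(0)=W'(0)=0$; $W_2)$ $W''(0)=m_0^2>0$ (with $m_0>0$); $W_3)$ there exist $m_1,c>0$ with $m_1<m_0$ such that $W(s)\le\frac12m_1^2s^2+c$ for all $s\in\mathbb{R}$; $W_4)$ $0\le\frac12W'(s)s\le W(s)$ for all $s\in\mathbb{R}$; $W_5)$ there exist constants $c_1,c_2>0$ and $p<4$ such that $|W''(s)|\le c_1|s|^p+c_2$ for all $s$. Then there exists $q_*>0$ such that for any $q$ with $0<q<q_*$ the system $$D_t^2\psi-\mathbf{D}_x^2\psi+W'(\psi)=0,$$ $$\nabla\cdot\left(\frac{\partial\mathbf{A}}{\partial t}+\nabla\phi\right)=q\left(\operatorname{Im}\frac1\psi\frac{\partial\psi}{\partial t}+q\phi\right)|\psi|^2,$$ $$\nabla\times(\nabla\times\mathbf{A})+\frac{\partial}{\partial t}\left(\frac{\partial\mathbf{A}}{\partial t}+\nabla\phi\right)=q\left(\operatorname{Im}\frac{\nabla\psi}{\psi}-q\mathbf{A}\right)|\psi|^2$$ on $\mathbb{R}\times\mathbb{R}^3$, in the unknowns $\psi$ (complex valued), $\phi$ (real valued), $\mathbf{A}$ ($\mathbb{R}^3$-valued), possesses a nontrivial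 finite energy solution of the form $$\psi(t,x)=u(x)e^{-i\omega t},\quad u\ge0,\quad \omega\in\mathbb{R},\quad \mathbf{A}=0,\quad \phi=\phi(x).$$
   Context: The covariant derivatives are $D_t=\frac{\partial}{\partial t}+iq\phi$ and $D_j=\frac{\partial}{\partial x^j}-iqA_j$ ($j=1,2,3$), where $\mathbf{A}=(A_1,A_2,A_3)$, and $\mathbf{D}_x^2\psi=\sum_{j=1}^3D_j^2\psi$. For $\psi=\psi_1+i\psi_2\in\mathbb{C}$, $W'(\psi)=\frac{\partial W}{\partial\psi_1}+i\frac{\partial W}{\partial\psi_2}$. The expressions $\left(\operatorname{Im}\frac1\psi\frac{\partial\psi}{\partial t}\right)|\psi|^2$ and $\left(\operatorname{Im}\frac{\nabla\psi}{\psi}\right)|\psi|^2$ mean $\operatorname{Im}(\bar\psi\,\partial_t\psi)$ and $\operatorname{Im}(\bar\psi\,\nabla\psi)$. Here $\nabla$, $\nabla\cdot$, $\nabla\times$ are the gradient, divergence and curl in $x\in\mathbb{R}^3$. Solutions are understood in the weak sense. A solution of the stated form has finite energy if and only if $u\in H^1(\mathbb{R}^3)$ and $\phi\in D$, where $D$ is the completion of $C_0^\infty(\mathbb{R}^3)$ with respect to the inner product $(v\mid w)_D=\int_{\mathbb{R}^3}\nabla v\cdot\nabla w\,dx$ (a space of functions contained in $L^6(\mathbb{R}^3)$). Nontrivial means $u\not\equiv0$. *)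

theory Defs
  imports "HOL-Analysis.Analysis"
begin

definition pd :: "'a::euclidean_space \<Rightarrow> ('a \<Rightarrow> 'b::real_normed_vector) \<Rightarrow> 'a \<Rightarrow> 'b" where
  "pd b f x = frechet_derivative f (at x) b"

primrec class_C :: "nat \<Rightarrow> ('a::euclidean_space \<Rightarrow> 'b::real_normed_vector) \<Rightarrow> bool" where
  "class_C 0 f \<longleftrightarrow> continuous_on UNIV f"
| "class_C (Suc k) f \<longleftrightarrow> (\<forall>x. f differentiable (at x)) \<and> (\<forall>b\<in>Basis. class_C k (pd b f))"

definition test_function :: "('a::euclidean_space \<Rightarrow> 'b::real_normed_vector) \<Rightarrow> bool" where
  "test_function f \<longleftrightarrow> (\<forall>k. class_C k f) \<and> compact (closure {x. f x \<noteq> 0})"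

definition locally_integrable :: "('a::euclidean_space \<Rightarrow> 'b::euclidean_space) \<Rightarrow> bool" where
  "locally_integrable f \<longleftrightarrow> (\<forall>K. compact K \<longrightarrow> set_integrable lborel K f)"

definition weak_pd :: "'a::euclidean_space \<Rightarrow> ('a \<Rightarrow> 'b::euclidean_space) \<Rightarrow> ('a \<Rightarrow> 'b) \<Rightarrow> bool" where
  "weak_pd b f g \<longleftrightarrow> locally_integrable f \<and> locally_integrable g \<and>
     (\<forall>\<eta> :: 'a \<Rightarrow> real. test_function \<eta> \<longrightarrow>
        (\<integral>x. pd b \<eta> x *\<^sub>R f x \<partial>lborel) = - (\<integral>x. \<eta> x *\<^sub>R g x \<partial>lborel))"

definition square_integrable :: "('a::euclidean_space \<Rightarrow> real) \<Rightarrow> bool" where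
  "square_integrable f \<longleftrightarrow> f \<in> borel_measurable lborel \<and> integrable lborel (\<lambda>x. (f x)\<^sup>2)"

definition H1 :: "(real^3 \<Rightarrow> real) set" where
  "H1 = {u. square_integrable u \<and> (\<forall>j. \<exists>g. weak_pd (axis j 1) u g \<and> square_integrable g)}"

definition grad :: "(real^3 \<Rightarrow> real) \<Rightarrow> real^3 \<Rightarrow> real^3" where
  "grad v x = (\<chi> j. pd (axis j 1) v x)"

definition D_inner :: "(real^3 \<Rightarrow> real) \<Rightarrow> (real^3 \<Rightarrow> real) \<Rightarrow> real" where
  "D_inner v w = (\<integral>x. grad v x \<bullet> grad w x \<partial>lborel)"

text \<open>
  The completion of the test functions for \<^const>\<open>D_inner\<close>, realised as a space of functions:
  by the Sobolev inequality a Cauchy sequence for this inner product converges in \<open>L\<^sup>6\<close>, and the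
  element of the completion it represents is identified with its \<open>L\<^sup>6\<close> limit.
\<close>

definition D_space :: "(real^3 \<Rightarrow> real) set" where
  "D_space = {v. v \<in> borel_measurable lborel \<and> (\<exists>s :: nat \<Rightarrow> real^3 \<Rightarrow> real.
      (\<forall>n. test_function (s n)) \<and>
      (\<forall>e>0. \<exists>N. \<forall>m\<ge>N. \<forall>n\<ge>N.
         sqrt (D_inner (\<lambda>x. s m x - s n x) (\<lambda>x. s m x - s n x)) < e) \<and>
      (\<lambda>n. \<integral>\<^sup>+x. ennreal (\<bar>s n x - v x\<bar> ^ 6) \<partial>lborel) \<longlonglongrightarrow> 0)}"

type_synonym spacetime = "real \<times> (real^3)"

definition e_t :: spacetime where "e_t = (1, 0)"
definition e_x :: "3 \<Rightarrow> spacetime" where "e_x j = (0, axis j 1)"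

definition W_grad :: "(complex \<Rightarrow> real) \<Rightarrow> complex \<Rightarrow> complex" where
  "W_grad W \<psi> = Complex (pd 1 W \<psi>) (pd \<i> W \<psi>)"

text \<open>The curl of a vector field with partial derivatives \<open>dF j\<close> in direction \<open>j\<close>.\<close>

definition curl :: "(3 \<Rightarrow> real^3) \<Rightarrow> real^3" where
  "curl dF = vector [dF 2 $ 3 - dF 3 $ 2, dF 3 $ 1 - dF 1 $ 3, dF 1 $ 2 - dF 2 $ 1]"

text \<open>
  Weak solutions on \<open>\<real> \<times> \<real>\<^sup>3\<close>: the first derivatives occurring in the equations are weak
  derivatives (\<open>\<psi>t\<close>, \<open>\<psi>x j\<close>, \<open>\<phi>x j\<close>, \<open>At\<close>, \<open>Ax j\<close>), and the outer derivative of each second order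
  term is moved onto the test function. Since \<open>\<phi>\<close> and \<open>A\<close> are real, the formal adjoint of each
  covariant derivative (with respect to the \<open>L\<^sup>2\<close> product of complex functions) is its negative.
\<close>

definition weak_KGM_solution ::
  "(complex \<Rightarrow> real) \<Rightarrow> real \<Rightarrow>
   (spacetime \<Rightarrow> complex) \<Rightarrow> (spacetime \<Rightarrow> real) \<Rightarrow> (spacetime \<Rightarrow> real^3) \<Rightarrow> bool" where
  "weak_KGM_solution W q \<psi> \<phi> A \<longleftrightarrow>
    (\<exists>(\<psi>t :: spacetime \<Rightarrow> complex) (\<psi>x :: 3 \<Rightarrow> spacetime \<Rightarrow> complex)
      (\<phi>x :: 3 \<Rightarrow> spacetime \<Rightarrow> real)
      (At :: spacetime \<Rightarrow> real^3) (Ax :: 3 \<Rightarrow> spacetime \<Rightarrow> real^3).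
      weak_pd e_t \<psi> \<psi>t \<and> (\<forall>j. weak_pd (e_x j) \<psi> (\<psi>x j)) \<and>
      (\<forall>j. weak_pd (e_x j) \<phi> (\<phi>x j)) \<and>
      weak_pd e_t A At \<and> (\<forall>j. weak_pd (e_x j) A (Ax j)) \<and>
      (\<forall>\<eta> :: spacetime \<Rightarrow> complex. test_function \<eta> \<longrightarrow>
        has_bochner_integral lborel (\<lambda>z.
          - (\<psi>t z + \<i> * of_real (q * \<phi> z) * \<psi> z) * cnj (pd e_t \<eta> z + \<i> * of_real (q * \<phi> z) * \<eta> z)
          + (\<Sum>j\<in>UNIV. (\<psi>x j z - \<i> * of_real (q * A z $ j) * \<psi> z)
                       * cnj (pd (e_x j) \<eta> z - \<i> * of_real (q * A z $ j) * \<eta> z))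
          + W_grad W (\<psi> z) * cnj (\<eta> z)) 0) \<and>
      (\<forall>\<eta> :: spacetime \<Rightarrow> real. test_function \<eta> \<longrightarrow>
        has_bochner_integral lborel (\<lambda>z.
          (At z + (\<chi> j. \<phi>x j z)) \<bullet> (\<chi> j. pd (e_x j) \<eta> z)
          + q * (Im (cnj (\<psi> z) * \<psi>t z) + q * \<phi> z * (cmod (\<psi> z))\<^sup>2) * \<eta> z) 0) \<and>
      (\<forall>\<zeta> :: spacetime \<Rightarrow> real^3. test_function \<zeta> \<longrightarrow>
        has_bochner_integral lborel (\<lambda>z.
          curl (\<lambda>j. Ax j z) \<bullet> curl (\<lambda>j. pd (e_x j) \<zeta> z)
          - (At z + (\<chi> j. \<phi>x j z)) \<bullet> pd e_t \<zeta> z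
          - (q *\<^sub>R ((\<chi> j. Im (cnj (\<psi> z) * \<psi>x j z)) - (q * (cmod (\<psi> z))\<^sup>2) *\<^sub>R A z)) \<bullet> \<zeta> z) 0))"

end

theory Submission
  imports Defs "HOL-Computational_Algebra.Polynomial" "HOL-Real_Asymp.Real_Asymp"
begin

text \<open>
  With \<open>\<Omega> = \<omega> - q \<phi>\<close> a radial standing wave solves \<open>\<Delta>u = W'(u) - \<Omega>\<^sup>2 u\<close>, \<open>\<Delta>\<Omega> = q\<^sup>2 u\<^sup>2 \<Omega>\<close>. Since \<open>\<omega>\<close> is not
  prescribed, one may fix \<open>\<Omega>(0) = b\<close> and shoot in the amplitude \<open>a = u(0)\<close> alone.

  By \<open>W\<^sub>4\<close> the quotient \<open>W(s)/s\<^sup>2\<close> is nonincreasing, and by \<open>W\<^sub>2\<close> and \<open>W\<^sub>3\<close> it is not constant. Choose \<open>s\<^sub>1\<close> where its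
  derivative is negative, \<open>b\<^sup>2 = 2 W(s\<^sub>1)/s\<^sub>1\<^sup>2 < m\<^sub>0\<^sup>2\<close>, and \<open>b' > b\<close> close to \<open>b\<close>; truncate \<open>\<Omega>\<close> to \<open>[b, b']\<close>. As long as
  \<open>u' \<le> 0\<close>, the energy \<open>u'\<^sup>2/2 + b'\<^sup>2u\<^sup>2/2 - W(u)\<close> decreases. Amplitudes whose solution turns around or acquires negative
  energy while still positive form an open set; it contains amplitudes just below \<open>s\<^sub>1\<close> but no very large ones. At its
  supremum \<open>u\<close> is positive and nonincreasing forever, with nonnegative energy. This forces \<open>u\<close> to become small
  within a time that does not depend on \<open>q\<close>, after which it decays exponentially. Hence \<open>\<Omega>\<close> grows by \<open>O(q\<^sup>2)\<close>
  only, and for small \<open>q\<close> the truncation is inactive.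
\<close>

section \<open>Radial second-order systems\<close>

text \<open>Fixing \<open>Om\<close> at the origin instead of \<open>\<omega>\<close> turns the
  coupled system into an initial value problem; otherwise the potential would depend on the whole
  profile. The frequency comes out as the limit of \<open>Om\<close> at infinity, and
  \<open>\<phi> = (\<omega> - Om) / q\<close> then decays like 1/r. The choice of b puts s1 at the
  zero of the potential b^2 s^2/2 - W(s): it is negative below s1, while from s1 on the force b^2 s
  - W'(s) is positive and drives u down. Clipping u to [0, A] as well makes the vector field bounded
  and globally Lipschitz, so solutions live on the whole half-line and depend continuously on the
  amplitude. The delicate point is that the solution at the supremum might reach zero. There its
  slope cannot vanish, by backward uniqueness, so the crossing is transversal and has positive
  energy; nearby amplitudes then cross too, which contradicts that the open set accumulates at the
  supremum. Every constant in the later estimates is fixed before q, so a single bound on q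
  suffices.\<close>

definition ray_mean :: "(real \<Rightarrow> 'a::banach) \<Rightarrow> real \<Rightarrow> 'a" where
  "ray_mean g s = integral {0..1} (\<lambda>t. t\<^sup>2 *\<^sub>R g (s * t))"

lemma continuous_on_ray_mean_param:
  fixes g :: "'c::topological_space \<Rightarrow> real \<Rightarrow> 'a::banach"
  assumes "continuous_on UNIV (\<lambda>(c, r). g c r)"
  shows "continuous_on UNIV (\<lambda>(c, s). ray_mean (g c) s)"
proof -
  have "continuous_on (UNIV \<times> cbox 0 1) (\<lambda>z. (fst (fst z), snd (fst z) * snd z) :: 'c \<times> real)"
    by (intro continuous_intros)
  from continuous_on_compose2[OF assms this]
  have "continuous_on (UNIV \<times> cbox 0 1) (\<lambda>z. g (fst (fst z)) (snd (fst z) * snd z))"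
    by (simp add: case_prod_unfold)
  then have "continuous_on (UNIV \<times> cbox 0 1) (\<lambda>(p, t). t\<^sup>2 *\<^sub>R g (fst p) (snd p * t))"
    unfolding case_prod_unfold by (intro continuous_intros)
  from integral_continuous_on_param[OF this] show ?thesis
    by (simp add: ray_mean_def case_prod_unfold)
qed

lemma continuous_on_ray_mean:
  fixes g :: "real \<Rightarrow> 'a::banach"
  assumes "continuous_on UNIV g"
  shows "continuous_on UNIV (ray_mean g)"
proof -
  have "continuous_on UNIV (\<lambda>(c::real, r). g r)"
    using continuous_on_compose2[OF assms, of UNIV snd] by (simp add: case_prod_unfold continuous_on_snd)
  from continuous_on_ray_mean_param[OF this]
  have c: "continuous_on UNIV (\<lambda>p::real \<times> real. ray_mean g (snd p))" by (simp add: case_prod_unfold)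
  show ?thesis
    using continuous_on_compose2[OF c, of UNIV "\<lambda>s. (0::real, s)"]
    by (simp add: continuous_on_Pair)
qed

lemma norm_ray_mean_diff_le:
  fixes g g' :: "real \<Rightarrow> 'a::banach"
  assumes "continuous_on UNIV g" "continuous_on UNIV g'"
    and "\<And>t. t \<in> {0..1} \<Longrightarrow> norm (g (s * t) - g' (s * t)) \<le> B"
  shows "norm (ray_mean g s - ray_mean g' s) \<le> B"
proof -
  have c: "continuous_on {0..1} (\<lambda>t. t\<^sup>2 *\<^sub>R g (s * t))" "continuous_on {0..1} (\<lambda>t. t\<^sup>2 *\<^sub>R g' (s * t))"
    by (auto intro!: continuous_intros continuous_on_compose2[OF assms(1)] continuous_on_compose2[OF assms(2)])
  have "ray_mean g s - ray_mean g' s = integral {0..1} (\<lambda>t. t\<^sup>2 *\<^sub>R g (s * t) - t\<^sup>2 *\<^sub>R g' (s * t))"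
    unfolding ray_mean_def using c by (intro integral_diff[symmetric] integrable_continuous_real)
  also have "norm \<dots> \<le> B * (1 - 0)"
  proof (rule integral_bound)
    fix t :: real assume t: "t \<in> {0..1}"
    have "norm (t\<^sup>2 *\<^sub>R g (s * t) - t\<^sup>2 *\<^sub>R g' (s * t)) = t\<^sup>2 * norm (g (s * t) - g' (s * t))"
      by (simp flip: scaleR_diff_right)
    also have "\<dots> \<le> 1 * norm (g (s * t) - g' (s * t))"
      using t by (intro mult_right_mono) (auto simp: power_le_one)
    also have "\<dots> \<le> B" using assms(3)[OF t] by simp
    finally show "norm (t\<^sup>2 *\<^sub>R g (s * t) - t\<^sup>2 *\<^sub>R g' (s * t)) \<le> B" .
  qed (auto intro!: continuous_on_diff c)
  finally show ?thesis by simp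
qed

lemma norm_ray_mean_le:
  fixes g :: "real \<Rightarrow> 'a::banach"
  assumes "continuous_on UNIV g" "\<And>t. t \<in> {0..1} \<Longrightarrow> norm (g (s * t)) \<le> B"
  shows "norm (ray_mean g s) \<le> B"
  using norm_ray_mean_diff_le[OF assms(1) continuous_on_const[of _ 0], of s B] assms(2)
  by (simp add: ray_mean_def)

text \<open>Substituting \<open>s = r t\<close>: \<open>r *\<^sub>R ray_mean g r\<close> is r^(-2)
  times the integral of \<open>s\<^sup>2 *\<^sub>R g s\<close>, the once integrated radial Laplacian
  in dimension three. The mean over the fixed interval [0, 1] stays continuous at the origin, where
  a quotient by r^3 would be singular.\<close>

lemma cube_ray_mean:
  fixes g :: "real \<Rightarrow> 'a::banach"
  assumes "continuous_on UNIV g" "r > 0"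
  shows "r^3 *\<^sub>R ray_mean g r = integral {0..r} (\<lambda>s. s\<^sup>2 *\<^sub>R g s)"
proof -
  have "continuous_on {0..r} (\<lambda>s. s\<^sup>2 *\<^sub>R g s)"
    using continuous_on_subset[OF assms(1)] by (auto intro!: continuous_intros)
  then have "((\<lambda>s. s\<^sup>2 *\<^sub>R g s) has_integral integral {0..r} (\<lambda>s. s\<^sup>2 *\<^sub>R g s)) (cbox 0 r)"
    by (simp add: integrable_integral integrable_continuous_real)
  from has_integral_affinity[OF this, of r 0] assms(2)
  have "((\<lambda>t. (r * t)\<^sup>2 *\<^sub>R g (r * t)) has_integral (1 / r) *\<^sub>R integral {0..r} (\<lambda>s. s\<^sup>2 *\<^sub>R g s)) ((\<lambda>x. x / r) ` {0..r})"
    by simp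
  moreover have "(\<lambda>x. x / r) ` {0..r} = {0..1}"
    using assms(2) by (auto simp: image_iff field_simps intro!: bexI[where x="r * _"])
  ultimately have 1: "((\<lambda>t. (r * t)\<^sup>2 *\<^sub>R g (r * t)) has_integral (1 / r) *\<^sub>R integral {0..r} (\<lambda>s. s\<^sup>2 *\<^sub>R g s)) {0..1}"
    by simp
  have "((\<lambda>t. t\<^sup>2 *\<^sub>R g (r * t)) has_integral ray_mean g r) {0..1}"
    unfolding ray_mean_def
    by (intro integrable_integral integrable_continuous_real continuous_intros
        continuous_on_compose2[OF assms(1)]) auto
  from has_integral_cmul[OF this, of "r\<^sup>2"]
  have "((\<lambda>t. (r * t)\<^sup>2 *\<^sub>R g (r * t)) has_integral r\<^sup>2 *\<^sub>R ray_mean g r) {0..1}"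
    by (simp add: power_mult_distrib)
  from has_integral_unique[OF this 1]
  have "r *\<^sub>R (r\<^sup>2 *\<^sub>R ray_mean g r) = integral {0..r} (\<lambda>s. s\<^sup>2 *\<^sub>R g s)" using assms(2) by simp
  then show ?thesis by (simp add: power3_eq_cube power2_eq_square mult.assoc)
qed

lemma ray_mean_has_vector_derivative:
  fixes g :: "real \<Rightarrow> 'a::banach"
  assumes "continuous_on UNIV g" "r > 0"
  shows "((\<lambda>r. r^3 *\<^sub>R ray_mean g r) has_vector_derivative r\<^sup>2 *\<^sub>R g r) (at r)"
proof -
  have "continuous_on {0..r+1} (\<lambda>s. s\<^sup>2 *\<^sub>R g s)"
    using continuous_on_subset[OF assms(1)] by (auto intro!: continuous_intros)
  then have "((\<lambda>r. integral {0..r} (\<lambda>s. s\<^sup>2 *\<^sub>R g s)) has_vector_derivative r\<^sup>2 *\<^sub>R g r) (at r within {0..r+1})"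
    using assms(2) by (intro integral_has_vector_derivative) auto
  then have "((\<lambda>r. integral {0..r} (\<lambda>s. s\<^sup>2 *\<^sub>R g s)) has_vector_derivative r\<^sup>2 *\<^sub>R g r) (at r)"
    using assms(2) by (subst (asm) at_within_Icc_at) auto
  then show ?thesis
    by (rule has_vector_derivative_transform_within_open[where S="{0<..}"])
       (use assms in \<open>auto simp: cube_ray_mean\<close>)
qed

text \<open>Setting for \<Delta>z = F(z) with z radial, written as z' = r h and (r^3 h)' = r^2 F(z).
  A bounded, globally Lipschitz field allows a single contraction on the entire half-line.\<close>

locale radial_ode =
  fixes F :: "'a::banach \<Rightarrow> 'a" and L M :: real
  assumes L_nonneg: "0 \<le> L"
    and lip: "norm (F x - F y) \<le> L * norm (x - y)"
    and bdd: "norm (F x) \<le> M"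
begin

text \<open>The Picard iteration runs in a norm weighted by exp(-lam r^2). The kernel s ds
  integrates exp(lam s^2) to at most exp(lam r^2) / (2 lam), so the contraction factor is L / (2
  lam), at most 1/2 for this choice.\<close>

definition lam :: real where "lam = L + 1"

lemma lam_pos: "lam > 0" and L_lam: "L / (2 * lam) \<le> 1/2"
  using L_nonneg by (auto simp: lam_def field_simps)

lemma M_nonneg: "0 \<le> M" using order_trans[OF norm_ge_zero bdd] .

lemma continuous_F: "continuous_on S F"
  by (rule continuous_on_subset[OF lipschitz_on_continuous_on[of L]])
     (use L_nonneg lip in \<open>auto simp: lipschitz_on_def dist_norm\<close>)

text \<open>\<open>z\<close> is the unknown multiplied by the weight
  \<open>exp (- (lam * s\<^sup>2))\<close>, so that growing solutions correspond to bounded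
  continuous functions.\<close>

definition rhs :: "(real \<Rightarrow>\<^sub>C 'a) \<Rightarrow> real \<Rightarrow> 'a" where
  "rhs z s = F (exp (lam * s\<^sup>2) *\<^sub>R apply_bcontfun z s)"

text \<open>The modulus of \<open>r\<close> extends the half-line problem evenly, because the
  complete space of bounded continuous functions lives on the whole real line.\<close>

definition picard :: "'a \<Rightarrow> (real \<Rightarrow>\<^sub>C 'a) \<Rightarrow> real \<Rightarrow> 'a" where
  "picard c z r = exp (- (lam * r\<^sup>2)) *\<^sub>R (c + integral {0..\<bar>r\<bar>} (\<lambda>s. s *\<^sub>R ray_mean (rhs z) s))"

lemma continuous_rhs: "continuous_on UNIV (rhs z)"
  unfolding rhs_def
  by (intro continuous_on_compose2[OF continuous_F[of UNIV]] continuous_intros) auto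

lemma continuous_integrand: "continuous_on S (\<lambda>s. s *\<^sub>R ray_mean (rhs z) s)"
  by (intro continuous_intros continuous_on_subset[OF continuous_on_ray_mean[OF continuous_rhs]]) auto

lemma continuous_on_integral_abs:
  fixes f :: "real \<Rightarrow> 'a"
  assumes "continuous_on UNIV f"
  shows "continuous_on UNIV (\<lambda>r. integral {0..\<bar>r\<bar>} f)"
proof (subst continuous_on_eq_continuous_at[OF open_UNIV], intro ballI)
  fix r :: real
  have "continuous_on {0..\<bar>r\<bar>+1} (\<lambda>r. integral {0..r} f)"
    by (intro indefinite_integral_continuous_1 integrable_continuous_real continuous_on_subset[OF assms]) auto
  then have "continuous_on {-\<bar>r\<bar>-1..\<bar>r\<bar>+1} (\<lambda>r. integral {0..\<bar>r\<bar>} f)"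
    by (rule continuous_on_compose2) (auto intro!: continuous_intros)
  then show "isCont (\<lambda>r. integral {0..\<bar>r\<bar>} f) r"
    by (rule continuous_on_interior) (auto simp: interior_cbox[of "-\<bar>r\<bar>-1" "\<bar>r\<bar>+1", simplified] )
qed

lemma continuous_picard: "continuous_on UNIV (picard c z)"
  unfolding picard_def
  by (intro continuous_intros continuous_on_integral_abs continuous_integrand)

text \<open>Since \<open>F\<close> is bounded, the integral grows at most like M r^2, and the weight
  absorbs this through lam r^2 <= exp(lam r^2). The iteration therefore stays among bounded
  functions.\<close>

lemma norm_picard_le: "norm (picard c z r) \<le> norm c + M / lam"
proof -
  have "norm (integral {0..\<bar>r\<bar>} (\<lambda>s. s *\<^sub>R ray_mean (rhs z) s)) \<le> (\<bar>r\<bar> * M) * (\<bar>r\<bar> - 0)"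
  proof (rule integral_bound)
    fix t assume t: "t \<in> {0..\<bar>r\<bar>}"
    have "norm (ray_mean (rhs z) t) \<le> M"
      by (rule norm_ray_mean_le[OF continuous_rhs]) (simp add: rhs_def bdd)
    then show "norm (t *\<^sub>R ray_mean (rhs z) t) \<le> \<bar>r\<bar> * M"
      using t by (auto intro!: mult_mono)
  qed (auto intro!: continuous_integrand)
  also have "\<dots> = M * r\<^sup>2" by (simp add: power2_eq_square algebra_simps flip: abs_mult)
  finally have 1: "norm (integral {0..\<bar>r\<bar>} (\<lambda>s. s *\<^sub>R ray_mean (rhs z) s)) \<le> M * r\<^sup>2" .
  have "lam * r\<^sup>2 \<le> exp (lam * r\<^sup>2)" using exp_ge_add_one_self[of "lam * r\<^sup>2"] by linarith
  then have 2: "exp (- (lam * r\<^sup>2)) * r\<^sup>2 \<le> 1 / lam"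
    using lam_pos by (simp add: exp_minus field_simps)
  have "norm (picard c z r) \<le> exp (- (lam * r\<^sup>2)) * (norm c + M * r\<^sup>2)"
    unfolding picard_def using 1 by (auto intro!: mult_left_mono order_trans[OF norm_triangle_ineq])
  also have "\<dots> = exp (- (lam * r\<^sup>2)) * norm c + M * (exp (- (lam * r\<^sup>2)) * r\<^sup>2)"
    by (simp add: algebra_simps)
  also have "\<dots> \<le> 1 * norm c + M * (1 / lam)"
    using lam_pos by (intro add_mono mult_right_mono mult_left_mono 2 M_nonneg) auto
  finally show ?thesis by simp
qed

definition picard_op :: "'a \<Rightarrow> (real \<Rightarrow>\<^sub>C 'a) \<Rightarrow> real \<Rightarrow>\<^sub>C 'a" where
  "picard_op c z = Bcontfun (picard c z)"

lemma apply_picard_op: "apply_bcontfun (picard_op c z) = picard c z"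
  unfolding picard_op_def
  by (rule Bcontfun_inverse) (rule bcontfun_normI[OF continuous_picard norm_picard_le])

lemma exp_integral:
  "((\<lambda>s. s * exp (lam * s\<^sup>2)) has_integral (exp (lam * r\<^sup>2) - 1) / (2 * lam)) {0..\<bar>r\<bar>}"
proof -
  have "((\<lambda>s. s * exp (lam * s\<^sup>2)) has_integral
      (exp (lam * \<bar>r\<bar>\<^sup>2) / (2 * lam) - exp (lam * 0\<^sup>2) / (2 * lam))) {0..\<bar>r\<bar>}"
    using lam_pos
    by (intro fundamental_theorem_of_calculus)
       (auto intro!: derivative_eq_intros simp flip: has_real_derivative_iff_has_vector_derivative)
  then show ?thesis by (simp add: diff_divide_distrib)
qed

text \<open>The ray mean at \<open>s\<close> only sees the points \<open>s * t\<close> with t <= 1,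
  where the inverse weight is at most exp(lam s^2). The initial values vary together with the
  functions, so that the same estimate gives Lipschitz dependence of the fixed point on
  \<open>c\<close>.\<close>

lemma picard_contraction: "dist (picard_op c z) (picard_op c' z') \<le> norm (c - c') + 1/2 * dist z z'"
proof (rule dist_bound)
  fix r
  let ?I = "\<lambda>z. integral {0..\<bar>r\<bar>} (\<lambda>s. s *\<^sub>R ray_mean (rhs z) s)"
  have pt: "norm (ray_mean (rhs z) s - ray_mean (rhs z') s) \<le> L * exp (lam * s\<^sup>2) * dist z z'" for s
  proof (rule norm_ray_mean_diff_le[OF continuous_rhs continuous_rhs])
    fix t :: real assume t: "t \<in> {0..1}"
    have "norm (rhs z (s * t) - rhs z' (s * t))
        \<le> L * norm (exp (lam * (s*t)\<^sup>2) *\<^sub>R apply_bcontfun z (s*t) - exp (lam * (s*t)\<^sup>2) *\<^sub>R apply_bcontfun z' (s*t))"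
      unfolding rhs_def by (rule lip)
    also have "\<dots> = L * (exp (lam * (s*t)\<^sup>2) * dist (apply_bcontfun z (s*t)) (apply_bcontfun z' (s*t)))"
      by (simp add: dist_norm flip: scaleR_diff_right)
    also have "\<dots> \<le> L * (exp (lam * s\<^sup>2) * dist z z')"
    proof (intro mult_left_mono mult_mono L_nonneg)
      have "(s * t)\<^sup>2 \<le> s\<^sup>2 * 1"
        unfolding power_mult_distrib using t by (intro mult_left_mono) (auto simp: power_le_one)
      then show "exp (lam * (s*t)\<^sup>2) \<le> exp (lam * s\<^sup>2)" using lam_pos by simp
    qed (auto simp: dist_bounded)
    finally show "norm (rhs z (s * t) - rhs z' (s * t)) \<le> L * exp (lam * s\<^sup>2) * dist z z'"
      by (simp add: mult.assoc)
  qed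
  have "norm (?I z - ?I z') = norm (integral {0..\<bar>r\<bar>} (\<lambda>s. s *\<^sub>R ray_mean (rhs z) s - s *\<^sub>R ray_mean (rhs z') s))"
    by (subst integral_diff) (auto intro!: integrable_continuous_real continuous_integrand)
  also have "\<dots> \<le> integral {0..\<bar>r\<bar>} (\<lambda>s. (L * dist z z') * (s * exp (lam * s\<^sup>2)))"
  proof (rule integral_norm_bound_integral)
    fix s assume "s \<in> {0..\<bar>r\<bar>}"
    then show "norm (s *\<^sub>R ray_mean (rhs z) s - s *\<^sub>R ray_mean (rhs z') s) \<le> (L * dist z z') * (s * exp (lam * s\<^sup>2))"
      using mult_left_mono[OF pt[of s], of s] by (simp add: algebra_simps flip: scaleR_diff_right)
  qed (auto intro!: integrable_continuous_real continuous_on_diff continuous_integrand continuous_intros)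
  also have "\<dots> = L * dist z z' * ((exp (lam * r\<^sup>2) - 1) / (2 * lam))"
    using integral_unique[OF exp_integral, of r] by (simp only: integral_mult_right)
  also have "\<dots> \<le> L * dist z z' * (exp (lam * r\<^sup>2) / (2 * lam))"
    using lam_pos L_nonneg by (intro mult_left_mono divide_right_mono) auto
  finally have I: "norm (?I z - ?I z') \<le> exp (lam * r\<^sup>2) * (L / (2 * lam) * dist z z')"
    by (simp add: algebra_simps)
  have "picard c z r - picard c' z' r = exp (- (lam * r\<^sup>2)) *\<^sub>R ((c - c') + (?I z - ?I z'))"
    unfolding picard_def scaleR_diff_right[symmetric] by (rule arg_cong[where f="scaleR _"]) simp
  then have "dist (picard c z r) (picard c' z' r) = exp (- (lam * r\<^sup>2)) * norm ((c - c') + (?I z - ?I z'))"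
    by (simp add: dist_norm)
  also have "\<dots> \<le> exp (- (lam * r\<^sup>2)) * (norm (c - c') + exp (lam * r\<^sup>2) * (L / (2 * lam) * dist z z'))"
    by (intro mult_left_mono order_trans[OF norm_triangle_ineq] add_mono I) auto
  also have "\<dots> = exp (- (lam * r\<^sup>2)) * norm (c - c') + L / (2 * lam) * dist z z'"
    by (simp add: algebra_simps exp_minus)
  also have "\<dots> \<le> 1 * norm (c - c') + 1/2 * dist z z'"
    using lam_pos L_lam by (intro add_mono mult_right_mono) auto
  finally show "dist (apply_bcontfun (picard_op c z) r) (apply_bcontfun (picard_op c' z') r)
      \<le> norm (c - c') + 1/2 * dist z z'" by (simp add: apply_picard_op)
qed

lemma picard_fixpoint: "\<exists>z. picard_op c z = z"
  using banach_fix_type[of "1/2" "picard_op c"] picard_contraction[of c _ c] by auto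

definition fixpt :: "'a \<Rightarrow> real \<Rightarrow>\<^sub>C 'a" where "fixpt c = (SOME z. picard_op c z = z)"

lemma fixpt: "picard_op c (fixpt c) = fixpt c"
  unfolding fixpt_def by (rule someI_ex[OF picard_fixpoint])

lemma dist_fixpt: "dist (fixpt c) (fixpt c') \<le> 2 * norm (c - c')"
  using picard_contraction[of c "fixpt c" c' "fixpt c'"] by (simp add: fixpt)

definition sol :: "'a \<Rightarrow> real \<Rightarrow> 'a" where
  "sol c r = exp (lam * r\<^sup>2) *\<^sub>R apply_bcontfun (fixpt c) r"

definition slope :: "'a \<Rightarrow> real \<Rightarrow> 'a" where
  "slope c r = ray_mean (\<lambda>r. F (sol c r)) r"

lemma sol_integral: "sol c r = c + integral {0..\<bar>r\<bar>} (\<lambda>s. s *\<^sub>R slope c s)"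
proof -
  have "rhs (fixpt c) = (\<lambda>r. F (sol c r))" by (auto simp: rhs_def sol_def)
  moreover have "apply_bcontfun (fixpt c) r = picard c (fixpt c) r"
    by (metis apply_picard_op fixpt)
  ultimately show ?thesis
    by (simp add: sol_def picard_def slope_def exp_minus)
qed

lemma sol_0: "sol c 0 = c"
  by (simp add: sol_integral)

lemma norm_sol_diff_le: "norm (sol c r - sol c' r) \<le> 2 * exp (lam * r\<^sup>2) * norm (c - c')"
proof -
  have "norm (sol c r - sol c' r) = exp (lam * r\<^sup>2) * dist (apply_bcontfun (fixpt c) r) (apply_bcontfun (fixpt c') r)"
    by (simp add: sol_def dist_norm flip: scaleR_diff_right)
  also have "\<dots> \<le> exp (lam * r\<^sup>2) * (2 * norm (c - c'))"
    using dist_bounded[of "fixpt c" r "fixpt c'"] dist_fixpt[of c c'] by (intro mult_left_mono) auto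
  finally show ?thesis by simp
qed

lemma continuous_sol: "continuous_on S (sol c)"
  unfolding sol_def by (intro continuous_intros) auto

text \<open>Lipschitz dependence on the initial value, with a constant locally bounded in
  \<open>r\<close>, is combined with continuity in \<open>r\<close> at a fixed initial
  value.\<close>

lemma continuous_sol2: "continuous_on UNIV (\<lambda>(c, r). sol c r)"
proof (subst continuous_on_eq_continuous_at[OF open_UNIV], intro ballI)
  fix p :: "'a \<times> real"
  obtain c r where p: "p = (c, r)" by force
  have "continuous_on UNIV (\<lambda>q. 2 * exp (lam * (snd q)\<^sup>2) * norm (fst q - c) + norm (sol c (snd q) - sol c r))"
    by (intro continuous_intros continuous_on_compose2[OF continuous_sol[of UNIV c]]) simp
  then have 1: "((\<lambda>q. 2 * exp (lam * (snd q)\<^sup>2) * norm (fst q - c) + norm (sol c (snd q) - sol c r)) \<longlongrightarrow>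
      2 * exp (lam * (snd p)\<^sup>2) * norm (fst p - c) + norm (sol c (snd p) - sol c r)) (at p)"
    unfolding continuous_on_def using UNIV_I[of p] by blast
  have "((\<lambda>q. sol (fst q) (snd q) - sol c r) \<longlongrightarrow> 0) (at p)"
  proof (rule Lim_null_comparison[where g="\<lambda>q. 2 * exp (lam * (snd q)\<^sup>2) * norm (fst q - c) + norm (sol c (snd q) - sol c r)"])
    show "\<forall>\<^sub>F q in at p. norm (sol (fst q) (snd q) - sol c r) \<le>
        2 * exp (lam * (snd q)\<^sup>2) * norm (fst q - c) + norm (sol c (snd q) - sol c r)"
    proof (intro always_eventually allI)
      fix q :: "'a \<times> real"
      have "norm (sol (fst q) (snd q) - sol c r) \<le> norm (sol (fst q) (snd q) - sol c (snd q)) + norm (sol c (snd q) - sol c r)"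
        using norm_triangle_ineq[of "sol (fst q) (snd q) - sol c (snd q)" "sol c (snd q) - sol c r"] by simp
      then show "norm (sol (fst q) (snd q) - sol c r) \<le>
        2 * exp (lam * (snd q)\<^sup>2) * norm (fst q - c) + norm (sol c (snd q) - sol c r)"
        using norm_sol_diff_le[of "fst q" "snd q" c] by linarith
    qed
    show "((\<lambda>q. 2 * exp (lam * (snd q)\<^sup>2) * norm (fst q - c) + norm (sol c (snd q) - sol c r)) \<longlongrightarrow> 0) (at p)"
      using 1 by (simp add: p)
  qed
  then show "isCont (\<lambda>(c, r). sol c r) p"
    by (simp add: isCont_def p case_prod_unfold LIM_zero_cancel)
qed

lemma continuous_F_sol: "continuous_on S (\<lambda>r. F (sol c r))"
  by (intro continuous_on_compose2[OF continuous_F[of UNIV]] continuous_sol) auto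

lemma continuous_slope: "continuous_on S (slope c)"
  unfolding slope_def
  by (rule continuous_on_subset[OF continuous_on_ray_mean[OF continuous_F_sol[of UNIV c]] subset_UNIV])

lemma continuous_slope2: "continuous_on UNIV (\<lambda>(c, r). slope c r)"
proof -
  have "continuous_on UNIV (\<lambda>(c, r). F (sol c r))"
    using continuous_on_compose2[OF continuous_F[of UNIV] continuous_sol2] by (simp add: case_prod_unfold)
  from continuous_on_ray_mean_param[OF this] show ?thesis by (simp add: slope_def)
qed

lemma sol_has_vector_derivative:
  assumes "r > 0" shows "(sol c has_vector_derivative r *\<^sub>R slope c r) (at r)"
proof -
  have "continuous_on {0..r+1} (\<lambda>s. s *\<^sub>R slope c s)"
    by (intro continuous_intros continuous_slope)
  then have "((\<lambda>r. integral {0..r} (\<lambda>s. s *\<^sub>R slope c s)) has_vector_derivative r *\<^sub>R slope c r) (at r within {0..r+1})"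
    using assms by (intro integral_has_vector_derivative) auto
  then have "((\<lambda>r. c + integral {0..r} (\<lambda>s. s *\<^sub>R slope c s)) has_vector_derivative r *\<^sub>R slope c r) (at r)"
    using assms by (subst (asm) at_within_Icc_at) (auto intro!: derivative_eq_intros)
  then show ?thesis
    by (rule has_vector_derivative_transform_within_open[where S="{0<..}"])
       (use assms in \<open>auto simp: sol_integral\<close>)
qed

lemma slope_has_vector_derivative:
  "r > 0 \<Longrightarrow> ((\<lambda>r. r^3 *\<^sub>R slope c r) has_vector_derivative r\<^sup>2 *\<^sub>R F (sol c r)) (at r)"
  unfolding slope_def by (rule ray_mean_has_vector_derivative[OF continuous_F_sol])

end

section \<open>Shooting\<close>

lemma nonincreasing_on_Icc:
  fixes g :: "real \<Rightarrow> real"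
  assumes "x \<le> y" "continuous_on {x..y} g"
    and "\<And>s. x < s \<Longrightarrow> s < y \<Longrightarrow> (g has_real_derivative g' s) (at s)"
    and "\<And>s. x < s \<Longrightarrow> s < y \<Longrightarrow> g' s \<le> 0"
  shows "g y \<le> g x"
  using DERIV_nonpos_imp_decreasing_open[OF assms(1) _ assms(2)] assms(3,4) by blast

text \<open>The function r^3 h - k r^3 / 3 has derivative r^2 (g - k) <= 0. This bounds the slope
  \<open>h\<close> in terms of the force without any information on h', and it works from x = 0
  on.\<close>

lemma cube_le:
  fixes h g :: "real \<Rightarrow> real"
  assumes "0 \<le> x" "x \<le> y" "continuous_on {x..y} h"
    and "\<And>s. x < s \<Longrightarrow> s < y \<Longrightarrow> ((\<lambda>r. r^3 * h r) has_real_derivative s\<^sup>2 * g s) (at s)"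
    and "\<And>s. x < s \<Longrightarrow> s < y \<Longrightarrow> g s \<le> k"
  shows "y^3 * h y \<le> x^3 * h x + k * (y^3 - x^3) / 3"
proof -
  have "y^3 * h y - k * y^3 / 3 \<le> x^3 * h x - k * x^3 / 3"
  proof (rule nonincreasing_on_Icc[OF assms(2), where g="\<lambda>y. y^3 * h y - k * y^3 / 3" and g'="\<lambda>s. s\<^sup>2 * (g s - k)"])
    show "continuous_on {x..y} (\<lambda>y. y^3 * h y - k * y^3 / 3)"
      by (intro continuous_intros assms) auto
    fix s assume s: "x < s" "s < y"
    show "((\<lambda>y. y^3 * h y - k * y^3 / 3) has_real_derivative s\<^sup>2 * (g s - k)) (at s)"
      by (rule derivative_eq_intros assms(4)[OF s] refl | simp add: algebra_simps)+
    show "s\<^sup>2 * (g s - k) \<le> 0" using assms(5)[OF s] by (simp add: mult_nonneg_nonpos)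
  qed
  then show ?thesis by (simp add: algebra_simps diff_divide_distrib)
qed

text \<open>The complement is the projection of a closed set along the compact interval: a
  subsequence of the witnesses converges inside the interval.\<close>

lemma open_forall_compact:
  fixes g :: "real \<Rightarrow> real \<Rightarrow> real"
  assumes "continuous_on UNIV (\<lambda>(a, s). g a s)"
  shows "open {a. \<forall>s\<in>{x..y}. 0 < g a s}"
proof -
  have "closed {a. \<exists>s\<in>{x..y}. g a s \<le> 0}"
    unfolding closed_sequential_limits
  proof (intro allI impI, elim conjE)
    fix X l assume X: "\<forall>n. X n \<in> {a. \<exists>s\<in>{x..y}. g a s \<le> 0}" and l: "X \<longlonglongrightarrow> l"
    then have "\<forall>n. \<exists>s. s \<in> {x..y} \<and> g (X n) s \<le> 0" by blast
    then obtain s where s: "\<And>n. s n \<in> {x..y}" "\<And>n. g (X n) (s n) \<le> 0" by metis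
    from compact_Icc[of x y, unfolded compact_def, rule_format, of s] s(1)
    obtain t r where t: "t \<in> {x..y}" and r: "strict_mono r" "(s \<circ> r) \<longlonglongrightarrow> t" by auto
    have "(\<lambda>n. (X (r n), s (r n))) \<longlonglongrightarrow> (l, t)"
      using LIMSEQ_subseq_LIMSEQ[OF l r(1)] r(2) by (intro tendsto_Pair) (auto simp: o_def)
    from continuous_on_tendsto_compose[OF assms this]
    have "(\<lambda>n. g (X (r n)) (s (r n))) \<longlonglongrightarrow> g l t" by simp
    then have "g l t \<le> 0" by (rule LIMSEQ_le_const2) (use s in auto)
    with t show "l \<in> {a. \<exists>s\<in>{x..y}. g a s \<le> 0}" by auto
  qed
  then have "open (- {a. \<exists>s\<in>{x..y}. g a s \<le> 0})" by (simp add: open_Compl)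
  also have "- {a. \<exists>s\<in>{x..y}. g a s \<le> 0} = {a. \<forall>s\<in>{x..y}. 0 < g a s}" by (auto simp: not_le)
  finally show ?thesis .
qed

lemma first_zero:
  fixes g :: "real \<Rightarrow> real"
  assumes "continuous_on UNIV g" "0 < g 0" "0 \<le> r" "g r \<le> 0"
  obtains r0 where "0 < r0" "r0 \<le> r" "g r0 = 0" "\<And>s. 0 \<le> s \<Longrightarrow> s < r0 \<Longrightarrow> 0 < g s"
proof -
  let ?Z = "{0..r} \<inter> g -` {..0}"
  have "closed ?Z"
    by (rule continuous_closed_preimage[OF continuous_on_subset[OF assms(1)]]) auto
  moreover have ne: "?Z \<noteq> {}" and bd: "bdd_below ?Z" using assms by (auto intro!: bdd_belowI[of _ 0])
  ultimately have Z: "Inf ?Z \<in> ?Z" by (rule closed_contains_Inf[rotated 2])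
  have pos: "0 < g s" if "0 \<le> s" "s < Inf ?Z" for s
  proof (rule ccontr)
    assume "\<not> 0 < g s"
    moreover have "s \<le> r" using that Z by auto
    ultimately have "s \<in> ?Z" using that by auto
    then have "Inf ?Z \<le> s" using bd by (rule cInf_lower)
    with that show False by simp
  qed
  have p: "0 < Inf ?Z" using Z assms(2) by (cases "Inf ?Z = 0") auto
  have "0 \<le> g (Inf ?Z)"
  proof (rule tendsto_lowerbound)
    show "(g \<longlongrightarrow> g (Inf ?Z)) (at_left (Inf ?Z))"
      using assms(1) by (meson UNIV_I continuous_on_def tendsto_within_subset subset_UNIV)
    show "\<forall>\<^sub>F x in at_left (Inf ?Z). 0 \<le> g x"
      using eventually_at_left_real[OF p] by eventually_elim (use pos less_imp_le in auto)
  qed simp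
  with Z have "g (Inf ?Z) = 0" by auto
  with p pos Z show ?thesis by (intro that[of "Inf ?Z"]) auto
qed

text \<open>On [0, T] compactness suffices; beyond T >= 1 the inequality 1 + r <= 2 r turns a bound
  with r^n into one with (1 + r)^n at the price of 2^n.\<close>

lemma decay_bound:
  fixes g :: "real \<Rightarrow> real"
  assumes "continuous_on {0..} g" "1 \<le> T" "\<And>r. T \<le> r \<Longrightarrow> r^n * \<bar>g r\<bar> \<le> B"
  shows "\<exists>C. \<forall>r\<ge>0. \<bar>g r\<bar> \<le> C / (1 + r)^n"
proof -
  have "compact ((\<lambda>r. (1 + r)^n * \<bar>g r\<bar>) ` {0..T})"
    by (intro compact_continuous_image continuous_intros continuous_on_subset[OF assms(1)]) auto
  then have "bdd_above ((\<lambda>r. (1 + r)^n * \<bar>g r\<bar>) ` {0..T})"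
    by (intro bounded_imp_bdd_above compact_imp_bounded)
  then obtain D where "\<And>x. x \<in> (\<lambda>r. (1 + r)^n * \<bar>g r\<bar>) ` {0..T} \<Longrightarrow> x \<le> D"
    unfolding bdd_above_def by blast
  then have D: "\<And>r. 0 \<le> r \<Longrightarrow> r \<le> T \<Longrightarrow> (1 + r)^n * \<bar>g r\<bar> \<le> D" by simp
  have "\<bar>g r\<bar> \<le> max D (2^n * B) / (1 + r)^n" if "0 \<le> r" for r
  proof (cases "r \<le> T")
    case True
    with D[OF that] have "(1 + r)^n * \<bar>g r\<bar> \<le> max D (2^n * B)" by simp
    with that show ?thesis by (simp add: field_simps)
  next
    case False
    then have r: "T \<le> r" by simp
    have "(1 + r)^n * \<bar>g r\<bar> \<le> (2 * r)^n * \<bar>g r\<bar>"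
      using r assms(2) by (intro mult_right_mono power_mono) auto
    also have "\<dots> \<le> 2^n * B"
      using assms(3)[OF r] by (simp add: power_mult_distrib)
    finally have "(1 + r)^n * \<bar>g r\<bar> \<le> max D (2^n * B)" by simp
    with that show ?thesis by (simp add: field_simps)
  qed
  then show ?thesis by blast
qed

text \<open>Radial profiles with \<open>\<psi> = u e\<^bsup>-i\<omega>t\<^esup>\<close> and \<open>Om = \<omega> - q \<phi>\<close>. The first derivatives are written \<open>u' = r h\<close> and
  \<open>Om' = r k\<close>, so that \<open>\<nabla>u = h x\<close> and \<open>\<Delta>u = (r\<^sup>3 h)' / r\<^sup>2\<close> with \<open>h\<close> and \<open>k\<close> continuous at the origin.\<close>

definition soliton_profile ::
  "(real \<Rightarrow> real) \<Rightarrow> real \<Rightarrow> (real \<Rightarrow> real) \<Rightarrow> (real \<Rightarrow> real) \<Rightarrow> (real \<Rightarrow> real) \<Rightarrow> (real \<Rightarrow> real) \<Rightarrow> real \<Rightarrow> bool" where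
  "soliton_profile f q u h Om k \<omega> \<longleftrightarrow>
     continuous_on UNIV u \<and> continuous_on UNIV h \<and> continuous_on UNIV Om \<and> continuous_on UNIV k \<and>
     (\<forall>r>0. (u has_real_derivative r * h r) (at r)) \<and>
     (\<forall>r>0. ((\<lambda>r. r^3 * h r) has_real_derivative r\<^sup>2 * (f (u r) - (Om r)\<^sup>2 * u r)) (at r)) \<and>
     (\<forall>r>0. (Om has_real_derivative r * k r) (at r)) \<and>
     (\<forall>r>0. ((\<lambda>r. r^3 * k r) has_real_derivative r\<^sup>2 * (q\<^sup>2 * (u r)\<^sup>2 * Om r)) (at r)) \<and>
     3 * h 0 = f (u 0) - (Om 0)\<^sup>2 * u 0 \<and> 3 * k 0 = q\<^sup>2 * (u 0)\<^sup>2 * Om 0 \<and>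
     (\<forall>r\<ge>0. 0 < u r) \<and>
     (\<exists>C. \<forall>r\<ge>0. \<bar>u r\<bar> \<le> C / (1 + r)^2) \<and>
     (\<exists>C. \<forall>r\<ge>0. \<bar>r * h r\<bar> \<le> C / (1 + r)^2) \<and>
     (\<exists>C. \<forall>r\<ge>0. \<bar>r * k r\<bar> \<le> C / (1 + r)^2) \<and>
     (\<exists>C. \<forall>r\<ge>0. \<bar>\<omega> - Om r\<bar> \<le> C / (1 + r)^1)"

text \<open>\<open>b\<close> is the initial value of \<open>Om\<close> and \<open>b'\<close> an upper bound kept throughout. On \<open>[x1, A]\<close> the amplitude is
  pushed down, on \<open>[eps, x1]\<close> the potential energy is negative, and on \<open>[0, eps]\<close> the linearisation at zero
  dominates. The last three assumptions make \<open>A\<close> so large that the solution starting there overshoots zero.\<close>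

locale shooting =
  fixes V f :: "real \<Rightarrow> real" and b b' m eps x1 A gam c del Lf R0 beta rb :: real
  assumes V_deriv: "\<And>s. (V has_real_derivative f s) (at s)" and V_0: "V 0 = 0"
    and f_lip: "\<And>s t. s \<in> {0..A} \<Longrightarrow> t \<in> {0..A} \<Longrightarrow> \<bar>f s - f t\<bar> \<le> Lf * \<bar>s - t\<bar>"
    and f_nonneg: "\<And>s. s \<in> {0..A} \<Longrightarrow> 0 \<le> f s"
    and f_le: "\<And>s. s \<in> {0..A} \<Longrightarrow> f s \<le> m\<^sup>2 * s"
    and params: "0 < b" "b < b'" "b' \<le> m" "0 < eps" "eps < x1" "x1 < A" "0 < gam" "0 < c" "0 < del"
      "0 \<le> Lf" "0 < R0" "2 * R0 < A" "0 < beta" "0 < rb"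
    and zone1: "\<And>s. s \<in> {x1..A} \<Longrightarrow> f s - b\<^sup>2 * s \<le> - gam"
    and zone2: "\<And>s. s \<in> {eps..x1} \<Longrightarrow> b'\<^sup>2 * s\<^sup>2 / 2 - V s \<le> - c"
    and zone3: "\<And>s. s \<in> {0..eps} \<Longrightarrow> del * s \<le> f s - b'\<^sup>2 * s"
    and large: "\<And>s. s \<in> {R0..A} \<Longrightarrow> f s - b\<^sup>2 * s \<le> - beta * s"
    and rb1: "A * exp (- (beta * rb\<^sup>2 / 6)) < R0"
    and rb2: "(m\<^sup>2 * R0 + R0) * (rb + 1)\<^sup>2 < beta * A / (6 * m^3)"
begin

text \<open>Clipping both components makes the right-hand side bounded and Lipschitz on the whole
  plane. Along the final solution both clips act as the identity.\<close>

definition clU :: "real \<Rightarrow> real" where "clU u = max 0 (min A u)"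
definition clO :: "real \<Rightarrow> real" where "clO y = max b (min b' y)"
definition F1 :: "real \<Rightarrow> real \<Rightarrow> real" where "F1 u y = f (clU u) - (clO y)\<^sup>2 * clU u"

lemma m_pos: "0 < m" and A_pos: "0 < A" and b'_pos: "0 < b'" using params by auto

lemma clU_range: "clU u \<in> {0..A}" "0 \<le> clU u" "clU u \<le> A" and clO_range: "b \<le> clO y" "clO y \<le> b'" "0 < clO y"
  using params by (auto simp: clU_def clO_def)

lemma clU_lip: "\<bar>clU u - clU v\<bar> \<le> \<bar>u - v\<bar>" and clO_lip: "\<bar>clO u - clO v\<bar> \<le> \<bar>u - v\<bar>"
  by (auto simp: clU_def clO_def)

lemma clU_id: "0 \<le> u \<Longrightarrow> u \<le> A \<Longrightarrow> clU u = u" by (simp add: clU_def)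

lemma clO_sq: "b\<^sup>2 \<le> (clO y)\<^sup>2" "(clO y)\<^sup>2 \<le> b'\<^sup>2"
  using clO_range[of y] params by (auto intro!: power_mono)

lemma F1_le: "F1 u y \<le> f (clU u) - b\<^sup>2 * clU u" and F1_ge: "f (clU u) - b'\<^sup>2 * clU u \<le> F1 u y"
  unfolding F1_def using clU_range[of u] clO_sq[of y] by (auto intro!: mult_right_mono)

lemma F1_zone1: "x1 \<le> u \<Longrightarrow> F1 u y \<le> - gam"
  using F1_le[of u y] zone1[of "clU u"] params by (auto simp: clU_def)

lemma F1_large: "R0 \<le> u \<Longrightarrow> F1 u y \<le> - beta * clU u"
  using F1_le[of u y] large[of "clU u"] params by (auto simp: clU_def)

text \<open>The bound has to be independent of \<open>A\<close>: above \<open>R0\<close> the force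
  is nonpositive, and below it f grows at most linearly. The overshoot argument plays this fixed
  upward push against a slope proportional to \<open>A\<close>.\<close>

lemma F1_upper: "F1 u y \<le> m\<^sup>2 * R0"
proof (cases "R0 \<le> u")
  case True
  have "- beta * clU u \<le> 0" using clU_range[of u] params by auto
  moreover have "0 \<le> m\<^sup>2 * R0" using params by auto
  ultimately show ?thesis using F1_large[OF True, of y] by linarith
next
  case False
  have "F1 u y \<le> f (clU u)" using F1_le[of u y] clU_range[of u] zero_le_power2[of b] 
    by (smt (verit) mult_nonneg_nonneg)
  also have "\<dots> \<le> m\<^sup>2 * clU u" by (rule f_le[OF clU_range(1)])
  also have "\<dots> \<le> m\<^sup>2 * R0" using False params by (intro mult_left_mono) (auto simp: clU_def)
  finally show ?thesis .
qed

lemma F1_lower: "- (m\<^sup>2 * A) \<le> F1 u y"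
proof -
  have "b'\<^sup>2 * clU u \<le> m\<^sup>2 * A" using clU_range[of u] params by (intro mult_mono power_mono) auto
  then show ?thesis using F1_ge[of u y] f_nonneg[OF clU_range(1)[of u]] by linarith
qed

end

text \<open>The coupling enters only here, so that all parameters of \<open>shooting\<close> are
  fixed before \<open>q\<close>.\<close>

locale shooting_q = shooting + fixes q :: real
begin

definition F2 :: "real \<Rightarrow> real \<Rightarrow> real" where "F2 u y = q\<^sup>2 * (clU u)\<^sup>2 * clO y"

lemma F2_nonneg: "0 \<le> F2 u y" and F2_le: "F2 u y \<le> q\<^sup>2 * A\<^sup>2 * b'"
  unfolding F2_def using clU_range[of u] clO_range[of y]
  by (auto intro!: mult_mono power_mono)

definition FF :: "real \<times> real \<Rightarrow> real \<times> real" where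
  "FF p = (F1 (fst p) (snd p), F2 (fst p) (snd p))"

definition LL :: real where "LL = Lf + b'\<^sup>2 + 2 * b' * A + q\<^sup>2 * (2 * A * b' + A\<^sup>2)"
definition MM :: real where "MM = m\<^sup>2 * A + m\<^sup>2 * R0 + q\<^sup>2 * A\<^sup>2 * b'"

lemma prod_diff_le:
  fixes x y x' y' :: real
  assumes "\<bar>x\<bar> \<le> X" "\<bar>y'\<bar> \<le> Y"
  shows "\<bar>x * y - x' * y'\<bar> \<le> X * \<bar>y - y'\<bar> + Y * \<bar>x - x'\<bar>"
proof -
  have "x * y - x' * y' = x * (y - y') + y' * (x - x')" by (simp add: algebra_simps)
  also have "\<bar>\<dots>\<bar> \<le> \<bar>x\<bar> * \<bar>y - y'\<bar> + \<bar>y'\<bar> * \<bar>x - x'\<bar>"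
    by (metis abs_triangle_ineq abs_mult)
  also have "\<dots> \<le> X * \<bar>y - y'\<bar> + Y * \<bar>x - x'\<bar>"
    using assms by (intro add_mono mult_right_mono) auto
  finally show ?thesis .
qed

lemma sq_diff_le:
  fixes x x' :: real
  assumes "\<bar>x\<bar> \<le> X" "\<bar>x'\<bar> \<le> X"
  shows "\<bar>x\<^sup>2 - x'\<^sup>2\<bar> \<le> 2 * X * \<bar>x - x'\<bar>"
  using prod_diff_le[OF assms(1) assms(2), of x x'] by (simp add: power2_eq_square)

lemma F1_lip: "\<bar>F1 u y - F1 v z\<bar> \<le> (Lf + b'\<^sup>2) * \<bar>u - v\<bar> + 2 * b' * A * \<bar>y - z\<bar>"
proof -
  have "\<bar>f (clU u) - f (clU v)\<bar> \<le> Lf * \<bar>clU u - clU v\<bar>"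
    by (intro f_lip clU_range)
  also have "\<dots> \<le> Lf * \<bar>u - v\<bar>" using clU_lip params by (intro mult_left_mono) auto
  finally have 1: "\<bar>f (clU u) - f (clU v)\<bar> \<le> Lf * \<bar>u - v\<bar>" .
  have "\<bar>(clO y)\<^sup>2 - (clO z)\<^sup>2\<bar> \<le> 2 * b' * \<bar>clO y - clO z\<bar>"
    using clO_range[of y] clO_range[of z] by (intro sq_diff_le) auto
  also have "\<dots> \<le> 2 * b' * \<bar>y - z\<bar>" using clO_lip params by (intro mult_left_mono) auto
  finally have 2: "\<bar>(clO y)\<^sup>2 - (clO z)\<^sup>2\<bar> \<le> 2 * b' * \<bar>y - z\<bar>" .
  have "\<bar>(clO y)\<^sup>2 * clU u - (clO z)\<^sup>2 * clU v\<bar> \<le> b'\<^sup>2 * \<bar>clU u - clU v\<bar> + A * \<bar>(clO y)\<^sup>2 - (clO z)\<^sup>2\<bar>"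
    using clO_sq[of y] clU_range[of v] by (intro prod_diff_le) auto
  also have "\<dots> \<le> b'\<^sup>2 * \<bar>u - v\<bar> + A * (2 * b' * \<bar>y - z\<bar>)"
    using clU_lip A_pos by (intro add_mono mult_left_mono 2) auto
  finally show ?thesis using 1 unfolding F1_def by (simp add: algebra_simps)
qed

lemma F2_lip: "\<bar>F2 u y - F2 v z\<bar> \<le> q\<^sup>2 * (A\<^sup>2 * \<bar>y - z\<bar> + 2 * A * b' * \<bar>u - v\<bar>)"
proof -
  have "\<bar>(clU u)\<^sup>2 - (clU v)\<^sup>2\<bar> \<le> 2 * A * \<bar>clU u - clU v\<bar>"
    using clU_range[of u] clU_range[of v] by (intro sq_diff_le) auto
  also have "\<dots> \<le> 2 * A * \<bar>u - v\<bar>" using clU_lip A_pos by (intro mult_left_mono) auto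
  finally have 2: "\<bar>(clU u)\<^sup>2 - (clU v)\<^sup>2\<bar> \<le> 2 * A * \<bar>u - v\<bar>" .
  have "\<bar>(clU u)\<^sup>2 * clO y - (clU v)\<^sup>2 * clO z\<bar> \<le> A\<^sup>2 * \<bar>clO y - clO z\<bar> + b' * \<bar>(clU u)\<^sup>2 - (clU v)\<^sup>2\<bar>"
    using clU_range[of u] clO_range[of z] by (intro prod_diff_le) (auto intro!: power_mono)
  also have "\<dots> \<le> A\<^sup>2 * \<bar>y - z\<bar> + b' * (2 * A * \<bar>u - v\<bar>)"
    using clO_lip b'_pos by (intro add_mono mult_left_mono 2) auto
  finally have "\<bar>(clU u)\<^sup>2 * clO y - (clU v)\<^sup>2 * clO z\<bar> \<le> A\<^sup>2 * \<bar>y - z\<bar> + 2 * A * b' * \<bar>u - v\<bar>"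
    by (simp add: algebra_simps)
  then have "q\<^sup>2 * \<bar>(clU u)\<^sup>2 * clO y - (clU v)\<^sup>2 * clO z\<bar> \<le> q\<^sup>2 * (A\<^sup>2 * \<bar>y - z\<bar> + 2 * A * b' * \<bar>u - v\<bar>)"
    by (intro mult_left_mono) auto
  moreover have "F2 u y - F2 v z = q\<^sup>2 * ((clU u)\<^sup>2 * clO y - (clU v)\<^sup>2 * clO z)"
    by (simp add: F2_def algebra_simps)
  ultimately show ?thesis by (simp add: abs_mult)
qed

lemma norm_pair_le: "norm (x, y) \<le> \<bar>x\<bar> + \<bar>y\<bar>" for x y :: real
  using norm_Pair_le[of x y] by simp

sublocale radial_ode FF LL MM
proof
  show "0 \<le> LL" unfolding LL_def using params by auto
next
  fix p p' :: "real \<times> real"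
  obtain u y v z where p: "p = (u, y)" "p' = (v, z)" by force
  have n: "\<bar>u - v\<bar> \<le> norm (p - p')" "\<bar>y - z\<bar> \<le> norm (p - p')"
    using norm_fst_le[of "u - v" "y - z"] norm_snd_le[of "y - z" "u - v"] by (auto simp: p)
  have "norm (FF p - FF p') \<le> \<bar>F1 u y - F1 v z\<bar> + \<bar>F2 u y - F2 v z\<bar>"
    using norm_pair_le by (simp add: FF_def p)
  also have "\<dots> \<le> ((Lf + b'\<^sup>2) * \<bar>u - v\<bar> + 2 * b' * A * \<bar>y - z\<bar>) + q\<^sup>2 * (A\<^sup>2 * \<bar>y - z\<bar> + 2 * A * b' * \<bar>u - v\<bar>)"
    by (intro add_mono F1_lip F2_lip)
  also have "\<dots> \<le> ((Lf + b'\<^sup>2) * norm (p - p') + 2 * b' * A * norm (p - p'))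
      + q\<^sup>2 * (A\<^sup>2 * norm (p - p') + 2 * A * b' * norm (p - p'))"
    using n params A_pos by (intro add_mono mult_left_mono) auto
  also have "\<dots> = LL * norm (p - p')" by (simp add: LL_def algebra_simps)
  finally show "norm (FF p - FF p') \<le> LL * norm (p - p')" .
next
  fix p :: "real \<times> real"
  have "\<bar>F1 (fst p) (snd p)\<bar> \<le> m\<^sup>2 * A + m\<^sup>2 * R0"
    using F1_upper[of "fst p" "snd p"] F1_lower[of "fst p" "snd p"] params
    by (smt (verit) mult_nonneg_nonneg zero_le_power2)
  then show "norm (FF p) \<le> MM"
    using norm_pair_le[of "F1 (fst p) (snd p)" "F2 (fst p) (snd p)"]
      F2_nonneg[of "fst p" "snd p"] F2_le[of "fst p" "snd p"]
    unfolding FF_def MM_def by linarith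
qed

definition U :: "real \<Rightarrow> real \<Rightarrow> real" where "U a r = fst (sol (a, b) r)"
definition Om :: "real \<Rightarrow> real \<Rightarrow> real" where "Om a r = snd (sol (a, b) r)"
definition H :: "real \<Rightarrow> real \<Rightarrow> real" where "H a r = fst (slope (a, b) r)"
definition K :: "real \<Rightarrow> real \<Rightarrow> real" where "K a r = snd (slope (a, b) r)"

lemma U_0: "U a 0 = a" and Om_0: "Om a 0 = b" by (auto simp: U_def Om_def sol_0)

lemma continuous_U: "continuous_on S (U a)" and continuous_Om: "continuous_on S (Om a)"
  and continuous_H: "continuous_on S (H a)" and continuous_K: "continuous_on S (K a)"
  unfolding U_def[abs_def] Om_def[abs_def] H_def[abs_def] K_def[abs_def]
  by (intro continuous_intros continuous_sol continuous_slope)+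

lemma continuous_param: "continuous_on UNIV (\<lambda>p. ((fst p, b), snd p) :: (real \<times> real) \<times> real)"
  by (intro continuous_intros)

lemma continuous_U2: "continuous_on UNIV (\<lambda>(a, r). U a r)"
  and continuous_H2: "continuous_on UNIV (\<lambda>(a, r). H a r)"
  unfolding U_def H_def
  using continuous_on_fst[OF continuous_on_compose2[OF continuous_sol2 continuous_param]]
    continuous_on_fst[OF continuous_on_compose2[OF continuous_slope2 continuous_param]]
  by (simp_all add: case_prod_unfold)

lemma U_deriv: "0 < r \<Longrightarrow> (U a has_real_derivative r * H a r) (at r)"
  and Om_deriv: "0 < r \<Longrightarrow> (Om a has_real_derivative r * K a r) (at r)"
  using has_derivative_fst[OF sol_has_vector_derivative[of r "(a, b)", unfolded has_vector_derivative_def]]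
    has_derivative_snd[OF sol_has_vector_derivative[of r "(a, b)", unfolded has_vector_derivative_def]]
  unfolding U_def[abs_def] Om_def[abs_def] H_def K_def
  by (simp_all add: has_real_derivative_iff_has_vector_derivative has_vector_derivative_def mult.assoc)

lemma H_deriv: "0 < r \<Longrightarrow> ((\<lambda>r. r^3 * H a r) has_real_derivative r\<^sup>2 * F1 (U a r) (Om a r)) (at r)"
  and K_deriv: "0 < r \<Longrightarrow> ((\<lambda>r. r^3 * K a r) has_real_derivative r\<^sup>2 * F2 (U a r) (Om a r)) (at r)"
  using has_derivative_fst[OF slope_has_vector_derivative[of r "(a, b)", unfolded has_vector_derivative_def]]
    has_derivative_snd[OF slope_has_vector_derivative[of r "(a, b)", unfolded has_vector_derivative_def]]
  unfolding U_def[abs_def] Om_def[abs_def] H_def K_def FF_def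
  by (simp_all add: has_real_derivative_iff_has_vector_derivative has_vector_derivative_def)

end

section \<open>Monotonicity of the profile, of \<open>Om\<close> and of the energy\<close>

context shooting_q
begin

text \<open>The factor 1/3 is the integral of t^2 over [0, 1]; it reflects \<Delta>u(0) = 3 h(0) in
  three dimensions.\<close>

lemma H_0: "H a 0 = F1 a b / 3" and K_0: "K a 0 = F2 a b / 3"
proof -
  have "((\<lambda>t::real. t\<^sup>2) has_integral (1^3 / 3 - 0^3 / 3)) {0..1}"
    by (intro fundamental_theorem_of_calculus)
       (auto intro!: derivative_eq_intros simp flip: has_real_derivative_iff_has_vector_derivative)
  then have "((\<lambda>t::real. t\<^sup>2 *\<^sub>R FF (a, b)) has_integral (1/3) *\<^sub>R FF (a, b)) {0..1}"
    using has_integral_scaleR_left[of "\<lambda>t::real. t\<^sup>2" "1/3" "{0..1}" "FF (a, b)"] by simp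
  then have "slope (a, b) 0 = (1/3) *\<^sub>R FF (a, b)"
    unfolding slope_def ray_mean_def by (simp add: sol_0 integral_unique)
  then show "H a 0 = F1 a b / 3" "K a 0 = F2 a b / 3" by (simp_all add: H_def K_def FF_def)
qed

lemma H_le:
  assumes "0 \<le> r" "\<And>s. 0 \<le> s \<Longrightarrow> s \<le> r \<Longrightarrow> F1 (U a s) (Om a s) \<le> k"
  shows "H a r \<le> k / 3"
proof (cases "r = 0")
  case True
  then show ?thesis using assms(2)[of 0] by (simp add: H_0 U_0 Om_0)
next
  case False
  have "r^3 * H a r \<le> 0^3 * H a 0 + k * (r^3 - 0^3) / 3"
    by (rule cube_le[OF _ assms(1) continuous_H]) (use H_deriv assms in auto)
  then have "r^3 * H a r \<le> r^3 * (k / 3)" by (simp add: algebra_simps)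
  with False assms(1) show ?thesis by simp
qed

lemma H_ge:
  assumes "0 \<le> r" "\<And>s. 0 \<le> s \<Longrightarrow> s \<le> r \<Longrightarrow> k \<le> F1 (U a s) (Om a s)"
  shows "k / 3 \<le> H a r"
proof (cases "r = 0")
  case True
  then show ?thesis using assms(2)[of 0] by (simp add: H_0 U_0 Om_0)
next
  case False
  have "r^3 * - H a r \<le> 0^3 * - H a 0 + - k * (r^3 - 0^3) / 3"
  proof (rule cube_le[OF _ assms(1) continuous_on_minus[OF continuous_H]])
    fix s assume "0 < s" "s < r"
    then show "((\<lambda>r. r ^ 3 * - H a r) has_real_derivative s\<^sup>2 * - F1 (U a s) (Om a s)) (at s)"
      using DERIV_minus[OF H_deriv[of s a]] by simp
  qed (use assms in auto)
  then have "r^3 * (k / 3) \<le> r^3 * H a r" by (simp add: algebra_simps)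
  with False assms(1) show ?thesis by simp
qed

lemma U_antimono:
  assumes "0 \<le> x" "x \<le> y" "\<And>s. x < s \<Longrightarrow> s < y \<Longrightarrow> H a s \<le> 0"
  shows "U a y \<le> U a x"
  by (rule nonincreasing_on_Icc[OF assms(2) continuous_U U_deriv])
     (use assms in \<open>auto intro!: mult_nonneg_nonpos\<close>)

lemma K_nonneg: "0 \<le> r \<Longrightarrow> 0 \<le> r^3 * K a r"
  using nonincreasing_on_Icc[OF _ _ DERIV_minus[OF K_deriv], of 0 r a]
  by (simp add: continuous_intros continuous_K F2_nonneg)

lemma K_nonneg': "0 < r \<Longrightarrow> 0 \<le> K a r"
  using K_nonneg[of r a] by (simp add: zero_le_mult_iff)

lemma Om_mono: "0 \<le> x \<Longrightarrow> x \<le> y \<Longrightarrow> Om a x \<le> Om a y"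
  using nonincreasing_on_Icc[OF _ _ DERIV_minus[OF Om_deriv], of x y a]
  by (simp add: continuous_intros continuous_Om K_nonneg')

lemma Om_ge: "0 \<le> r \<Longrightarrow> b \<le> Om a r"
  using Om_mono[of 0 r a] by (simp add: Om_0)

text \<open>The mechanical energy with the constant \<open>b'\<close> in place of \<open>Om\<close>,
  so that the variation of \<open>Om\<close> contributes with a favourable sign instead of an error
  term.\<close>

definition E :: "real \<Rightarrow> real \<Rightarrow> real" where
  "E a r = (r * H a r)\<^sup>2 / 2 + b'\<^sup>2 * (U a r)\<^sup>2 / 2 - V (U a r)"

lemma continuous_V: "continuous_on S V"
  by (meson DERIV_isCont V_deriv continuous_at_imp_continuous_on)

lemma continuous_E2: "continuous_on UNIV (\<lambda>(a, r). E a r)"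
proof -
  have 1: "continuous_on UNIV (\<lambda>p. U (fst p) (snd p))" "continuous_on UNIV (\<lambda>p. H (fst p) (snd p))"
    using continuous_U2 continuous_H2 by (simp_all add: case_prod_unfold)
  show ?thesis unfolding E_def case_prod_unfold
    by (intro continuous_intros 1 continuous_on_compose2[OF continuous_V[of UNIV] 1(1)]) auto
qed

lemma continuous_E: "continuous_on S (E a)"
  unfolding E_def[abs_def]
  by (intro continuous_intros continuous_U continuous_H continuous_on_compose2[OF continuous_V[of UNIV]]) auto

lemma rH_deriv:
  assumes "0 < r" shows "((\<lambda>r. r * H a r) has_real_derivative F1 (U a r) (Om a r) - 2 * H a r) (at r)"
proof -
  have "((\<lambda>r. (r^3 * H a r) / r\<^sup>2) has_real_derivative F1 (U a r) (Om a r) - 2 * H a r) (at r)"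
    by (rule derivative_eq_intros H_deriv assms refl)+
       (use assms in \<open>simp_all add: field_simps power2_eq_square power3_eq_cube\<close>)
  then show ?thesis
    by (rule DERIV_cong_ev[THEN iffD1, rotated 3])
       (use assms in \<open>auto simp: power2_eq_square power3_eq_cube intro!: eventually_at_in_open'[of "{0<..}", THEN eventually_mono]\<close>)
qed

text \<open>E' = u u' (b'^2 - Om^2) - 2 u'^2 / r, with \<open>Om\<close> clipped to at most b'. Both
  terms are nonpositive while u' <= 0 <= u; the range condition on u removes its clip.\<close>

lemma E_antimono:
  assumes "0 \<le> x" "x \<le> y"
    and "\<And>s. x < s \<Longrightarrow> s < y \<Longrightarrow> 0 \<le> U a s \<and> U a s \<le> A \<and> H a s \<le> 0"
  shows "E a y \<le> E a x"
proof (rule nonincreasing_on_Icc[OF assms(2) continuous_E])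
  fix s assume s: "x < s" "s < y"
  with assms have s0: "0 < s" by simp
  note U = U_deriv[OF s0, of a] and rH = rH_deriv[OF s0, of a]
  have V: "((\<lambda>r. V (U a r)) has_real_derivative f (U a s) * (s * H a s)) (at s)"
    by (rule DERIV_chain2[OF V_deriv U])
  show "(E a has_real_derivative
      s * H a s * (F1 (U a s) (Om a s) - f (U a s) + b'\<^sup>2 * U a s) - 2 * s * (H a s)\<^sup>2) (at s)"
    unfolding E_def[abs_def]
    by (rule rH U V derivative_eq_intros refl | simp add: algebra_simps power2_eq_square diff_divide_distrib)+
  have c: "clU (U a s) = U a s" using assms(3)[OF s] by (simp add: clU_id)
  have "0 \<le> F1 (U a s) (Om a s) - f (U a s) + b'\<^sup>2 * U a s"
    using F1_ge[of "U a s" "Om a s"] by (simp add: c)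
  moreover have "s * H a s \<le> 0" using assms(3)[OF s] s0 by (simp add: mult_nonneg_nonpos)
  ultimately have "s * H a s * (F1 (U a s) (Om a s) - f (U a s) + b'\<^sup>2 * U a s) \<le> 0"
    by (simp add: mult_nonpos_nonneg)
  moreover have "0 \<le> 2 * s * (H a s)\<^sup>2" using s0 by simp
  ultimately show "s * H a s * (F1 (U a s) (Om a s) - f (U a s) + b'\<^sup>2 * U a s) - 2 * s * (H a s)\<^sup>2 \<le> 0"
    by linarith
qed

text \<open>Negative energy stands beside an upward slope because it can be read off at the start,
  for the amplitude \<open>x1\<close>. As the energy is nonnegative at any zero of \<open>U\<close>
  and decreases along a descent, negative energy excludes a later monotone descent to zero.\<close>

definition N :: "real set" where
  "N = {a. \<exists>r\<ge>0. (\<forall>s\<in>{0..r}. 0 < U a s) \<and> (0 < H a r \<or> E a r < 0)}"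

lemma open_N: "open N"
proof -
  have c: "continuous_on UNIV (\<lambda>a. H a r)" "continuous_on UNIV (\<lambda>a. E a r)" for r
    using continuous_on_compose2[OF continuous_H2, of UNIV "\<lambda>a. (a, r)"]
      continuous_on_compose2[OF continuous_E2, of UNIV "\<lambda>a. (a, r)"]
    by (auto simp: continuous_on_Pair)
  have "open {a. 0 < H a r}" "open {a. E a r < 0}" for r
    using c[of r] by (auto intro!: open_Collect_less continuous_on_const)
  then have "open (\<Union>r\<in>{0..}. {a. \<forall>s\<in>{0..r}. 0 < U a s} \<inter> ({a. 0 < H a r} \<union> {a. E a r < 0}))"
    by (intro open_UN open_Int open_Un ballI open_forall_compact continuous_U2)
  also have "\<dots> = N" by (auto simp: N_def)
  finally show ?thesis .
qed

lemma x1_in_N: "x1 \<in> N"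
proof -
  have "E x1 0 \<le> - c" using zone2[of x1] params by (simp add: E_def U_0)
  then show ?thesis using params by (auto simp: N_def U_0 intro!: exI[of _ 0])
qed

text \<open>The solution leaves the region \<open>u \<ge> R0\<close> before time \<open>rb\<close> with a slope proportional to \<open>A\<close>, whereas
  \<open>rb\<close> grows only like the square root of \<open>ln A\<close>.\<close>

lemma A_hits:
  obtains r1 where "0 < r1" "U A r1 < 0" "\<And>s. 0 \<le> s \<Longrightarrow> s \<le> r1 \<Longrightarrow> H A s < 0"
proof -
  have R0A: "R0 < A" using params by auto
  \<comment> \<open>While u >= R0 the force is at most - beta u, and u decreases, so u' <= - beta r
    u / 3. Integrated, this is Gaussian decay with exponent beta r^2 / 6, which forces an exit
    before \<open>rb\<close>.\<close>
  have H_large: "H A r \<le> - beta * U A r / 3 \<and> H A r < 0 \<and> U A r * exp (beta * r\<^sup>2 / 6) \<le> A"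
    if r: "0 \<le> r" "\<And>s. 0 \<le> s \<Longrightarrow> s \<le> r \<Longrightarrow> R0 \<le> U A s" for r
  proof -
    have neg: "H A t < 0" if t: "0 \<le> t" "t \<le> r" for t
    proof -
      have "H A t \<le> (- beta * R0) / 3"
      proof (rule H_le[OF t(1)])
        fix s assume s: "0 \<le> s" "s \<le> t"
        have "F1 (U A s) (Om A s) \<le> - beta * clU (U A s)" using s t r by (intro F1_large) auto
        also have "\<dots> \<le> - beta * R0" using r(2)[of s] s t params by (auto simp: clU_def)
        finally show "F1 (U A s) (Om A s) \<le> - beta * R0" .
      qed
      moreover have "0 < beta * R0" using params by simp
      ultimately show ?thesis by linarith
    qed
    have mono: "U A t \<le> U A s" if "0 \<le> s" "s \<le> t" "t \<le> r" for s t
      by (rule U_antimono[OF that(1,2)]) (use that in \<open>auto intro!: less_imp_le[OF neg]\<close>)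
    have strong: "H A t \<le> - beta * U A t / 3" if t: "0 \<le> t" "t \<le> r" for t
    proof (rule H_le[OF t(1)])
      fix s assume s: "0 \<le> s" "s \<le> t"
      have "U A s \<le> A" using mono[of 0 s] s t by (simp add: U_0)
      moreover have "R0 \<le> U A s" using r(2) s t by auto
      ultimately have "clU (U A s) = U A s" using params by (intro clU_id) auto
      then have "F1 (U A s) (Om A s) \<le> - beta * U A s" using F1_large[OF \<open>R0 \<le> U A s\<close>] by simp
      also have "\<dots> \<le> - beta * U A t" using mono[OF s t(2)] params by simp
      finally show "F1 (U A s) (Om A s) \<le> - beta * U A t" .
    qed
    have "U A r * exp (beta * r\<^sup>2 / 6) \<le> U A 0 * exp (beta * 0\<^sup>2 / 6)"
    proof (rule nonincreasing_on_Icc[OF r(1), where g="\<lambda>r. U A r * exp (beta * r\<^sup>2 / 6)"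
          and g'="\<lambda>s. exp (beta * s\<^sup>2 / 6) * s * (H A s + beta * U A s / 3)"])
      fix s assume s: "0 < s" "s < r"
      show "((\<lambda>r. U A r * exp (beta * r\<^sup>2 / 6)) has_real_derivative
          exp (beta * s\<^sup>2 / 6) * s * (H A s + beta * U A s / 3)) (at s)"
        by (rule derivative_eq_intros U_deriv s refl | simp add: algebra_simps)+
      show "exp (beta * s\<^sup>2 / 6) * s * (H A s + beta * U A s / 3) \<le> 0"
        using strong[of s] s by (intro mult_nonneg_nonpos) auto
    qed (intro continuous_intros continuous_U; simp)
    then show ?thesis using strong[of r] neg[of r] r(1) by (simp add: U_0)
  qed
  have "\<exists>s. 0 \<le> s \<and> s \<le> rb \<and> U A s < R0"
  proof (rule ccontr)
    assume "\<not> ?thesis"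
    then have *: "\<And>s. 0 \<le> s \<Longrightarrow> s \<le> rb \<Longrightarrow> R0 \<le> U A s" by force
    have "U A rb * exp (beta * rb\<^sup>2 / 6) \<le> A" using H_large[of rb] * params by auto
    then have "U A rb \<le> A * exp (- (beta * rb\<^sup>2 / 6))" by (simp add: exp_minus field_simps)
    with *[of rb] rb1 params show False by auto
  qed
  then obtain s0 where s0: "0 \<le> s0" "s0 \<le> rb" "U A s0 < R0" by blast
  have "continuous_on UNIV (\<lambda>s. U A s - R0)" by (intro continuous_intros continuous_U)
  then obtain r2 where r2: "0 < r2" "r2 \<le> rb" "U A r2 = R0" "\<And>s. 0 \<le> s \<Longrightarrow> s < r2 \<Longrightarrow> R0 < U A s"
    by (rule first_zero[of _ s0]) (use s0 R0A in \<open>auto simp: U_0\<close>)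
  have ge: "R0 \<le> U A s" if "0 \<le> s" "s \<le> r2" for s
    using r2(3) r2(4)[of s] that by (cases "s = r2") auto
  \<comment> \<open>A fixed time, short enough for u to stay above A/2: the force is at least - m^2
    A, so u loses at most m^2 A r^2 / 6. At this time the slope is already proportional to
    \<open>A\<close>.\<close>
  let ?\<rho> = "1 / m"
  have lower: "A - m\<^sup>2 * A * r\<^sup>2 / 6 \<le> U A r" if "0 \<le> r" for r
  proof -
    have "- U A r - m\<^sup>2 * A * r\<^sup>2 / 6 \<le> - U A 0 - m\<^sup>2 * A * 0\<^sup>2 / 6"
    proof (rule nonincreasing_on_Icc[OF that, where g="\<lambda>r. - U A r - m\<^sup>2 * A * r\<^sup>2 / 6"
          and g'="\<lambda>s. s * (- H A s - m\<^sup>2 * A / 3)"])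
      fix s assume s: "0 < s" "s < r"
      show "((\<lambda>r. - U A r - m\<^sup>2 * A * r\<^sup>2 / 6) has_real_derivative s * (- H A s - m\<^sup>2 * A / 3)) (at s)"
        by (rule derivative_eq_intros U_deriv s refl | simp add: algebra_simps)+
      have "- (m\<^sup>2 * A) / 3 \<le> H A s" using s by (intro H_ge F1_lower) auto
      then show "s * (- H A s - m\<^sup>2 * A / 3) \<le> 0" using s by (intro mult_nonneg_nonpos) auto
    qed (intro continuous_intros continuous_U; simp)
    then show ?thesis by (simp add: U_0)
  qed
  have half: "A / 2 \<le> U A r" if "0 \<le> r" "r \<le> ?\<rho>" for r
  proof -
    have "m * r \<le> 1" using that m_pos by (simp add: field_simps)
    then have "(m * r)\<^sup>2 \<le> 1" using that m_pos by (intro power_le_one) auto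
    then have "(m * r)\<^sup>2 * A \<le> 1 * A" using A_pos by (intro mult_right_mono) auto
    then have "m\<^sup>2 * A * r\<^sup>2 \<le> A" by (simp add: power_mult_distrib algebra_simps)
    then show ?thesis using lower[OF that(1)] A_pos by linarith
  qed
  have rho: "?\<rho> < r2"
  proof (rule ccontr)
    assume "\<not> ?thesis"
    then have "A / 2 \<le> R0" using half[of r2] r2 by auto
    then show False using params by auto
  qed
  define S where "S = beta * A / (6 * m^3)"
  have cube_rho: "?\<rho>^3 * H A ?\<rho> \<le> - S"
  proof -
    have "H A ?\<rho> \<le> - beta * U A ?\<rho> / 3"
      using H_large[of ?\<rho>] ge rho m_pos by auto
    also have "\<dots> \<le> - beta * (A / 2) / 3"
      using half[of ?\<rho>] m_pos params by (auto simp: divide_right_mono)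
    finally have "?\<rho>^3 * H A ?\<rho> \<le> ?\<rho>^3 * (- beta * (A / 2) / 3)"
      using m_pos by (intro mult_left_mono) auto
    then show ?thesis by (simp add: S_def power_divide)
  qed
  \<comment> \<open>Up to \<open>r2\<close> the force is nonpositive, so r^3 h stays below - S.
    During the next unit of time the push is at most m^2 R0 and s <= rb + 1, which costs at most m^2
    R0 (rb + 1)^2. Condition \<open>rb2\<close> leaves a slope below - R0, enough to fall from R0
    past zero within that unit.\<close>
  have cube_after: "r^3 * H A r \<le> - S + m\<^sup>2 * R0 * (rb + 1)\<^sup>2" if r: "r2 \<le> r" "r \<le> r2 + 1" for r
  proof -
    have "r2^3 * H A r2 \<le> ?\<rho>^3 * H A ?\<rho> + 0 * (r2^3 - ?\<rho>^3) / 3"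
    proof (rule cube_le[OF _ _ continuous_H])
      fix s assume s: "?\<rho> < s" "s < r2"
      have s0: "0 < s" using s m_pos by (smt (verit) divide_pos_pos)
      show "((\<lambda>r. r ^ 3 * H A r) has_real_derivative s\<^sup>2 * F1 (U A s) (Om A s)) (at s)"
        by (rule H_deriv[OF s0])
      have "F1 (U A s) (Om A s) \<le> - beta * clU (U A s)" using s s0 ge by (intro F1_large) auto
      also have "\<dots> \<le> 0" using clU_range params by (simp add: mult_nonpos_nonneg)
      finally show "F1 (U A s) (Om A s) \<le> 0" .
    qed (use rho m_pos in auto)
    then have 1: "r2^3 * H A r2 \<le> - S" using cube_rho by simp
    have "r^3 * H A r - m\<^sup>2 * R0 * (rb + 1)\<^sup>2 * r \<le> r2^3 * H A r2 - m\<^sup>2 * R0 * (rb + 1)\<^sup>2 * r2"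
    proof (rule nonincreasing_on_Icc[OF r(1), where g="\<lambda>r. r^3 * H A r - m\<^sup>2 * R0 * (rb + 1)\<^sup>2 * r"
          and g'="\<lambda>s. s\<^sup>2 * F1 (U A s) (Om A s) - m\<^sup>2 * R0 * (rb + 1)\<^sup>2"])
      fix s assume s: "r2 < s" "s < r"
      then have s0: "0 < s" using r2 by simp
      show "((\<lambda>r. r^3 * H A r - m\<^sup>2 * R0 * (rb + 1)\<^sup>2 * r) has_real_derivative
          s\<^sup>2 * F1 (U A s) (Om A s) - m\<^sup>2 * R0 * (rb + 1)\<^sup>2) (at s)"
        by (rule derivative_eq_intros H_deriv s0 refl | simp)+
      have "s\<^sup>2 * F1 (U A s) (Om A s) \<le> s\<^sup>2 * (m\<^sup>2 * R0)" by (intro mult_left_mono F1_upper) auto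
      also have "\<dots> \<le> (rb + 1)\<^sup>2 * (m\<^sup>2 * R0)"
        using s s0 r r2 params by (intro mult_right_mono power_mono) auto
      finally show "s\<^sup>2 * F1 (U A s) (Om A s) - m\<^sup>2 * R0 * (rb + 1)\<^sup>2 \<le> 0" by (simp add: algebra_simps)
    qed (intro continuous_intros continuous_H)
    then have "r^3 * H A r \<le> - S + m\<^sup>2 * R0 * (rb + 1)\<^sup>2 * (r - r2)" using 1 by (simp add: algebra_simps)
    also have "m\<^sup>2 * R0 * (rb + 1)\<^sup>2 * (r - r2) \<le> m\<^sup>2 * R0 * (rb + 1)\<^sup>2 * 1"
      using r params by (intro mult_left_mono) auto
    finally show ?thesis by simp
  qed
  have S: "- S + m\<^sup>2 * R0 * (rb + 1)\<^sup>2 < - (R0 * (rb + 1)\<^sup>2)"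
    using rb2 by (simp add: S_def algebra_simps)
  have slope_after: "r * H A r < - R0" if r: "r2 \<le> r" "r \<le> r2 + 1" for r
  proof -
    have r0: "0 < r" using r r2 by simp
    have "r\<^sup>2 * (r * H A r) < - (R0 * (rb + 1)\<^sup>2)"
      using cube_after[OF r] S by (simp add: power3_eq_cube power2_eq_square mult.assoc)
    also have "\<dots> \<le> - (R0 * r\<^sup>2)"
      using r r0 r2 params by (auto intro!: mult_left_mono power_mono)
    finally have "r\<^sup>2 * (r * H A r) < r\<^sup>2 * - R0" by (simp add: mult.commute)
    then show ?thesis using r0 by (simp only: mult_less_cancel_left_pos zero_less_power)
  qed
  have neg: "H A s < 0" if "0 \<le> s" "s \<le> r2 + 1" for s
  proof (cases "s \<le> r2")
    case True
    then show ?thesis using H_large[of s] ge that by auto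
  next
    case False
    then have "s * H A s < 0" using slope_after[of s] that params by auto
    then show ?thesis using False r2 by (simp add: mult_less_0_iff)
  qed
  have "\<exists>z. r2 < z \<and> z < r2 + 1 \<and> U A (r2 + 1) - U A r2 = (r2 + 1 - r2) * (z * H A z)"
    by (rule MVT2) (use U_deriv r2 in auto)
  then obtain z where z: "r2 < z" "z < r2 + 1" "U A (r2 + 1) - U A r2 = z * H A z" by auto
  then have "U A (r2 + 1) < 0" using slope_after[of z] r2(3) by linarith
  then show ?thesis using neg r2 by (intro that[of "r2 + 1"]) auto
qed

text \<open>The descent from \<open>A\<close> is strictly monotone up to its first zero, where the
  energy is u'^2 / 2 >= 0. As the energy only decreases, it was nonnegative all the way, and a
  witness for membership in \<open>N\<close> would have to lie before that zero.\<close>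

lemma A_notin_N: "A \<notin> N"
proof
  assume "A \<in> N"
  then obtain r where r: "0 \<le> r" "\<And>s. 0 \<le> s \<Longrightarrow> s \<le> r \<Longrightarrow> 0 < U A s" "0 < H A r \<or> E A r < 0"
    by (auto simp: N_def)
  obtain r1 where r1: "0 < r1" "U A r1 < 0" "\<And>s. 0 \<le> s \<Longrightarrow> s \<le> r1 \<Longrightarrow> H A s < 0"
    using A_hits by blast
  obtain r0 where r0: "0 < r0" "r0 \<le> r1" "U A r0 = 0" "\<And>s. 0 \<le> s \<Longrightarrow> s < r0 \<Longrightarrow> 0 < U A s"
    using first_zero[of "U A" r1] r1 A_pos by (auto simp: U_0 intro!: continuous_U)
  have "r < r0" using r(2)[of r0] r0 by force
  have "E A r0 \<le> E A r"
  proof (rule E_antimono)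
    fix s assume s: "r < s" "s < r0"
    have "U A s \<le> U A 0"
      by (rule U_antimono) (use s r r0 in \<open>auto intro!: less_imp_le[OF r1(3)]\<close>)
    then show "0 \<le> U A s \<and> U A s \<le> A \<and> H A s \<le> 0"
      using s r r0 r1(3)[of s] by (auto simp: U_0 less_imp_le)
  qed (use \<open>r < r0\<close> r in auto)
  moreover have "0 \<le> E A r0" by (simp add: E_def r0 V_0)
  moreover have "H A r < 0" using r1(3)[of r] r(1) \<open>r < r0\<close> r0 by auto
  ultimately show False using r(3) by linarith
qed

section \<open>Transversality of crossings and the threshold amplitude\<close>

lemma not_N:
  assumes "a \<notin> N" "0 \<le> r" "\<And>s. 0 \<le> s \<Longrightarrow> s \<le> r \<Longrightarrow> 0 < U a s"
  shows "H a r \<le> 0" "0 \<le> E a r"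
  using assms by (force simp: N_def)+

text \<open>Outside \<open>N\<close> the slope is nonpositive; strictness has a different source in
  each range of u. Above x1 the force has been negative from the start. Between eps and x1 the
  potential part of \<open>E\<close> is negative, so nonnegative energy requires u' to be nonzero.
  Below eps the force is positive, and a vanishing slope would turn upward.\<close>

lemma H_neg:
  assumes "a \<notin> N" "x1 < a" "a \<le> A" and pos: "\<And>s. 0 \<le> s \<Longrightarrow> s < R \<Longrightarrow> 0 < U a s"
    and r: "0 \<le> r" "r < R"
  shows "H a r < 0"
proof -
  have H_le0: "H a s \<le> 0" if "0 \<le> s" "s < R" for s
    using not_N(1)[OF assms(1) that(1)] pos that by auto
  have mono: "U a t \<le> U a s" if "0 \<le> s" "s \<le> t" "t < R" for s t
    by (rule U_antimono[OF that(1,2)]) (use that H_le0 in auto)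
  consider "x1 \<le> U a r" | "eps \<le> U a r" "U a r \<le> x1" | "U a r < eps" by linarith
  then show ?thesis
  proof cases
    case 1
    have "H a r \<le> - gam / 3"
      by (rule H_le[OF r(1)], rule F1_zone1) (use 1 mono r order_trans in blast)
    then show ?thesis using params by linarith
  next
    case 2
    have "0 \<le> E a r" using not_N(2)[OF assms(1) r(1)] pos r by auto
    then have "H a r \<noteq> 0" using zone2[of "U a r"] 2 params by (auto simp: E_def)
    then show ?thesis using H_le0[OF r] by simp
  next
    case 3
    show ?thesis
    proof (rule ccontr)
      assume "\<not> ?thesis"
      then have H0: "H a r = 0" using H_le0[OF r] by simp
      have r0: "0 < r" using 3 params assms r by (cases "r = 0") (auto simp: U_0)
      \<comment> \<open>A point after \<open>r\<close> but still before \<open>R\<close>: from a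
        zero slope at \<open>r\<close> the positive force makes r^3 h increase, so the slope would
        be positive at \<open>t\<close>.\<close>
      define t where "t = (r + R) / 2"
      have t: "r < t" "t < R" using r by (auto simp: t_def)
      have "r^3 * H a r < t^3 * H a t"
      proof (rule DERIV_pos_imp_increasing_open[OF t(1), where f="\<lambda>r. r^3 * H a r"])
        fix s assume s: "r < s" "s < t"
        have u: "0 < U a s" "U a s \<le> eps" using pos[of s] mono[of r s] s r0 t 3 by auto
        then have "clU (U a s) = U a s" using params by (intro clU_id) auto
        then have "del * U a s \<le> F1 (U a s) (Om a s)"
          using F1_ge[of "U a s" "Om a s"] zone3[of "U a s"] u by auto
        moreover have "0 < del * U a s" using u params by auto
        ultimately have "0 < s\<^sup>2 * F1 (U a s) (Om a s)" using s r0 by auto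
        then show "\<exists>y. ((\<lambda>r. r^3 * H a r) has_real_derivative y) (at s) \<and> 0 < y"
          using H_deriv[of s a] s r0 by auto
      qed (intro continuous_intros continuous_H)
      then have "0 < t^3 * H a t" by (simp add: H0)
      then have "0 < H a t" using t r0 by (simp add: zero_less_mult_iff)
      then show False using H_le0[of t] t r0 by auto
    qed
  qed
qed

text \<open>Backward uniqueness: \<open>U\<close> cannot reach zero with vanishing slope. With \<open>p = r\<^sup>2 u'\<close> the quantity
  \<open>(p + m r0\<^sup>2 u) e\<^bsup>-mr\<^esup>\<close> is nonincreasing, which gives \<open>u' \<ge> - 4 m u\<close> near \<open>r0\<close>.\<close>

lemma H_neg_at_zero:
  assumes "0 < r0" "U a r0 = 0" and pos: "\<And>s. 0 \<le> s \<Longrightarrow> s < r0 \<Longrightarrow> 0 < U a s \<and> U a s \<le> A \<and> H a s \<le> 0"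
  shows "H a r0 \<noteq> 0"
proof
  assume H0: "H a r0 = 0"
  let ?z = "\<lambda>r. r^3 * H a r + m * r0\<^sup>2 * U a r"
  have p_ge: "- (m * r0\<^sup>2 * U a r) \<le> r^3 * H a r" if r: "0 < r" "r < r0" for r
  proof -
    have "?z r0 * exp (- (m * r0)) \<le> ?z r * exp (- (m * r))"
    proof (rule nonincreasing_on_Icc[where g="\<lambda>r. ?z r * exp (- (m * r))"
          and g'="\<lambda>s. exp (- (m * s)) * (s\<^sup>2 * F1 (U a s) (Om a s) + m * r0\<^sup>2 * (s * H a s) - m * ?z s)"])
      fix s assume s: "r < s" "s < r0"
      have s0: "0 < s" using s r by simp
      show "((\<lambda>r. ?z r * exp (- (m * r))) has_real_derivative
          exp (- (m * s)) * (s\<^sup>2 * F1 (U a s) (Om a s) + m * r0\<^sup>2 * (s * H a s) - m * ?z s)) (at s)"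
        by (rule H_deriv[OF s0] U_deriv[OF s0] derivative_eq_intros refl | simp add: algebra_simps)+
      have u: "0 < U a s" "U a s \<le> A" "H a s \<le> 0" using pos[of s] s s0 by auto
      then have c: "clU (U a s) = U a s" by (intro clU_id) auto
      have "F1 (U a s) (Om a s) \<le> f (U a s)"
        using F1_le[of "U a s" "Om a s"] u by (smt (verit) c mult_nonneg_nonneg zero_le_power2)
      also have "\<dots> \<le> m\<^sup>2 * U a s" using f_le[of "U a s"] u by auto
      finally have "s\<^sup>2 * F1 (U a s) (Om a s) \<le> r0\<^sup>2 * (m\<^sup>2 * U a s)"
        using s s0 u by (intro order_trans[OF mult_left_mono mult_right_mono]) (auto intro!: power_mono)
      moreover have "m * r0\<^sup>2 * (s * H a s) \<le> m * (s^3 * H a s)"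
      proof -
        have "r0\<^sup>2 * (s * H a s) \<le> s\<^sup>2 * (s * H a s)"
          using s s0 u by (intro mult_right_mono_neg) (auto intro!: power_mono mult_nonneg_nonpos)
        then have "m * (r0\<^sup>2 * (s * H a s)) \<le> m * (s\<^sup>2 * (s * H a s))"
          using m_pos by (intro mult_left_mono) auto
        then show ?thesis by (simp add: power2_eq_square power3_eq_cube mult.assoc)
      qed
      ultimately have "s\<^sup>2 * F1 (U a s) (Om a s) + m * r0\<^sup>2 * (s * H a s) - m * ?z s \<le> 0"
        by (simp add: algebra_simps power2_eq_square)
      then show "exp (- (m * s)) * (s\<^sup>2 * F1 (U a s) (Om a s) + m * r0\<^sup>2 * (s * H a s) - m * ?z s) \<le> 0"
        by (intro mult_nonneg_nonpos) auto
    qed (use r in \<open>auto intro!: continuous_intros continuous_H continuous_U\<close>)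
    then have "0 \<le> ?z r * exp (- (m * r))" by (simp add: H0 assms(2))
    then show ?thesis by (simp add: zero_le_mult_iff)
  qed
  \<comment> \<open>On [r0/2, r0] one has r0^2 <= 4 s^2, the origin of the 4. There u exp(4 m r) is
    nondecreasing, which is impossible for a function positive at r0/2 and zero at r0.\<close>
  have "- (U a r0 * exp (4 * m * r0)) \<le> - (U a (r0/2) * exp (4 * m * (r0/2)))"
  proof (rule nonincreasing_on_Icc[where g="\<lambda>r. - (U a r * exp (4 * m * r))"
        and g'="\<lambda>s. - (exp (4 * m * s) * (s * H a s + 4 * m * U a s))"])
    fix s assume s: "r0/2 < s" "s < r0"
    have s0: "0 < s" using s assms(1) by simp
    show "((\<lambda>r. - (U a r * exp (4 * m * r))) has_real_derivative
        - (exp (4 * m * s) * (s * H a s + 4 * m * U a s))) (at s)"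
      by (rule U_deriv[OF s0] derivative_eq_intros refl | simp add: algebra_simps)+
    have u: "0 < U a s" using pos[of s] s s0 by auto
    have "(r0/2)\<^sup>2 \<le> s\<^sup>2" using s assms(1) by (intro power_mono) auto
    then have "m * r0\<^sup>2 * U a s \<le> m * (4 * s\<^sup>2) * U a s"
      using m_pos u by (intro mult_right_mono mult_left_mono) (auto simp: power_divide)
    then have "0 \<le> s^3 * H a s + m * (4 * s\<^sup>2) * U a s" using p_ge[OF s0 s(2)] by linarith
    also have "\<dots> = s\<^sup>2 * (s * H a s + 4 * m * U a s)"
      by (simp add: algebra_simps power2_eq_square power3_eq_cube)
    finally have "0 \<le> s * H a s + 4 * m * U a s" using s0 by (simp add: zero_le_mult_iff)
    then show "- (exp (4 * m * s) * (s * H a s + 4 * m * U a s)) \<le> 0" by simp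
  qed (use assms(1) in \<open>auto intro!: continuous_intros continuous_U\<close>)
  then have "U a (r0/2) * exp (4 * m * (r0/2)) \<le> 0" by (simp add: assms(2))
  moreover have "0 < U a (r0/2)" using pos[of "r0/2"] assms(1) by auto
  ultimately show False by (simp add: mult_le_0_iff not_le)
qed

text \<open>The first zero is reached with strictly negative slope, hence with positive energy all
  the way, and both signs persist up to some \<open>r1\<close> where U < 0. These strict
  inequalities over the compact [0, r1] survive a small change of amplitude, and any witness for
  \<open>N\<close> would have to lie before \<open>r1\<close>.\<close>

lemma hit_nbhd:
  assumes "a \<notin> N" "x1 < a" "a \<le> A" "0 \<le> r" "U a r \<le> 0"
  shows "\<exists>S. open S \<and> a \<in> S \<and> S \<inter> N = {}"
proof -
  have "0 < U a 0" using assms params by (simp add: U_0)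
  with assms obtain r0 where r0: "0 < r0" "U a r0 = 0" and pos: "\<And>s. 0 \<le> s \<Longrightarrow> s < r0 \<Longrightarrow> 0 < U a s"
    using first_zero[OF continuous_U, of a r] by metis
  have neg: "H a s < 0" if "0 \<le> s" "s < r0" for s
    by (rule H_neg[OF assms(1-3) pos that])
  have UA: "U a s \<le> A" if "0 \<le> s" "s \<le> r0" for s
  proof -
    have "U a s \<le> U a 0" by (rule U_antimono) (use that in \<open>auto intro!: less_imp_le[OF neg]\<close>)
    then show ?thesis using assms by (simp add: U_0)
  qed
  have "H a r0 \<le> 0"
  proof (rule tendsto_upperbound)
    show "(H a \<longlongrightarrow> H a r0) (at_left r0)"
      using continuous_H[of UNIV a] by (meson UNIV_I continuous_on_def tendsto_within_subset subset_UNIV)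
    show "\<forall>\<^sub>F s in at_left r0. H a s \<le> 0"
      using eventually_at_left_real[OF r0(1)] by eventually_elim (use neg less_imp_le in auto)
  qed simp
  moreover have "H a r0 \<noteq> 0"
    by (rule H_neg_at_zero[OF r0]) (use pos UA in \<open>auto intro!: less_imp_le[OF neg]\<close>)
  ultimately have neg0: "H a r0 < 0" by simp
  have Epos: "0 < E a s" if s: "0 \<le> s" "s \<le> r0" for s
  proof -
    have "E a r0 \<le> E a s"
      by (rule E_antimono[OF s]) (use s pos UA in \<open>auto intro!: less_imp_le[OF neg] less_imp_le[OF pos]\<close>)
    moreover have "0 < E a r0" using r0 neg0 by (simp add: E_def V_0)
    ultimately show ?thesis by simp
  qed
  have "isCont (H a) r0" "isCont (E a) r0"
    using continuous_H[of UNIV a] continuous_E[of UNIV a] by (auto simp: continuous_on_eq_continuous_at)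
  then have "\<forall>\<^sub>F s in nhds r0. H a s < 0" "\<forall>\<^sub>F s in nhds r0. 0 < E a s"
    using neg0 Epos[of r0] r0 by (auto simp: isCont_def tendsto_at_iff_tendsto_nhds intro: order_tendstoD)
  then have "\<forall>\<^sub>F s in nhds r0. H a s < 0 \<and> 0 < E a s" by (rule eventually_conj)
  then obtain d where d: "0 < d" "\<And>s. dist s r0 < d \<Longrightarrow> H a s < 0 \<and> 0 < E a s"
    by (auto simp: eventually_nhds_metric)
  define r1 where "r1 = r0 + d/2"
  have r1: "r0 < r1" using d by (simp add: r1_def)
  have ext: "H a s < 0 \<and> 0 < E a s" if "0 \<le> s" "s \<le> r1" for s
  proof (cases "s < r0")
    case True then show ?thesis using neg Epos that by auto
  next
    case False
    then show ?thesis using that d by (intro d(2)) (auto simp: r1_def dist_real_def)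
  qed
  have "U a r1 < U a r0"
  proof (rule DERIV_neg_imp_decreasing_open[OF r1 _ continuous_U])
    fix s assume s: "r0 < s" "s < r1"
    then show "\<exists>y. (U a has_real_derivative y) (at s) \<and> y < 0"
      using U_deriv[of s a] ext[of s] r0(1) by (intro exI[of _ "s * H a s"]) (auto simp: mult_pos_neg)
  qed
  then have U1: "U a r1 < 0" by (simp add: r0)
  let ?S = "{a. \<forall>s\<in>{0..r1}. 0 < - H a s} \<inter> {a. \<forall>s\<in>{0..r1}. 0 < E a s} \<inter> {a. U a r1 < 0}"
  have "continuous_on UNIV (\<lambda>a. U a r1)"
    using continuous_on_compose2[OF continuous_U2, of UNIV "\<lambda>a. (a, r1)"] by (auto simp: continuous_on_Pair)
  moreover have "continuous_on UNIV (\<lambda>(a, s). - H a s)"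
    using continuous_on_minus[OF continuous_H2] by (simp add: case_prod_unfold)
  ultimately have "open ?S"
    by (intro open_Int open_forall_compact continuous_E2 open_Collect_less continuous_on_const)
  moreover have "a \<in> ?S" using ext U1 by auto
  moreover have "x \<notin> N" if x: "x \<in> ?S" for x
  proof
    assume "x \<in> N"
    then obtain r where r: "0 \<le> r" "\<And>s. 0 \<le> s \<Longrightarrow> s \<le> r \<Longrightarrow> 0 < U x s" "0 < H x r \<or> E x r < 0"
      by (auto simp: N_def)
    have "r < r1" using r(2)[of r1] x r1 r0 by force
    then have "r \<in> {0..r1}" using r(1) by simp
    with x have "0 < - H x r" "0 < E x r" by blast+
    then show False using r(3) by linarith
  qed
  ultimately show ?thesis by blast
qed

text \<open>The supremum lies outside the open set \<open>N\<close> but is a limit of its elements.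
  By \<open>hit_nbhd\<close> an amplitude outside \<open>N\<close> whose solution reaches zero has a
  neighbourhood free of \<open>N\<close>, so this solution stays positive.\<close>

lemma threshold_solution:
  obtains a where "x1 < a" "a \<le> A" "\<And>r. 0 \<le> r \<Longrightarrow> 0 < U a r \<and> H a r \<le> 0 \<and> 0 \<le> E a r"
proof -
  let ?X = "N \<inter> {x1..A}"
  define a where "a = Sup ?X"
  have X: "x1 \<in> ?X" "bdd_above ?X" using x1_in_N params by auto
  have a: "x1 \<le> a" "a \<le> A"
    unfolding a_def using X by (auto intro!: cSup_upper cSup_least)
  have "a \<notin> N"
  proof
    assume aN: "a \<in> N"
    then have "a < A" using a A_notin_N by (cases "a = A") auto
    obtain e where e: "0 < e" "ball a e \<subseteq> N" using open_N aN openE by blast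
    define y where "y = a + min (e/2) (A - a)"
    have "y \<in> ball a e" using e \<open>a < A\<close> by (auto simp: y_def dist_real_def)
    then have "y \<in> ?X" using e a \<open>a < A\<close> by (auto simp: y_def)
    then have "y \<le> a" unfolding a_def using X(2) by (rule cSup_upper)
    then show False using e \<open>a < A\<close> by (auto simp: y_def)
  qed
  then have x1a: "x1 < a" using a x1_in_N by (cases "a = x1") auto
  have pos: "0 < U a r" if "0 \<le> r" for r
  proof (rule ccontr)
    assume "\<not> ?thesis"
    then obtain S where S: "open S" "a \<in> S" "S \<inter> N = {}"
      using hit_nbhd[OF \<open>a \<notin> N\<close> x1a a(2) \<open>0 \<le> r\<close>] by auto
    obtain e where e: "0 < e" "ball a e \<subseteq> S" using S openE by blast
    have "a - e < Sup ?X" using e by (simp add: a_def)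
    then obtain y where y: "y \<in> ?X" "a - e < y" using X less_cSupD[of ?X "a - e"] by blast
    have "y \<le> a" unfolding a_def using y(1) X(2) by (rule cSup_upper)
    then have "y \<in> S" using y e by (auto simp: dist_real_def)
    then show False using y S by auto
  qed
  show ?thesis
    by (rule that[OF x1a a(2)]) (use pos not_N[OF \<open>a \<notin> N\<close>] in auto)
qed

text \<open>None of these constants mentions \<open>q\<close>. \<open>T1\<close> bounds the time
  spent above x1 and \<open>T\<close> adds the time to cross [eps, x1]; \<open>kap\<close> is the
  exponential rate that \<open>zone3\<close> provides, \<open>C0\<close> the resulting prefactor,
  and \<open>q\<^sup>2 * Q\<close> bounds r^3 k, the source of \<open>Om\<close> integrated up to
  radius r.\<close>

definition T1 :: real where "T1 = 6 * A / gam + 1"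
definition T :: real where "T = T1 + (x1 / sqrt (2 * c) + 1)"
definition kap :: real where "kap = sqrt del"
definition C0 :: real where "C0 = A * exp (kap * T)"
definition Q :: real where "Q = 2 * b' * C0\<^sup>2 / kap^3"

lemma kap_pos: "0 < kap" and kap_sq: "kap * kap = del" and T1_ge: "1 \<le> T1" and T_ge: "1 \<le> T"
  and T1_le: "T1 \<le> T" and C0_pos: "0 < C0" and Q_pos: "0 < Q"
proof -
  show 1: "0 < kap" and "kap * kap = del" using params by (auto simp: kap_def)
  show "1 \<le> T1" using params by (simp add: T1_def)
  then show "1 \<le> T" "T1 \<le> T" using params by (auto simp: T_def add_increasing2)
  show "0 < C0" using A_pos by (simp add: C0_def)
  then show "0 < Q" using 1 b'_pos by (simp add: Q_def)
qed

section \<open>Decay of the threshold solution, uniformly in the coupling\<close>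

context
  fixes a :: real
  assumes a: "x1 < a" "a \<le> A" and sol: "\<And>r. 0 \<le> r \<Longrightarrow> 0 < U a r \<and> H a r \<le> 0 \<and> 0 \<le> E a r"
begin

lemma U_mono: "0 \<le> x \<Longrightarrow> x \<le> y \<Longrightarrow> U a y \<le> U a x"
  by (rule U_antimono) (use sol in auto)

lemma U_range: "0 \<le> r \<Longrightarrow> 0 < U a r \<and> U a r \<le> A"
  using U_mono[of 0 r] sol[of r] a by (auto simp: U_0)

lemma clU_U: "0 \<le> r \<Longrightarrow> clU (U a r) = U a r"
  using U_range[of r] by (auto intro: clU_id)

text \<open>Otherwise the force stays below - gam on [0, T1], and u <= a - gam r^2 / 6 becomes
  negative. The 1 added in \<open>T1\<close> ensures T1 >= 1, hence T1^2 >= T1 > 6 A / gam.\<close>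

lemma U_T1: "U a T1 < x1"
proof (rule ccontr)
  assume "\<not> ?thesis"
  then have ge: "x1 \<le> U a s" if "0 \<le> s" "s \<le> T1" for s using U_mono[of s T1] that by auto
  have "U a T1 + gam * T1\<^sup>2 / 6 \<le> U a 0 + gam * 0\<^sup>2 / 6"
  proof (rule nonincreasing_on_Icc[where g="\<lambda>r. U a r + gam * r\<^sup>2 / 6" and g'="\<lambda>s. s * (H a s + gam / 3)"])
    fix s assume s: "0 < s" "s < T1"
    show "((\<lambda>r. U a r + gam * r\<^sup>2 / 6) has_real_derivative s * (H a s + gam / 3)) (at s)"
      by (rule U_deriv s derivative_eq_intros refl | simp add: algebra_simps)+
    have "H a s \<le> - gam / 3" using s ge by (intro H_le F1_zone1) auto
    then show "s * (H a s + gam / 3) \<le> 0" using s by (intro mult_nonneg_nonpos) auto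
  qed (use T1_ge in \<open>auto intro!: continuous_intros continuous_U\<close>)
  moreover have "6 * A / gam < T1 * T1"
  proof -
    have "T1 * 1 \<le> T1 * T1" using T1_ge by (intro mult_left_mono) auto
    moreover have "6 * A / gam < T1" by (simp add: T1_def)
    ultimately show ?thesis by linarith
  qed
  then have "6 * A < gam * T1\<^sup>2" using params by (simp add: power2_eq_square field_simps)
  ultimately have "U a T1 < 0" using a by (simp add: U_0)
  then show False using sol[of T1] T1_ge by auto
qed

text \<open>Between eps and x1 the potential part of \<open>E\<close> is at most - c, so nonnegative
  energy gives u'^2 >= 2 c. A monotone solution leaves this range within x1 / sqrt (2 c).\<close>

lemma U_T: "U a T < eps"
proof (rule ccontr)
  assume "\<not> ?thesis"
  then have ge: "eps \<le> U a s" if "0 \<le> s" "s \<le> T" for s using U_mono[of s T] that by auto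
  have "U a T + sqrt (2 * c) * T \<le> U a T1 + sqrt (2 * c) * T1"
  proof (rule nonincreasing_on_Icc[where g="\<lambda>r. U a r + sqrt (2 * c) * r" and g'="\<lambda>s. s * H a s + sqrt (2 * c)"])
    fix s assume s: "T1 < s" "s < T"
    have s0: "0 < s" using s T1_ge by simp
    show "((\<lambda>r. U a r + sqrt (2 * c) * r) has_real_derivative s * H a s + sqrt (2 * c)) (at s)"
      by (rule U_deriv[OF s0] derivative_eq_intros refl | simp)+
    have "U a s \<le> x1" using U_mono[of T1 s] U_T1 s T1_ge by auto
    then have "b'\<^sup>2 * (U a s)\<^sup>2 / 2 - V (U a s) \<le> - c" using ge[of s] s s0 by (intro zone2) auto
    then have "2 * c \<le> (s * H a s)\<^sup>2" using sol[of s] s0 by (auto simp: E_def)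
    then have "sqrt (2 * c) \<le> \<bar>s * H a s\<bar>" by (metis real_sqrt_abs real_sqrt_le_mono)
    moreover have "s * H a s \<le> 0" using sol[of s] s0 by (simp add: mult_nonneg_nonpos)
    ultimately show "s * H a s + sqrt (2 * c) \<le> 0" by linarith
  qed (use T1_le in \<open>auto intro!: continuous_intros continuous_U\<close>)
  moreover have "sqrt (2 * c) * T = sqrt (2 * c) * T1 + x1 + sqrt (2 * c)"
    using params by (simp add: T_def algebra_simps)
  moreover have "0 < sqrt (2 * c)" using params by simp
  ultimately have "U a T < 0" using U_T1 by linarith
  then show False using sol[of T] T_ge by auto
qed

lemma U_small: "T \<le> r \<Longrightarrow> U a r < eps"
  using U_T U_mono[of T r] T_ge by auto

lemma F1_tail: "T \<le> r \<Longrightarrow> del * U a r \<le> F1 (U a r) (Om a r)"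
  using F1_ge[of "U a r" "Om a r"] clU_U[of r] zone3[of "U a r"] U_small[of r] U_range[of r] T_ge
  by auto

definition zz :: "real \<Rightarrow> real" where "zz r = U a r + r * (r * H a r) + kap * (r * U a r)"

text \<open>With \<open>v = r u\<close> one has \<open>v'' \<ge> del v\<close> for \<open>r \<ge> T\<close>, so \<open>z = v' + kap v\<close> satisfies \<open>z' \<ge> kap z\<close>. As \<open>z\<close> grows
  at most linearly, \<open>z \<le> 0\<close>, that is \<open>v' \<le> - kap v\<close>.\<close>

lemma zz_growth:
  assumes "T \<le> x" "x \<le> y"
  shows "zz x * exp (- (kap * x)) \<le> zz y * exp (- (kap * y))"
proof -
  have "- (zz y * exp (- (kap * y))) \<le> - (zz x * exp (- (kap * x)))"
  proof (rule nonincreasing_on_Icc[OF assms(2), where g="\<lambda>r. - (zz r * exp (- (kap * r)))"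
        and g'="\<lambda>s. - (exp (- (kap * s)) * (s * (F1 (U a s) (Om a s) - kap * kap * U a s)))"])
    show "continuous_on {x..y} (\<lambda>r. - (zz r * exp (- (kap * r))))"
      unfolding zz_def by (intro continuous_intros continuous_U continuous_H)
    fix s assume s: "x < s" "s < y"
    have s0: "0 < s" using s assms T_ge by simp
    show "((\<lambda>r. - (zz r * exp (- (kap * r)))) has_real_derivative
        - (exp (- (kap * s)) * (s * (F1 (U a s) (Om a s) - kap * kap * U a s)))) (at s)"
      unfolding zz_def
      by (rule rH_deriv[OF s0] U_deriv[OF s0] derivative_eq_intros refl | simp add: algebra_simps)+
    show "- (exp (- (kap * s)) * (s * (F1 (U a s) (Om a s) - kap * kap * U a s))) \<le> 0"
      using F1_tail[of s] s assms s0 by (auto simp: kap_sq)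
  qed
  then show ?thesis by simp
qed

lemma zz_nonpos:
  assumes "T \<le> r" shows "zz r \<le> 0"
proof -
  have le: "zz r * exp (- (kap * r)) \<le> (1 + kap * s) * eps * exp (- (kap * s))" if s: "r \<le> s" for s
  proof -
    have s0: "0 < s" using s assms T_ge by simp
    have "s * (s * H a s) \<le> 0" using sol[of s] s0 by (simp add: mult_nonneg_nonpos)
    then have "zz s \<le> (1 + kap * s) * U a s" by (simp add: zz_def algebra_simps)
    also have "\<dots> \<le> (1 + kap * s) * eps"
      using U_small[of s] s assms s0 kap_pos by (intro mult_left_mono) auto
    finally have "zz s * exp (- (kap * s)) \<le> (1 + kap * s) * eps * exp (- (kap * s))"
      by (intro mult_right_mono) auto
    then show ?thesis by (rule order_trans[OF zz_growth[OF assms s]])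
  qed
  have "((\<lambda>s. (1 + kap * s) * eps * exp (- (kap * s))) \<longlongrightarrow> 0) at_top"
    using kap_pos by real_asymp
  then have "zz r * exp (- (kap * r)) \<le> 0"
    by (rule tendsto_lowerbound) (use le in \<open>auto simp: eventually_at_top_linorder\<close>)
  then show ?thesis by (simp add: mult_le_0_iff)
qed

text \<open>The derivative of r u exp(kap r) is exp(kap r) \<open>zz\<close>, nonpositive from
  \<open>T\<close> on; before \<open>T\<close> the bound u <= A is absorbed in
  \<open>C0\<close>.\<close>

lemma U_decay: "0 \<le> r \<Longrightarrow> U a r \<le> C0 * exp (- (kap * r))"
proof (cases "T \<le> r")
  case True
  have "r * U a r * exp (kap * r) \<le> T * U a T * exp (kap * T)"
  proof (rule nonincreasing_on_Icc[OF True, where g="\<lambda>r. r * U a r * exp (kap * r)"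
        and g'="\<lambda>s. exp (kap * s) * zz s"])
    fix s assume s: "T < s" "s < r"
    then have s0: "0 < s" using T_ge by simp
    show "((\<lambda>r. r * U a r * exp (kap * r)) has_real_derivative exp (kap * s) * zz s) (at s)"
      unfolding zz_def by (rule U_deriv[OF s0] derivative_eq_intros refl | simp add: algebra_simps)+
    show "exp (kap * s) * zz s \<le> 0" using zz_nonpos[of s] s by (intro mult_nonneg_nonpos) auto
  qed (intro continuous_intros continuous_U)
  also have "\<dots> \<le> r * A * exp (kap * T)"
    using True T_ge U_range[of T] by (intro mult_right_mono mult_mono) auto
  finally have "r * (U a r * exp (kap * r)) \<le> r * C0" by (simp add: C0_def)
  then have "U a r * exp (kap * r) \<le> C0" using True T_ge by simp
  then show ?thesis by (simp add: exp_minus field_simps)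
next
  case False
  assume "0 \<le> r"
  have "A * exp (kap * r) \<le> C0"
    unfolding C0_def using False kap_pos A_pos by (intro mult_left_mono) auto
  moreover have "U a r * exp (kap * r) \<le> A * exp (kap * r)" using U_range[OF \<open>0 \<le> r\<close>] by simp
  ultimately have "U a r * exp (kap * r) \<le> C0" by linarith
  then show ?thesis by (simp add: exp_minus field_simps)
qed

lemma sq_exp: "0 \<le> r \<Longrightarrow> r\<^sup>2 * kap\<^sup>2 \<le> 2 * exp (kap * r)"
proof -
  assume "0 \<le> r"
  then have "0 \<le> kap * r" using kap_pos by simp
  then have "(kap * r)\<^sup>2 \<le> 2 * exp (kap * r)"
    using exp_lower_Taylor_quadratic[of "kap * r"] by linarith
  then show ?thesis by (simp only: power_mult_distrib mult.commute)
qed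

text \<open>The source contains u^2 and hence two decaying exponentials. One absorbs the factor s^2,
  the other is integrated and yields the further division by \<open>kap\<close>.\<close>

lemma K_cube:
  assumes "0 \<le> r" shows "r^3 * K a r \<le> q\<^sup>2 * Q"
proof -
  define D where "D = 2 * b' * C0\<^sup>2 / kap\<^sup>2"
  have "r^3 * K a r + q\<^sup>2 * D / kap * exp (- (kap * r)) \<le> 0^3 * K a 0 + q\<^sup>2 * D / kap * exp (- (kap * 0))"
  proof (rule nonincreasing_on_Icc[OF assms, where g="\<lambda>r. r^3 * K a r + q\<^sup>2 * D / kap * exp (- (kap * r))"
        and g'="\<lambda>s. s\<^sup>2 * F2 (U a s) (Om a s) - q\<^sup>2 * D * exp (- (kap * s))"])
    fix s assume s: "0 < s" "s < r"
    show "((\<lambda>r. r^3 * K a r + q\<^sup>2 * D / kap * exp (- (kap * r))) has_real_derivative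
        s\<^sup>2 * F2 (U a s) (Om a s) - q\<^sup>2 * D * exp (- (kap * s))) (at s)"
      by (rule K_deriv[OF s(1)] derivative_eq_intros refl | use kap_pos in simp)+
    have "(U a s)\<^sup>2 \<le> (C0 * exp (- (kap * s)))\<^sup>2"
      using U_decay[of s] U_range[of s] s by (intro power_mono) auto
    then have "s\<^sup>2 * F2 (U a s) (Om a s) \<le> s\<^sup>2 * (q\<^sup>2 * (C0 * exp (- (kap * s)))\<^sup>2 * b')"
      unfolding F2_def using clU_U[of s] clO_range[of "Om a s"] s
      by (intro mult_left_mono mult_mono) auto
    also have "\<dots> = q\<^sup>2 * b' * C0\<^sup>2 * exp (- (kap * s)) * (s\<^sup>2 * exp (- (kap * s)))"
      by (simp add: power2_eq_square algebra_simps)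
    also have "\<dots> \<le> q\<^sup>2 * b' * C0\<^sup>2 * exp (- (kap * s)) * (2 / kap\<^sup>2)"
      using sq_exp[of s] s kap_pos b'_pos by (intro mult_left_mono) (auto simp: exp_minus field_simps)
    also have "\<dots> = q\<^sup>2 * D * exp (- (kap * s))" by (simp add: D_def)
    finally show "s\<^sup>2 * F2 (U a s) (Om a s) - q\<^sup>2 * D * exp (- (kap * s)) \<le> 0" by simp
  qed (intro continuous_intros continuous_K)
  moreover have "0 \<le> q\<^sup>2 * D / kap * exp (- (kap * r))"
    using kap_pos b'_pos by (simp add: D_def)
  moreover have "q\<^sup>2 * D / kap = q\<^sup>2 * Q" by (simp add: D_def Q_def power2_eq_square power3_eq_cube)
  ultimately show ?thesis by simp
qed

text \<open>By \<open>K_cube\<close>, Om' = r k <= q^2 Q / r^2, so Om + q^2 Q / r is nonincreasing;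
  the factor \<open>* -1\<close> in the proof only produces the plus sign of this second
  term.\<close>

lemma Om_upper_tail:
  assumes "0 < x" "x \<le> y" shows "Om a y \<le> Om a x + q\<^sup>2 * Q / x"
proof -
  have "Om a y - q\<^sup>2 * Q / y * -1 \<le> Om a x - q\<^sup>2 * Q / x * -1"
  proof (rule nonincreasing_on_Icc[OF assms(2), where g="\<lambda>r. Om a r - q\<^sup>2 * Q / r * -1"
        and g'="\<lambda>s. s * K a s - q\<^sup>2 * Q / s\<^sup>2"])
    show "continuous_on {x..y} (\<lambda>r. Om a r - q\<^sup>2 * Q / r * -1)"
      using assms by (intro continuous_intros continuous_Om) auto
    fix s assume s: "x < s" "s < y"
    then have s0: "0 < s" using assms by simp
    show "((\<lambda>r. Om a r - q\<^sup>2 * Q / r * -1) has_real_derivative s * K a s - q\<^sup>2 * Q / s\<^sup>2) (at s)"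
      using s0 by (auto intro!: Om_deriv[OF s0] derivative_eq_intros simp: power2_eq_square)
    show "s * K a s - q\<^sup>2 * Q / s\<^sup>2 \<le> 0"
      using K_cube[of s] s0 by (simp add: field_simps power2_eq_square power3_eq_cube)
  qed
  moreover have "0 \<le> q\<^sup>2 * Q / y" using assms Q_pos by simp
  ultimately show ?thesis by simp
qed

text \<open>The tail estimate blows up at the origin, so on [0, 1] the source is bounded by its
  clipped maximum instead.\<close>

lemma Om_1: "Om a 1 \<le> b + q\<^sup>2 * A\<^sup>2 * b'"
proof -
  have "Om a 1 - q\<^sup>2 * A\<^sup>2 * b' * 1\<^sup>2 / 6 \<le> Om a 0 - q\<^sup>2 * A\<^sup>2 * b' * 0\<^sup>2 / 6"
  proof (rule nonincreasing_on_Icc[where g="\<lambda>r. Om a r - q\<^sup>2 * A\<^sup>2 * b' * r\<^sup>2 / 6"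
        and g'="\<lambda>s. s * (K a s - q\<^sup>2 * A\<^sup>2 * b' / 3)"])
    fix s :: real assume s: "0 < s" "s < 1"
    show "((\<lambda>r. Om a r - q\<^sup>2 * A\<^sup>2 * b' * r\<^sup>2 / 6) has_real_derivative s * (K a s - q\<^sup>2 * A\<^sup>2 * b' / 3)) (at s)"
      by (rule Om_deriv s derivative_eq_intros refl | simp add: algebra_simps)+
    have "s^3 * K a s \<le> 0^3 * K a 0 + q\<^sup>2 * A\<^sup>2 * b' * (s^3 - 0^3) / 3"
      by (rule cube_le[OF _ _ continuous_K K_deriv F2_le]) (use s in auto)
    then have "s^3 * K a s \<le> s^3 * (q\<^sup>2 * A\<^sup>2 * b' / 3)" by (simp add: algebra_simps)
    then have "K a s \<le> q\<^sup>2 * A\<^sup>2 * b' / 3" using s by simp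
    then show "s * (K a s - q\<^sup>2 * A\<^sup>2 * b' / 3) \<le> 0" using s by (intro mult_nonneg_nonpos) auto
  qed (auto intro!: continuous_intros continuous_Om)
  moreover have "0 \<le> q\<^sup>2 * A\<^sup>2 * b'" using b'_pos by simp
  ultimately show ?thesis by (simp add: Om_0)
qed

lemma Om_le:
  assumes "0 \<le> r" shows "Om a r \<le> b + q\<^sup>2 * (A\<^sup>2 * b' + Q)"
proof (cases "r \<le> 1")
  case True
  then have "Om a r \<le> Om a 1" using assms by (intro Om_mono) auto
  moreover have "0 \<le> q\<^sup>2 * Q" using Q_pos by simp
  ultimately show ?thesis using Om_1 by (simp add: algebra_simps)
next
  case False
  then show ?thesis using Om_upper_tail[of 1 r] Om_1 by (simp add: algebra_simps)
qed

text \<open>Smallness of q keeps \<open>Om\<close> in [b, b'], and u lies in [0, A], so the clips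
  disappear and the original system is solved. \<open>Om\<close> is nondecreasing, so the supremum
  taken for \<omega> is its limit at infinity, and \<omega> - Om decays like 1/r.\<close>

lemma profile_of_threshold:
  assumes small: "q\<^sup>2 * (A\<^sup>2 * b' + Q) \<le> b' - b"
  shows "soliton_profile f q (U a) (H a) (Om a) (K a) (Sup (Om a ` {0..}))"
proof -
  let ?w = "Sup (Om a ` {0..})"
  have clO_Om: "clO (Om a r) = Om a r" if "0 \<le> r" for r
  proof -
    have "b \<le> Om a r" "Om a r \<le> b'" using Om_ge[OF that, of a] Om_le[OF that] small by linarith+
    then show ?thesis by (simp add: clO_def)
  qed
  have bdd: "bdd_above (Om a ` {0..})" using Om_le by (auto intro!: bdd_aboveI2)
  have Om_w: "Om a r \<le> ?w" if "0 \<le> r" for r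
    using that by (intro cSup_upper bdd) auto
  have w_Om: "?w \<le> Om a r + q\<^sup>2 * Q / r" if "0 < r" for r
  proof (rule cSup_least)
    fix y assume "y \<in> Om a ` {0..}"
    then obtain s where s: "0 \<le> s" "y = Om a s" by auto
    have "y \<le> Om a (max r s)" using s by (auto intro!: Om_mono)
    then show "y \<le> Om a r + q\<^sup>2 * Q / r" using Om_upper_tail[of r "max r s"] that by auto
  qed auto
  have "\<exists>C. \<forall>r\<ge>0. \<bar>U a r\<bar> \<le> C / (1 + r)^2"
  proof (rule decay_bound[OF continuous_U order_refl])
    fix r :: real assume r: "1 \<le> r"
    have "r\<^sup>2 * \<bar>U a r\<bar> \<le> r\<^sup>2 * (C0 * exp (- (kap * r)))"
      using U_decay[of r] U_range[of r] r by (intro mult_left_mono) auto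
    also have "\<dots> = C0 * (r\<^sup>2 * exp (- (kap * r)))" by simp
    also have "\<dots> \<le> C0 * (2 / kap\<^sup>2)"
      using sq_exp[of r] r kap_pos C0_pos by (intro mult_left_mono) (auto simp: exp_minus field_simps)
    finally show "r\<^sup>2 * \<bar>U a r\<bar> \<le> C0 * (2 / kap\<^sup>2)" .
  qed
  moreover have "\<exists>C. \<forall>r\<ge>0. \<bar>r * H a r\<bar> \<le> C / (1 + r)^2"
  proof (rule decay_bound[OF _ T_ge])
    fix r assume r: "T \<le> r"
    \<comment> \<open>In the tail the force is positive, so r^3 |h| is nonincreasing. This gives
      |u'| = O(r^(-2)), which is square integrable at infinity in three dimensions.\<close>
    have "r^3 * - H a r \<le> T^3 * - H a T + 0 * (r^3 - T^3) / 3"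
    proof (rule cube_le[OF _ r continuous_on_minus[OF continuous_H]])
      fix s assume s: "T < s" "s < r"
      then show "((\<lambda>r. r ^ 3 * - H a r) has_real_derivative s\<^sup>2 * - F1 (U a s) (Om a s)) (at s)"
        using DERIV_minus[OF H_deriv[of s a]] T_ge by simp
      have "0 < del * U a s" using params U_range[of s] s T_ge by auto
      then show "- F1 (U a s) (Om a s) \<le> 0" using F1_tail[of s] s by auto
    qed (use T_ge in auto)
    moreover have "r\<^sup>2 * \<bar>r * H a r\<bar> = r^3 * - H a r"
      using sol[of r] r T_ge by (simp add: abs_mult power2_eq_square power3_eq_cube)
    ultimately show "r\<^sup>2 * \<bar>r * H a r\<bar> \<le> T^3 * - H a T" by simp
  qed (intro continuous_intros continuous_H)
  moreover have "\<exists>C. \<forall>r\<ge>0. \<bar>r * K a r\<bar> \<le> C / (1 + r)^2"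
  proof (rule decay_bound[OF _ order_refl])
    fix r :: real assume r: "1 \<le> r"
    have "r\<^sup>2 * \<bar>r * K a r\<bar> = r^3 * K a r"
      using K_nonneg'[of r a] r by (simp add: abs_mult power2_eq_square power3_eq_cube)
    then show "r\<^sup>2 * \<bar>r * K a r\<bar> \<le> q\<^sup>2 * Q" using K_cube[of r] r by simp
  qed (intro continuous_intros continuous_K)
  moreover have "\<exists>C. \<forall>r\<ge>0. \<bar>?w - Om a r\<bar> \<le> C / (1 + r)^1"
  proof (rule decay_bound[OF _ order_refl])
    fix r :: real assume r: "1 \<le> r"
    show "r^1 * \<bar>?w - Om a r\<bar> \<le> q\<^sup>2 * Q"
      using w_Om[of r] Om_w[of r] r by (simp add: field_simps)
  qed (intro continuous_intros continuous_Om)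
  moreover have "((\<lambda>r. r^3 * H a r) has_real_derivative r\<^sup>2 * (f (U a r) - (Om a r)\<^sup>2 * U a r)) (at r)"
    "((\<lambda>r. r^3 * K a r) has_real_derivative r\<^sup>2 * (q\<^sup>2 * (U a r)\<^sup>2 * Om a r)) (at r)" if "0 < r" for r
    using H_deriv[OF that, of a] K_deriv[OF that, of a] clU_U[of r] clO_Om[of r] that
    by (simp_all add: F1_def F2_def)
  moreover have "3 * H a 0 = f (U a 0) - (Om a 0)\<^sup>2 * U a 0" "3 * K a 0 = q\<^sup>2 * (U a 0)\<^sup>2 * Om a 0"
    using clU_U[of 0] clO_Om[of 0] by (simp_all add: H_0 K_0 U_0 Om_0 F1_def F2_def)
  ultimately show ?thesis
    unfolding soliton_profile_def
    by (intro conjI allI impI continuous_U continuous_Om continuous_H continuous_K U_deriv Om_deriv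
        conjunct1[OF U_range])
qed

end

lemma exists_soliton_profile:
  assumes "q\<^sup>2 * (A\<^sup>2 * b' + Q) \<le> b' - b"
  shows "\<exists>u h Om k \<omega>. soliton_profile f q u h Om k \<omega>"
proof -
  obtain a where "x1 < a" "a \<le> A" "\<And>r. 0 \<le> r \<Longrightarrow> 0 < U a r \<and> H a r \<le> 0 \<and> 0 \<le> E a r"
    using threshold_solution by blast
  from profile_of_threshold[OF this assms] show ?thesis by blast
qed

end

lemma (in shooting) soliton_profiles:
  "\<exists>q0>0. \<forall>q. 0 < q \<and> q < q0 \<longrightarrow> (\<exists>u h Om k \<omega>. soliton_profile f q u h Om k \<omega>)"
proof -
  \<comment> \<open>The instance q = 1 only names the value of \<open>Q\<close>, which is the same
    for every q; the bound on q can thus be written down before q is chosen.\<close>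
  interpret one: shooting_q V f b b' m eps x1 A gam c del Lf R0 beta rb 1
    by unfold_locales
  define X where "X = A\<^sup>2 * b' + one.Q"
  have X: "0 < X" using one.Q_pos A_pos b'_pos by (simp add: X_def add_pos_pos)
  have "\<exists>u h Om k \<omega>. soliton_profile f q u h Om k \<omega>" if q: "0 < q" "q < sqrt ((b' - b) / X)" for q
  proof -
    interpret shooting_q V f b b' m eps x1 A gam c del Lf R0 beta rb q
      by unfold_locales
    have "Q = one.Q"
      by (simp add: Q_def one.Q_def C0_def one.C0_def T_def one.T_def T1_def one.T1_def kap_def one.kap_def)
    moreover have "q\<^sup>2 < (b' - b) / X"
      using q by (metis less_imp_le real_sqrt_less_iff real_sqrt_unique)
    ultimately show ?thesis
      using X by (intro exists_soliton_profile) (simp add: X_def field_simps)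
  qed
  moreover have "0 < sqrt ((b' - b) / X)" using X params by simp
  ultimately show ?thesis by blast
qed

section \<open>Directional derivatives and integration by parts\<close>

text \<open>Fields such as h(|x|) x_j are differentiated along single directions, where the origin
  can be treated by hand. Such a derivative at every point, together with a bound, is what the
  integration by parts uses.\<close>

definition dirderiv :: "'a::real_normed_vector \<Rightarrow> ('a \<Rightarrow> 'b::real_normed_vector) \<Rightarrow> ('a \<Rightarrow> 'b) \<Rightarrow> bool" where
  "dirderiv b f g \<longleftrightarrow> (\<forall>x. ((\<lambda>t. f (x + t *\<^sub>R b)) has_vector_derivative g x) (at 0))"

lemma dirderiv_line:
  assumes "dirderiv b f g"
  shows "((\<lambda>s. f (x + s *\<^sub>R b)) has_vector_derivative g (x + t *\<^sub>R b)) (at t within S)"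
proof -
  have "((\<lambda>s. f ((x + t *\<^sub>R b) + s *\<^sub>R b)) has_vector_derivative g (x + t *\<^sub>R b)) (at 0)"
    using assms by (simp add: dirderiv_def)
  then have "((\<lambda>s. f ((x + t *\<^sub>R b) + s *\<^sub>R b)) has_vector_derivative g (x + t *\<^sub>R b)) (at (t - t))"
    by simp
  moreover have "((\<lambda>s. s - t) has_real_derivative 1) (at t)" by (auto intro!: derivative_eq_intros)
  ultimately have "(((\<lambda>s. f ((x + t *\<^sub>R b) + s *\<^sub>R b)) \<circ> (\<lambda>s. s - t)) has_vector_derivative 1 *\<^sub>R g (x + t *\<^sub>R b)) (at t)"
    by (intro vector_diff_chain_at) (auto simp: has_real_derivative_iff_has_vector_derivative)
  then have "((\<lambda>s. f (x + s *\<^sub>R b)) has_vector_derivative g (x + t *\<^sub>R b)) (at t)"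
    by (simp add: o_def algebra_simps)
  then show ?thesis by (rule has_vector_derivative_at_within)
qed

lemma compactly_supported:
  fixes f :: "'a::euclidean_space \<Rightarrow> 'b::euclidean_space"
  assumes "continuous_on UNIV f" "compact K" "\<And>x. x \<notin> K \<Longrightarrow> f x = 0"
  shows "integrable lborel f" "\<exists>B. \<forall>x. norm (f x) \<le> B"
proof -
  have c: "continuous_on K f" by (rule continuous_on_subset[OF assms(1)]) simp
  have "integrable lborel (\<lambda>x. indicator K x *\<^sub>R f x)"
    by (rule borel_integrable_compact[OF assms(2) c])
  also have "(\<lambda>x. indicator K x *\<^sub>R f x) = f"
    using assms(3) by (auto simp: indicator_def fun_eq_iff)
  finally show "integrable lborel f" .
  have "bounded (f ` K)" by (intro compact_imp_bounded compact_continuous_image c assms)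
  then obtain B where B: "\<And>x. x \<in> K \<Longrightarrow> norm (f x) \<le> B" by (auto simp: bounded_iff)
  have "norm (f x) \<le> max B 0" for x
    using B[of x] assms(3)[of x] by (cases "x \<in> K") auto
  then show "\<exists>B. \<forall>x. norm (f x) \<le> B" by blast
qed

text \<open>By translation invariance every difference quotient of \<open>f\<close> has integral zero; dominated convergence
  then gives the claim. No product structure of the space is used.\<close>

lemma integral_dirderiv_eq_0:
  fixes f g :: "'a::euclidean_space \<Rightarrow> 'b::euclidean_space"
  assumes d: "dirderiv b f g" and bnd: "\<And>x. norm (g x) \<le> B"
    and c: "continuous_on UNIV f" and K: "compact K" "\<And>x. x \<notin> K \<Longrightarrow> f x = 0"
  shows "has_bochner_integral lborel g 0"
proof -
  define \<epsilon> :: "nat \<Rightarrow> real" where "\<epsilon> n = 1 / (real n + 1)" for n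
  define D where "D n x = (1 / \<epsilon> n) *\<^sub>R (f (x + \<epsilon> n *\<^sub>R b) - f x)" for n x
  have eps: "0 < \<epsilon> n" "\<epsilon> n \<le> 1" for n by (auto simp: \<epsilon>_def)
  have int_f: "integrable lborel f" by (rule compactly_supported(1)[OF c K])
  have cs: "continuous_on UNIV (\<lambda>x. f (x + v))" for v
    by (intro continuous_on_compose2[OF c] continuous_intros) auto
  have transl: "integrable lborel (\<lambda>x. f (x + v))" "(\<integral>x. f (x + v) \<partial>lborel) = (\<integral>x. f x \<partial>lborel)" for v
  proof -
    have m: "f \<in> borel_measurable borel" by (rule borel_measurable_continuous_onI[OF c])
    have "integrable (distr lborel borel ((+) v)) f" by (subst lborel_distr_plus) (rule int_f)
    then show "integrable lborel (\<lambda>x. f (x + v))"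
      by (subst (asm) integrable_distr_eq) (auto simp: m add.commute)
    have "(\<integral>x. f x \<partial>lborel) = (\<integral>x. f x \<partial>distr lborel borel ((+) v))" by (subst lborel_distr_plus) simp
    also have "\<dots> = (\<integral>x. f (v + x) \<partial>lborel)" by (rule integral_distr) (auto simp: m)
    finally show "(\<integral>x. f (x + v) \<partial>lborel) = (\<integral>x. f x \<partial>lborel)" by (simp add: add.commute)
  qed
  have lim: "(\<lambda>n. D n x) \<longlonglongrightarrow> g x" for x
  proof -
    have "((\<lambda>t. (1 / t) *\<^sub>R (f (x + t *\<^sub>R b) - f x)) \<longlongrightarrow> g x) (at 0)"
    proof (rule LIM_zero_cancel, rule tendsto_norm_zero_cancel)
      have "((\<lambda>t. (1 / \<bar>t\<bar>) *\<^sub>R (f (x + t *\<^sub>R b) - (f x + t *\<^sub>R g x))) \<longlongrightarrow> 0) (at 0)"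
        using d[unfolded dirderiv_def, rule_format, of x]
        by (simp add: has_vector_derivative_def has_derivative_at2)
      then have "((\<lambda>t. norm ((1 / \<bar>t\<bar>) *\<^sub>R (f (x + t *\<^sub>R b) - (f x + t *\<^sub>R g x)))) \<longlongrightarrow> 0) (at 0)"
        by (rule tendsto_norm_zero)
      then show "((\<lambda>t. norm ((1 / t) *\<^sub>R (f (x + t *\<^sub>R b) - f x) - g x)) \<longlongrightarrow> 0) (at 0)"
      proof (rule Lim_transform_eventually)
        show "\<forall>\<^sub>F t in at 0. norm ((1 / \<bar>t\<bar>) *\<^sub>R (f (x + t *\<^sub>R b) - (f x + t *\<^sub>R g x)))
            = norm ((1 / t) *\<^sub>R (f (x + t *\<^sub>R b) - f x) - g x)"
          using eventually_neq_at_within[of 0 0 UNIV]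
        proof eventually_elim
          case (elim t)
          then have "(1 / t) *\<^sub>R (f (x + t *\<^sub>R b) - f x) - g x = (1 / t) *\<^sub>R (f (x + t *\<^sub>R b) - (f x + t *\<^sub>R g x))"
            by (simp add: scaleR_diff_right scaleR_add_right)
          then show ?case by simp
        qed
      qed
    qed
    moreover have "filterlim \<epsilon> (at 0) sequentially"
      unfolding filterlim_at \<epsilon>_def using LIMSEQ_inverse_real_of_nat by (auto simp: inverse_eq_divide add.commute)
    ultimately show ?thesis unfolding D_def by (rule filterlim_compose)
  qed
  obtain R where "\<And>x. x \<in> K \<Longrightarrow> norm x \<le> R"
    using compact_imp_bounded[OF K(1)] by (auto simp: bounded_iff)
  then have R: "K \<subseteq> cball 0 R" by auto
  define K' where "K' = cball (0::'a) (R + norm b)"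
  have "0 \<le> B" using bnd[of 0] norm_ge_zero order_trans by blast
  \<comment> \<open>The mean value inequality along the line bounds the quotients by
    \<open>B\<close>. The steps are at most 1, so all quotients vanish outside the ball enlarged by
    the length of \<open>b\<close>.\<close>
  have dom: "norm (D n x) \<le> indicator K' x *\<^sub>R B" for n x
  proof (cases "x \<in> K'")
    case True
    have "norm (f (x + \<epsilon> n *\<^sub>R b) - f (x + 0 *\<^sub>R b)) \<le> B * norm (\<epsilon> n - 0)"
    proof (rule differentiable_bound[where f="\<lambda>s. f (x + s *\<^sub>R b)" and S=UNIV
          and f'="\<lambda>s h. h *\<^sub>R g (x + s *\<^sub>R b)"])
      fix s
      show "((\<lambda>s. f (x + s *\<^sub>R b)) has_derivative (\<lambda>h. h *\<^sub>R g (x + s *\<^sub>R b))) (at s within UNIV)"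
        using dirderiv_line[OF d] by (simp add: has_vector_derivative_def)
      show "onorm (\<lambda>h. h *\<^sub>R g (x + s *\<^sub>R b)) \<le> B"
      proof (rule onorm_bound[OF \<open>0 \<le> B\<close>])
        fix h :: real
        show "norm (h *\<^sub>R g (x + s *\<^sub>R b)) \<le> B * norm h"
          using mult_left_mono[OF bnd[of "x + s *\<^sub>R b"], of "\<bar>h\<bar>"] by (simp add: mult.commute)
      qed
    qed auto
    then have "norm (f (x + \<epsilon> n *\<^sub>R b) - f x) \<le> B * \<epsilon> n" using eps[of n] by simp
    then have "norm (f (x + \<epsilon> n *\<^sub>R b) - f x) / \<epsilon> n \<le> B" using eps[of n] by (simp add: pos_divide_le_eq)
    moreover have "norm (D n x) = norm (f (x + \<epsilon> n *\<^sub>R b) - f x) / \<epsilon> n"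
      unfolding D_def norm_scaleR using eps[of n] by simp
    ultimately show ?thesis using True by simp
  next
    case False
    then have x: "R + norm b < norm x" by (simp add: K'_def)
    have "norm x \<le> norm (x + \<epsilon> n *\<^sub>R b) + norm (\<epsilon> n *\<^sub>R b)"
      using norm_triangle_ineq4[of "x + \<epsilon> n *\<^sub>R b" "\<epsilon> n *\<^sub>R b"] by simp
    moreover have "norm (\<epsilon> n *\<^sub>R b) \<le> norm b" using eps[of n] by (simp add: mult_left_le_one_le)
    ultimately have "R < norm (x + \<epsilon> n *\<^sub>R b)" using x by linarith
    moreover have "R < norm x" using x norm_ge_zero[of b] by linarith
    ultimately have "x + \<epsilon> n *\<^sub>R b \<notin> K" "x \<notin> K" using R by auto
    then show ?thesis using False by (simp add: D_def K(2))
  qed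
  have meas: "D n \<in> borel_measurable lborel" for n
    unfolding D_def using cs[of "\<epsilon> n *\<^sub>R b"] c
    by (simp, intro borel_measurable_continuous_onI continuous_intros)
  have g: "g \<in> borel_measurable lborel"
    by (rule borel_measurable_LIMSEQ_metric[OF meas lim])
  have w: "integrable lborel (\<lambda>x. indicator K' x *\<^sub>R B)"
    by (rule borel_integrable_compact) (auto simp: K'_def)
  have "integral\<^sup>L lborel (D n) = 0" for n
    unfolding D_def using transl[of "\<epsilon> n *\<^sub>R b"] int_f by simp
  moreover have "(\<lambda>n. integral\<^sup>L lborel (D n)) \<longlonglongrightarrow> integral\<^sup>L lborel g"
    by (rule integral_dominated_convergence[OF g meas w]) (use lim dom in auto)
  ultimately have "integral\<^sup>L lborel g = 0" by (simp add: LIMSEQ_const_iff)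
  moreover have "integrable lborel g"
    by (rule integrable_dominated_convergence[where s=D, OF g meas w]) (use lim dom in auto)
  ultimately show ?thesis by (simp add: has_bochner_integral_iff)
qed

lemma dirderiv_bilinear:
  assumes "bounded_bilinear p" "dirderiv b f f'" "dirderiv b g g'"
  shows "dirderiv b (\<lambda>x. p (f x) (g x)) (\<lambda>x. p (f x) (g' x) + p (f' x) (g x))"
  unfolding dirderiv_def
proof
  fix x
  show "((\<lambda>t. p (f (x + t *\<^sub>R b)) (g (x + t *\<^sub>R b))) has_vector_derivative p (f x) (g' x) + p (f' x) (g x)) (at 0)"
    using bounded_bilinear.has_vector_derivative[OF assms(1), of "\<lambda>t. f (x + t *\<^sub>R b)" "f' x" 0 UNIV
        "\<lambda>t. g (x + t *\<^sub>R b)" "g' x"] assms(2,3) by (simp add: dirderiv_def)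
qed

lemma dirderiv_bounded_linear:
  assumes "bounded_linear p" "dirderiv b f f'"
  shows "dirderiv b (\<lambda>x. p (f x)) (\<lambda>x. p (f' x))"
  unfolding dirderiv_def
  using bounded_linear.has_vector_derivative[OF assms(1)] assms(2) by (auto simp: dirderiv_def)

lemma class_C_1:
  assumes "class_C (Suc 0) f"
  shows "continuous_on UNIV f" "b \<in> Basis \<Longrightarrow> continuous_on UNIV (pd b f)" "dirderiv b f (pd b f)"
proof -
  have d: "f differentiable (at x)" for x using assms by simp
  then show "continuous_on UNIV f"
    by (intro continuous_at_imp_continuous_on ballI differentiable_imp_continuous_within)
  show "b \<in> Basis \<Longrightarrow> continuous_on UNIV (pd b f)" using assms by simp
  show "dirderiv b f (pd b f)" unfolding dirderiv_def
  proof
    fix x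
    have f: "(f has_derivative frechet_derivative f (at x)) (at (x + 0 *\<^sub>R b))"
      using d[of x] by (simp add: frechet_derivative_works)
    have "((\<lambda>t. x + t *\<^sub>R b) has_derivative (\<lambda>t. t *\<^sub>R b)) (at 0)"
      by (auto intro!: derivative_eq_intros)
    from diff_chain_at[OF this f]
    have "((\<lambda>t. f (x + t *\<^sub>R b)) has_derivative (\<lambda>t. frechet_derivative f (at x) (t *\<^sub>R b))) (at 0)"
      by (simp add: o_def)
    moreover have "frechet_derivative f (at x) (t *\<^sub>R b) = t *\<^sub>R pd b f x" for t
      using linear_frechet_derivative[OF d[of x]] by (simp add: pd_def linear_cmul)
    ultimately show "((\<lambda>t. f (x + t *\<^sub>R b)) has_vector_derivative pd b f x) (at 0)"
      by (simp add: has_vector_derivative_def)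
  qed
qed

lemma test_function_D:
  assumes "test_function \<eta>"
  obtains K where "compact K" "\<And>x. x \<notin> K \<Longrightarrow> \<eta> x = 0" "\<And>x b. x \<notin> K \<Longrightarrow> pd b \<eta> x = 0"
    "continuous_on UNIV \<eta>" "\<And>b. b \<in> Basis \<Longrightarrow> continuous_on UNIV (pd b \<eta>)" "\<And>b. dirderiv b \<eta> (pd b \<eta>)"
proof
  let ?K = "closure {x. \<eta> x \<noteq> 0}"
  have C: "class_C (Suc 0) \<eta>" using assms unfolding test_function_def by blast
  show "compact ?K" using assms by (simp add: test_function_def)
  show 0: "\<eta> x = 0" if "x \<notin> ?K" for x
    using that subsetD[OF closure_subset, of x "{x. \<eta> x \<noteq> 0}"] by blast
  show "pd b \<eta> x = 0" if x: "x \<notin> ?K" for x b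
  proof -
    have "((\<lambda>_. 0) has_derivative (\<lambda>_. 0)) (at x)" by simp
    then have "(\<eta> has_derivative (\<lambda>_. 0)) (at x)"
    proof (rule has_derivative_transform_within_open[where s="- ?K"])
      show "x \<in> - ?K" using x unfolding Compl_iff .
      show "0 = \<eta> y" if "y \<in> - ?K" for y by (rule 0[symmetric]) (use that in \<open>rule ComplD\<close>)
    qed (intro open_Compl closed_closure)
    then show ?thesis by (simp add: pd_def frechet_derivative_at[symmetric])
  qed
  show "continuous_on UNIV \<eta>" "b \<in> Basis \<Longrightarrow> continuous_on UNIV (pd b \<eta>)" "dirderiv b \<eta> (pd b \<eta>)" for b
    by (rule class_C_1[OF C], assumption?)+
qed

text \<open>By the Leibniz rule the integrand is the derivative along \<open>b\<close> of p(f,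
  \<eta>), which has compact support. A continuous majorant \<open>M\<close> controls
  \<open>f'\<close>; second derivatives of radial profiles come with such a majorant
  directly.\<close>

lemma integral_divergence_eq_0:
  fixes f f' :: "'a::euclidean_space \<Rightarrow> 'b::euclidean_space" and \<eta> :: "'a \<Rightarrow> 'c::euclidean_space"
    and p :: "'b \<Rightarrow> 'c \<Rightarrow> 'd::euclidean_space"
  assumes p: "bounded_bilinear p" and b: "b \<in> Basis" and f: "continuous_on UNIV f" and d: "dirderiv b f f'"
    and M: "continuous_on UNIV M" "\<And>x. norm (f' x) \<le> M x" and \<eta>: "test_function \<eta>"
  shows "has_bochner_integral lborel (\<lambda>x. p (f x) (pd b \<eta> x) + p (f' x) (\<eta> x)) 0"
proof -
  obtain K where K: "compact K" "\<And>x. x \<notin> K \<Longrightarrow> \<eta> x = 0" "\<And>x b. x \<notin> K \<Longrightarrow> pd b \<eta> x = 0"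
    "continuous_on UNIV \<eta>" "\<And>b. b \<in> Basis \<Longrightarrow> continuous_on UNIV (pd b \<eta>)" "\<And>b. dirderiv b \<eta> (pd b \<eta>)"
    using \<eta> by (rule test_function_D) (rule that; assumption)
  interpret p: bounded_bilinear p by (rule p)
  obtain C where C: "0 < C" "\<And>x y. norm (p x y) \<le> norm x * norm y * C" using p.pos_bounded by blast
  let ?R = "\<lambda>x. norm (f x) * norm (pd b \<eta> x) * C + M x * norm (\<eta> x) * C"
  have "continuous_on UNIV ?R" using K(4) K(5)[OF b] by (intro continuous_intros f M)
  then obtain B where B: "\<And>x. norm (?R x) \<le> B"
    using compactly_supported(2)[OF _ K(1), of ?R] K(2,3) by auto
  have bnd: "norm (p (f x) (pd b \<eta> x) + p (f' x) (\<eta> x)) \<le> B" for x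
  proof -
    have "norm (p (f x) (pd b \<eta> x) + p (f' x) (\<eta> x)) \<le> norm (f x) * norm (pd b \<eta> x) * C + norm (f' x) * norm (\<eta> x) * C"
      by (intro order_trans[OF norm_triangle_ineq] add_mono C)
    also have "\<dots> \<le> ?R x" using C(1) M(2)[of x] by (intro add_mono mult_right_mono) auto
    also have "\<dots> \<le> B" using B[of x] by simp
    finally show ?thesis .
  qed
  show ?thesis
    by (rule integral_dirderiv_eq_0[OF dirderiv_bilinear[OF p d K(6)] bnd _ K(1)])
       (use K(2) in \<open>auto intro!: p.continuous_on f K(4) simp: p.zero_right\<close>)
qed

lemma locally_integrable_continuous:
  assumes "continuous_on UNIV f" shows "locally_integrable f"
  unfolding locally_integrable_def set_integrable_def
  using borel_integrable_compact continuous_on_subset[OF assms] by blast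

lemma weak_pd_classical:
  fixes f g :: "'a::euclidean_space \<Rightarrow> 'b::euclidean_space"
  assumes b: "b \<in> Basis" and f: "continuous_on UNIV f" and g: "continuous_on UNIV g" and d: "dirderiv b f g"
  shows "weak_pd b f g"
  unfolding weak_pd_def
proof (intro conjI allI impI locally_integrable_continuous f g)
  fix \<eta> :: "'a \<Rightarrow> real" assume \<eta>: "test_function \<eta>"
  obtain K where K: "compact K" "\<And>x. x \<notin> K \<Longrightarrow> \<eta> x = 0" "\<And>x b. x \<notin> K \<Longrightarrow> pd b \<eta> x = 0"
    "continuous_on UNIV \<eta>" "\<And>b. b \<in> Basis \<Longrightarrow> continuous_on UNIV (pd b \<eta>)" "\<And>b. dirderiv b \<eta> (pd b \<eta>)"
    using \<eta> by (rule test_function_D) (rule that; assumption)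
  have c: "continuous_on UNIV (\<lambda>x. pd b \<eta> x *\<^sub>R f x)" "continuous_on UNIV (\<lambda>x. \<eta> x *\<^sub>R g x)"
    by (intro continuous_intros f g K(4) K(5)[OF b])+
  have "integrable lborel (\<lambda>x. pd b \<eta> x *\<^sub>R f x)" "integrable lborel (\<lambda>x. \<eta> x *\<^sub>R g x)"
    by (rule compactly_supported(1)[OF c(1) K(1)] compactly_supported(1)[OF c(2) K(1)]; use K(2,3) in simp)+
  moreover have "has_bochner_integral lborel (\<lambda>x. pd b \<eta> x *\<^sub>R f x + \<eta> x *\<^sub>R g x) 0"
    by (rule integral_divergence_eq_0[OF bounded_bilinear.flip[OF bounded_bilinear_scaleR] b f d _ order_refl \<eta>])
       (intro continuous_intros g)
  ultimately show "(\<integral>x. pd b \<eta> x *\<^sub>R f x \<partial>lborel) = - (\<integral>x. \<eta> x *\<^sub>R g x \<partial>lborel)"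
    by (simp add: has_bochner_integral_iff add_eq_0_iff2)
qed

text \<open>Where 2^k < |x| <= 2^(k+1) the function is at most 16^(-k), and the ball has volume of
  order 8^k, which leaves a geometric series of ratio 1/2. Square integrability of the profile and
  dominated convergence for \<phi> both rest on this majorant.\<close>

lemma integrable_inverse_power4:
  "integrable lborel (\<lambda>x::real^3. 1 / (1 + norm x)^4)"
proof (rule integrableI_bounded)
  show "(\<lambda>x::real^3. 1 / (1 + norm x)^4) \<in> borel_measurable lborel" by measurable
  let ?S = "\<lambda>k. cball (0::real^3) (2^(k+1))"
  have pow16: "((2::real)^k)^4 = 16^k" for k
    by (subst power_mult[symmetric], subst mult.commute, subst power_mult) simp
  have pt: "ennreal (1 / (1 + norm x)^4) \<le> (\<Sum>k. ennreal (1 / 16^k) * indicator (?S k) x)" for x :: "real^3"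
  proof -
    define k where "k = (LEAST k. norm x \<le> 2^(k+1))"
    obtain n :: nat where "norm x < 2 ^ n" using real_arch_pow[of 2 "norm x"] by auto
    then have "norm x \<le> 2^(n+1)" by (rule less_imp_le[OF less_le_trans]) simp
    then have k1: "norm x \<le> 2^(k+1)" unfolding k_def by (rule LeastI)
    have "16^k \<le> (1 + norm x)^4"
    proof (cases k)
      case (Suc j)
      then have "\<not> norm x \<le> 2^(j+1)" using not_less_Least[of j "\<lambda>k. norm x \<le> 2^(k+1)"] by (simp add: k_def)
      then have "2^k \<le> 1 + norm x" by (simp add: Suc)
      then have "(2^k)^4 \<le> (1 + norm x)^4" by (intro power_mono) auto
      then show ?thesis by (simp add: pow16)
    qed simp
    then have "ennreal (1 / (1 + norm x)^4) \<le> ennreal (1 / 16^k) * indicator (?S k) x"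
      using k1 by (auto intro!: ennreal_leI divide_left_mono mult_pos_pos zero_less_power add_pos_nonneg)
    also have "\<dots> = (\<Sum>k\<in>{k}. ennreal (1 / 16^k) * indicator (?S k) x)"
      by (subst sum.insert) auto
    also have "\<dots> \<le> (\<Sum>k. ennreal (1 / 16^k) * indicator (?S k) x)"
      by (rule sum_le_suminf) auto
    finally show ?thesis .
  qed
  have "(\<integral>\<^sup>+x. ennreal (norm (1 / (1 + norm (x::real^3))^4)) \<partial>lborel)
      \<le> (\<integral>\<^sup>+x. (\<Sum>k. ennreal (1 / 16^k) * indicator (?S k) x) \<partial>lborel)"
    by (intro nn_integral_mono) (use pt in auto)
  also have "\<dots> = (\<Sum>k. \<integral>\<^sup>+x. ennreal (1 / 16^k) * indicator (?S k) x \<partial>lborel)"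
    by (rule nn_integral_suminf, intro borel_measurable_times_ennreal borel_measurable_const
        borel_measurable_indicator) simp
  also have "\<dots> = (\<Sum>k. ennreal (8 * unit_ball_vol 3 * (1/2)^k))"
  proof (rule suminf_cong)
    fix k
    have "(\<integral>\<^sup>+x. ennreal (1 / 16^k) * indicator (?S k) x \<partial>lborel) = ennreal (1 / 16^k) * emeasure lborel (?S k)"
      by (rule nn_integral_cmult_indicator) auto
    also have "\<dots> = ennreal (1 / 16^k) * ennreal (unit_ball_vol 3 * (2^(k+1))^3)"
      by (subst emeasure_cball) auto
    also have "\<dots> = ennreal (1 / 16^k * (unit_ball_vol 3 * (2^(k+1))^3))"
      by (rule ennreal_mult'[symmetric]) auto
    also have "1 / 16^k * (unit_ball_vol 3 * (2^(k+1))^3) = 8 * unit_ball_vol 3 * (1/2::real)^k"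
    proof -
      have "(16::real)^k = 2^k * (2^k)^3" using pow16[of k] power_Suc[of "(2::real)^k" 3] by simp
      then show ?thesis by (simp add: power_mult_distrib power_divide field_simps)
    qed
    finally show "(\<integral>\<^sup>+x. ennreal (1 / 16^k) * indicator (?S k) x \<partial>lborel) = ennreal (8 * unit_ball_vol 3 * (1/2)^k)" .
  qed
  also have "\<dots> < \<infinity>"
  proof -
    have "summable (\<lambda>k. 8 * unit_ball_vol 3 * (1/2::real)^k)"
      by (intro summable_mult summable_geometric) simp
    then show ?thesis by (subst suminf_ennreal2) (auto intro!: mult_nonneg_nonneg)
  qed
  finally show "(\<integral>\<^sup>+x. ennreal (norm (1 / (1 + norm (x::real^3))^4)) \<partial>lborel) < \<infinity>" .
qed

section \<open>Smooth cutoffs and the completion of the test functions\<close>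

lemma pd_eq: "(f has_derivative f') (at x) \<Longrightarrow> pd b f x = f' b"
  by (simp add: pd_def frechet_derivative_at[symmetric])

lemma differentiable_all_imp_continuous:
  "(\<And>x. f differentiable (at x)) \<Longrightarrow> continuous_on UNIV f"
  by (intro continuous_at_imp_continuous_on ballI differentiable_imp_continuous_within)

lemma class_C_SucD: "class_C (Suc k) f \<Longrightarrow> class_C k f"
proof (induction k arbitrary: f)
  case 0
  then show ?case by (auto intro: differentiable_all_imp_continuous)
next
  case (Suc k)
  then show ?case by simp
qed

lemma class_C_has_derivative:
  "class_C (Suc k) f \<Longrightarrow> (f has_derivative frechet_derivative f (at x)) (at x)"
  by (simp add: frechet_derivative_works)

lemma class_C_const: "class_C k (\<lambda>_. c)"
proof (induction k arbitrary: c)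
  case (Suc k)
  have "pd b (\<lambda>_. c) = (\<lambda>_. 0)" for b :: 'a
    by (rule ext, subst pd_eq[of _ "\<lambda>_. 0"]) auto
  then show ?case using Suc by simp
qed simp

lemma class_C_add: "class_C k f \<Longrightarrow> class_C k g \<Longrightarrow> class_C k (\<lambda>x. f x + g x)"
proof (induction k arbitrary: f g)
  case (Suc k)
  have "pd b (\<lambda>x. f x + g x) = (\<lambda>x. pd b f x + pd b g x)" for b
    by (rule ext, subst pd_eq[OF has_derivative_add[OF class_C_has_derivative[OF Suc.prems(1)]
          class_C_has_derivative[OF Suc.prems(2)]]]) (simp add: pd_def)
  with Suc show ?case by simp
qed (auto intro: continuous_on_add)

lemma class_C_mult:
  fixes f g :: "'a::euclidean_space \<Rightarrow> real"
  shows "class_C k f \<Longrightarrow> class_C k g \<Longrightarrow> class_C k (\<lambda>x. f x * g x)"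
proof (induction k arbitrary: f g)
  case (Suc k)
  have eq: "pd b (\<lambda>x. f x * g x) = (\<lambda>x. f x * pd b g x + pd b f x * g x)" for b
    by (rule ext, subst pd_eq[OF has_derivative_mult[OF class_C_has_derivative[OF Suc.prems(1)]
          class_C_has_derivative[OF Suc.prems(2)]]]) (simp add: pd_def)
  have "class_C k (\<lambda>x. f x * pd b g x + pd b f x * g x)" if "b \<in> Basis" for b
    using that Suc.prems class_C_SucD[OF Suc.prems(1)] class_C_SucD[OF Suc.prems(2)]
    by (intro class_C_add Suc.IH) auto
  with Suc.prems eq show ?case by simp
qed (auto intro: continuous_on_mult)

lemma class_C_inner: "class_C k (\<lambda>x::'a::euclidean_space. x \<bullet> v)"
proof (cases k)
  case 0
  then show ?thesis by (auto intro!: continuous_intros)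
next
  case (Suc j)
  have d: "((\<lambda>x. x \<bullet> v) has_derivative (\<lambda>h. h \<bullet> v)) (at x)" for x :: 'a
    by (auto intro!: derivative_eq_intros)
  then have "pd b (\<lambda>x. x \<bullet> v) = (\<lambda>_. b \<bullet> v)" for b :: 'a by (auto simp: pd_eq[OF d])
  moreover have "(\<lambda>x. x \<bullet> v) differentiable (at x)" for x :: 'a
    using d by (rule differentiableI)
  ultimately show ?thesis using Suc by (simp add: class_C_const)
qed

lemma class_C_inner_self: "class_C k (\<lambda>x::'a::euclidean_space. x \<bullet> x)"
proof (cases k)
  case 0
  then show ?thesis by (auto intro!: continuous_intros)
next
  case (Suc j)
  have d: "((\<lambda>x. x \<bullet> x) has_derivative (\<lambda>h. 2 * (x \<bullet> h))) (at x)" for x :: 'a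
    by (auto intro!: derivative_eq_intros simp: inner_commute)
  then have "pd b (\<lambda>x. x \<bullet> x) = (\<lambda>x. 2 * (x \<bullet> b))" for b :: 'a by (auto simp: pd_eq[OF d])
  moreover have "(\<lambda>x. x \<bullet> x) differentiable (at x)" for x :: 'a
    using d by (rule differentiableI)
  ultimately show ?thesis using Suc by (simp add: class_C_mult class_C_const class_C_inner)
qed

text \<open>The whole tower of derivatives of the outer function is given as a family: the chain
  rule sends the index n to n + 1, and the induction on \<open>k\<close> closes.\<close>

lemma class_C_compose:
  fixes \<beta> :: "nat \<Rightarrow> real \<Rightarrow> real" and g :: "'a::euclidean_space \<Rightarrow> real"
  assumes \<beta>: "\<And>n x. (\<beta> n has_real_derivative \<beta> (Suc n) x) (at x)" and g: "\<And>k. class_C k g"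
  shows "class_C k (\<lambda>x. \<beta> n (g x))"
proof (induction k arbitrary: n)
  case 0
  have "continuous_on UNIV (\<beta> n)" using \<beta>[of n] by (meson DERIV_isCont continuous_at_imp_continuous_on)
  moreover have "continuous_on UNIV g" using g[of 0] by simp
  ultimately show ?case using continuous_on_compose2[of UNIV "\<beta> n" UNIV g] by simp
next
  case (Suc k)
  have d: "((\<lambda>x. \<beta> n (g x)) has_derivative (\<lambda>h. \<beta> (Suc n) (g x) * frechet_derivative g (at x) h)) (at x)" for x
    using has_derivative_compose[OF class_C_has_derivative[OF g] \<beta>[of n "g x", unfolded has_field_derivative_def]]
    by simp
  have "pd b (\<lambda>x. \<beta> n (g x)) = (\<lambda>x. \<beta> (Suc n) (g x) * pd b g x)" for b
    by (rule ext) (simp add: pd_eq[OF d] pd_def)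
  moreover have "class_C k (\<lambda>x. \<beta> (Suc n) (g x) * pd b g x)" if "b \<in> Basis" for b
    using that g[of "Suc k"] by (intro class_C_mult Suc) auto
  moreover have "(\<lambda>x. \<beta> n (g x)) differentiable (at x)" for x using d by (rule differentiableI)
  ultimately show ?case by simp
qed

section \<open>A smooth cutoff built from exp(-1/x)\<close>

definition flat_exp :: "real poly \<Rightarrow> real \<Rightarrow> real" where
  "flat_exp p x = (if 0 < x then poly p (1 / x) * exp (- (1 / x)) else 0)"

text \<open>With y = 1/x the derivative of p(y) exp(-y) in x is y^2 (p - p')(y) exp(-y), so the
  family is closed under differentiation.\<close>

definition flat_exp_step :: "real poly \<Rightarrow> real poly" where
  "flat_exp_step p = [:0, 0, 1:] * (p - pderiv p)"

lemma poly_exp_tendsto_0: "((\<lambda>y. poly p y * exp (- y)) \<longlongrightarrow> (0::real)) at_top"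
proof -
  have "((\<lambda>y. \<Sum>i\<le>degree p. coeff p i * (y ^ i / exp y)) \<longlongrightarrow> (\<Sum>i\<le>degree p. coeff p i * 0)) at_top"
    by (intro tendsto_intros tendsto_power_div_exp_0)
  then show ?thesis by (simp add: poly_altdef sum_distrib_right exp_minus divide_inverse mult.assoc)
qed

lemma flat_exp_deriv: "(flat_exp p has_real_derivative flat_exp (flat_exp_step p) x) (at x)"
proof -
  consider "x < 0" | "x = 0" | "0 < x" by linarith
  then show ?thesis
  proof cases
    case 1
    have "((\<lambda>_. 0) has_real_derivative 0) (at x)" by simp
    then have "(flat_exp p has_real_derivative 0) (at x)"
      by (rule has_field_derivative_transform_within_open[where S="{..<0}"])
         (use 1 in \<open>auto simp: flat_exp_def\<close>)
    then show ?thesis using 1 by (simp add: flat_exp_def)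
  next
    case 2
    have "((\<lambda>x. flat_exp p x / x) \<longlongrightarrow> 0) (at_right 0)"
    proof -
      have "((\<lambda>x. poly ([:0, 1:] * p) (inverse x) * exp (- inverse x)) \<longlongrightarrow> 0) (at_right (0::real))"
        by (rule filterlim_compose[OF poly_exp_tendsto_0 filterlim_inverse_at_top_right])
      then show ?thesis
        by (rule Lim_transform_eventually)
           (auto simp: eventually_at_filter flat_exp_def field_simps)
    qed
    moreover have "((\<lambda>x. flat_exp p x / x) \<longlongrightarrow> 0) (at_left 0)"
      by (rule tendsto_eventually) (auto simp: eventually_at_filter flat_exp_def)
    ultimately have "((\<lambda>x. flat_exp p x / x) \<longlongrightarrow> 0) (at 0)"
      by (rule filterlim_split_at[rotated])
    then show ?thesis using 2 by (simp add: DERIV_def flat_exp_def)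
  next
    case 3
    have "((\<lambda>x. poly p (1 / x) * exp (- (1 / x))) has_real_derivative
        poly (pderiv p) (1/x) * (- (1 / x\<^sup>2)) * exp (- (1/x)) + poly p (1/x) * (exp (- (1/x)) * (1 / x\<^sup>2))) (at x)"
      using 3 by (auto intro!: derivative_eq_intros DERIV_chain2[OF poly_DERIV] simp: power2_eq_square)
    then have "(flat_exp p has_real_derivative
        poly (pderiv p) (1/x) * (- (1 / x\<^sup>2)) * exp (- (1/x)) + poly p (1/x) * (exp (- (1/x)) * (1 / x\<^sup>2))) (at x)"
      by (rule has_field_derivative_transform_within_open[where S="{0<..}"])
         (use 3 in \<open>auto simp: flat_exp_def\<close>)
    also have "poly (pderiv p) (1/x) * (- (1 / x\<^sup>2)) * exp (- (1/x)) + poly p (1/x) * (exp (- (1/x)) * (1 / x\<^sup>2))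
        = flat_exp (flat_exp_step p) x"
      using 3 by (simp add: flat_exp_def flat_exp_step_def power2_eq_square algebra_simps)
    finally show ?thesis .
  qed
qed

text \<open>The n-th derivative of e exp(-1/(1 - x)), extended by zero from x = 1 on. The sign comes
  from the reflection 1 - x, and the factor e normalises the function itself to 1 at 0. It is
  applied to squared radii, so a cutoff on the right is enough.\<close>

definition bump :: "nat \<Rightarrow> real \<Rightarrow> real" where
  "bump n x = (-1)^n * flat_exp ((flat_exp_step ^^ n) 1) (1 - x) * exp 1"

lemma bump_deriv: "(bump n has_real_derivative bump (Suc n) x) (at x)"
proof -
  have "((\<lambda>x. flat_exp ((flat_exp_step ^^ n) 1) (1 - x)) has_real_derivative
      flat_exp ((flat_exp_step ^^ Suc n) 1) (1 - x) * -1) (at x)"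
  proof -
    have "((\<lambda>x. 1 - x) has_real_derivative -1) (at x)" by (auto intro!: derivative_eq_intros)
    from DERIV_chain2[OF flat_exp_deriv this] show ?thesis by simp
  qed
  from DERIV_cmult[OF this, of "(-1)^n * exp 1"] show ?thesis
    by (simp add: bump_def[abs_def] algebra_simps)
qed

lemma continuous_bump: "continuous_on S (bump n)"
  using bump_deriv by (meson DERIV_isCont continuous_at_imp_continuous_on)

lemma bump_eq_0: "1 \<le> x \<Longrightarrow> bump n x = 0" by (simp add: bump_def flat_exp_def)

lemma bump_0_0: "bump 0 0 = 1" by (simp add: bump_def flat_exp_def exp_minus)

lemma bump_bounded: "\<exists>B>0. \<forall>x\<ge>0. \<bar>bump n x\<bar> \<le> B"
proof -
  have "bounded (bump n ` {0..1})"
    by (intro compact_imp_bounded compact_continuous_image continuous_bump) auto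
  then obtain B where "\<forall>x\<in>{0..1}. \<bar>bump n x\<bar> \<le> B" by (auto simp: bounded_iff)
  then have B: "\<And>x. x \<in> {0..1} \<Longrightarrow> \<bar>bump n x\<bar> \<le> B" by blast
  have "\<bar>bump n x\<bar> \<le> max B 1" if "0 \<le> x" for x
    using B[of x] bump_eq_0[of x n] that by (cases "x \<le> 1") auto
  then show ?thesis by (intro exI[of _ "max B 1"]) auto
qed

lemma funpow_pderiv_deriv: "(poly ((pderiv ^^ n) p) has_real_derivative poly ((pderiv ^^ Suc n) p) x) (at x)"
  by (simp add: poly_DERIV)

section \<open>Approximation of radial functions by test functions\<close>

lemma radial_increment:
  fixes G :: "real \<Rightarrow> real"
  assumes c: "continuous_on {0..r} G" and d: "\<And>s. 0 < s \<Longrightarrow> (G has_real_derivative s * \<kappa> s) (at s)"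
    and b: "\<And>s. 0 < s \<Longrightarrow> s < r \<Longrightarrow> \<bar>\<kappa> s\<bar> \<le> e" and r: "0 \<le> r"
  shows "\<bar>G r - G 0\<bar> \<le> r\<^sup>2 * e"
proof -
  have le: "\<bar>s * \<kappa> s\<bar> \<le> r * e" if "0 < s" "s < r" for s
    unfolding abs_mult using b[OF that] that by (intro mult_mono) auto
  have "G r - r * e * r \<le> G 0 - r * e * 0"
  proof (rule nonincreasing_on_Icc[OF r, where g="\<lambda>s. G s - r * e * s" and g'="\<lambda>s. s * \<kappa> s - r * e"])
    fix s assume s: "0 < s" "s < r"
    show "((\<lambda>s. G s - r * e * s) has_real_derivative s * \<kappa> s - r * e) (at s)"
      by (auto intro!: derivative_eq_intros d s)
    show "s * \<kappa> s - r * e \<le> 0" using le[OF s] by linarith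
  qed (intro continuous_intros c)
  moreover have "- G r - r * e * r \<le> - G 0 - r * e * 0"
  proof (rule nonincreasing_on_Icc[OF r, where g="\<lambda>s. - G s - r * e * s" and g'="\<lambda>s. - (s * \<kappa> s) - r * e"])
    fix s assume s: "0 < s" "s < r"
    show "((\<lambda>s. - G s - r * e * s) has_real_derivative - (s * \<kappa> s) - r * e) (at s)"
      by (auto intro!: derivative_eq_intros d s)
    show "- (s * \<kappa> s) - r * e \<le> 0" using le[OF s] by linarith
  qed (intro continuous_intros c)
  moreover have "r * e * r = r\<^sup>2 * e" by (simp add: power2_eq_square)
  ultimately show ?thesis by (simp add: abs_le_iff)
qed

text \<open>A polynomial in r^2 gives a smooth function of x. As d/dr P(r^2) = r * 2 P'(r^2),
  Weierstrass is applied to \<open>k / 2\<close> as a function of \<rho> = r^2; \<open>P\<close> is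
  the primitive starting at \<open>g 0\<close>, and closeness of the values follows by
  integration.\<close>

lemma poly_C1_approx:
  fixes g k :: "real \<Rightarrow> real"
  assumes "continuous_on UNIV g" "continuous_on UNIV k"
    and d: "\<And>r. 0 < r \<Longrightarrow> (g has_real_derivative r * k r) (at r)" and "0 < R" "0 < e"
  obtains P where "\<And>r. 0 \<le> r \<Longrightarrow> r \<le> R \<Longrightarrow> \<bar>2 * poly (pderiv P) (r\<^sup>2) - k r\<bar> \<le> e"
    "\<And>r. 0 \<le> r \<Longrightarrow> r \<le> R \<Longrightarrow> \<bar>poly P (r\<^sup>2) - g r\<bar> \<le> R\<^sup>2 * e"
proof -
  have "continuous_on {0..R\<^sup>2} (\<lambda>\<rho>. k (sqrt \<rho>) / 2)"
    by (intro continuous_intros continuous_on_compose2[OF assms(2)]) auto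
  then obtain f where f: "real_polynomial_function f" "\<And>\<rho>. \<rho> \<in> {0..R\<^sup>2} \<Longrightarrow> \<bar>k (sqrt \<rho>) / 2 - f \<rho>\<bar> < e / 2"
    using Stone_Weierstrass_real_polynomial_function[of "{0..R\<^sup>2}" "\<lambda>\<rho>. k (sqrt \<rho>) / 2" "e/2"] \<open>0 < e\<close> by auto
  then obtain a n where a: "f = (\<lambda>x. \<Sum>i\<le>n. a i * x^i)" by (auto simp: real_polynomial_function_iff_sum)
  define P where "P = [:g 0:] + (\<Sum>i\<le>n. monom (a i / real (Suc i)) (Suc i))"
  have "pderiv P = (\<Sum>i\<le>n. monom (a i) i)"
    by (simp add: P_def pderiv_add higher_pderiv_sum[of 1, simplified] pderiv_monom pderiv_pCons)
  then have p: "poly (pderiv P) = f" by (auto simp: a poly_sum poly_monom)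
  have P0: "poly P 0 = g 0" by (simp add: P_def poly_sum poly_monom)
  have 1: "\<bar>2 * poly (pderiv P) (r\<^sup>2) - k r\<bar> \<le> e" if "0 \<le> r" "r \<le> R" for r
  proof -
    have "r\<^sup>2 \<in> {0..R\<^sup>2}" using that by (auto intro: power_mono)
    then have "\<bar>k r / 2 - f (r\<^sup>2)\<bar> < e / 2" using f(2)[of "r\<^sup>2"] that by simp
    then show ?thesis unfolding p by linarith
  qed
  have 2: "\<bar>poly P (r\<^sup>2) - g r\<bar> \<le> R\<^sup>2 * e" if r: "0 \<le> r" "r \<le> R" for r
  proof (cases "r = 0")
    case True
    then show ?thesis using \<open>0 < e\<close> by (simp add: P0)
  next
    case False
    have dd: "((\<lambda>r. poly P (r\<^sup>2) - g r) has_real_derivative s * (2 * poly (pderiv P) (s\<^sup>2) - k s)) (at s)" if "0 < s" for s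
      by (rule derivative_eq_intros DERIV_chain2[OF poly_DERIV] d that refl | simp add: algebra_simps)+
    have "\<bar>(poly P (r\<^sup>2) - g r) - (poly P (0\<^sup>2) - g 0)\<bar> \<le> r\<^sup>2 * e"
    proof (rule radial_increment[OF _ dd])
      show "continuous_on {0..r} (\<lambda>r. poly P (r\<^sup>2) - g r)"
        by (intro continuous_intros continuous_on_subset[OF assms(1)]) auto
    qed (use 1 r in auto)
    moreover have "r\<^sup>2 * e \<le> R\<^sup>2 * e" using r \<open>0 < e\<close> by (intro mult_right_mono power_mono) auto
    ultimately show ?thesis by (simp add: P0)
  qed
  show ?thesis by (rule that[OF 1 2])
qed

text \<open>The approximants are cutoffs at scale N of polynomials in |x|^2. Although g may decay
  only like 1/r, the derivative of the cutoff contributes O(N^(-2)) to the gradient on the ball of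
  radius N, below a multiple of (1 + r)^(-2). Dominated convergence then serves both the Dirichlet
  norm and the L^6 limit.\<close>

lemma radial_in_D_space:
  fixes g k :: "real \<Rightarrow> real"
  assumes g: "continuous_on UNIV g" and k: "continuous_on UNIV k"
    and d: "\<And>r. 0 < r \<Longrightarrow> (g has_real_derivative r * k r) (at r)"
    and Cg: "\<And>r. 0 \<le> r \<Longrightarrow> \<bar>g r\<bar> \<le> Cg / (1 + r)" and Ck: "\<And>r. 0 \<le> r \<Longrightarrow> \<bar>r * k r\<bar> \<le> Ck / (1 + r)\<^sup>2"
  shows "(\<lambda>x. g (norm x)) \<in> D_space"
proof -
  define N :: "nat \<Rightarrow> real" where "N n = real n + 1" for n
  have N: "1 \<le> N n" "0 < N n" for n by (auto simp: N_def)
  have Cg0: "0 \<le> Cg" using Cg[of 0] by simp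
  have Ck0: "0 \<le> Ck" using Ck[of 0] by simp
  \<comment> \<open>The accuracy N^(-4) compensates the growing ball: multiplied by r <= N it is
    still at most N^(-2), which for r <= N is dominated by 4 / (1 + r)^2.\<close>
  have "\<exists>P. (\<forall>r. 0 \<le> r \<and> r \<le> N n \<longrightarrow> \<bar>2 * poly (pderiv P) (r\<^sup>2) - k r\<bar> \<le> 1 / N n^4) \<and>
      (\<forall>r. 0 \<le> r \<and> r \<le> N n \<longrightarrow> \<bar>poly P (r\<^sup>2) - g r\<bar> \<le> (N n)\<^sup>2 * (1 / N n^4))" for n
  proof -
    have pos: "0 < 1 / N n^4" using N(2)[of n] by simp
    show ?thesis by (rule poly_C1_approx[OF g k d N(2)[of n] pos]) blast+
  qed
  then obtain P where P1: "\<And>n r. 0 \<le> r \<Longrightarrow> r \<le> N n \<Longrightarrow> \<bar>2 * poly (pderiv (P n)) (r\<^sup>2) - k r\<bar> \<le> 1 / N n^4"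
    and P0': "\<And>n r. 0 \<le> r \<Longrightarrow> r \<le> N n \<Longrightarrow> \<bar>poly (P n) (r\<^sup>2) - g r\<bar> \<le> (N n)\<^sup>2 * (1 / N n^4)"
    by metis
  have P0: "\<bar>poly (P n) (r\<^sup>2) - g r\<bar> \<le> 1 / (N n)\<^sup>2" if "0 \<le> r" "r \<le> N n" for n r
    using P0'[OF that] N(2)[of n] by (simp add: power2_eq_square power4_eq_xxxx)
  let ?B = "\<lambda>i n r. bump i (r\<^sup>2 * (1 / (N n)\<^sup>2))"
  define S where "S n r = ?B 0 n r * poly (P n) (r\<^sup>2)" for n r
  \<comment> \<open>\<open>r * c n r\<close> is the derivative of \<open>S n\<close>, so the
    gradient of \<open>s n\<close> at x is \<open>c n (norm x)\<close> times x.\<close>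
  define c where "c n r = ?B 0 n r * (2 * poly (pderiv (P n)) (r\<^sup>2))
      + 2 / (N n)\<^sup>2 * ?B 1 n r * poly (P n) (r\<^sup>2)" for n r
  let ?d = "\<lambda>n (x::real^3). (norm x * (c n (norm x) - k (norm x)))\<^sup>2"
    and ?e = "\<lambda>n (x::real^3). \<bar>S n (norm x) - g (norm x)\<bar>^6"
  define s where "s n x = S n (norm x)" for n and x :: "real^3"
  have s_eq: "s n = (\<lambda>x. bump 0 ((x \<bullet> x) * (1 / (N n)\<^sup>2)) * poly (P n) (x \<bullet> x))" for n
    by (simp add: s_def[abs_def] S_def power2_norm_eq_inner)
  have big: "?B i n r = 0" if "N n \<le> r" for i r n
  proof (rule bump_eq_0)
    have "(N n)\<^sup>2 \<le> r\<^sup>2" using that N(2)[of n] by (intro power_mono) auto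
    then show "1 \<le> r\<^sup>2 * (1 / (N n)\<^sup>2)" using N(2)[of n] by (simp add: field_simps)
  qed
  have test: "test_function (s n)" for n
    unfolding test_function_def
  proof (intro conjI allI)
    have "class_C m (\<lambda>x::real^3. poly ((pderiv ^^ 0) (P n)) (x \<bullet> x))" for m
      by (rule class_C_compose[where \<beta>="\<lambda>i. poly ((pderiv ^^ i) (P n))", OF funpow_pderiv_deriv class_C_inner_self])
    then show "class_C m (s n)" for m
      unfolding s_eq
      by (intro class_C_mult class_C_compose[where \<beta>=bump, OF bump_deriv] class_C_inner_self class_C_const) simp
    have "{x. s n x \<noteq> 0} \<subseteq> cball 0 (N n)"
      using big[of n] by (auto simp: s_def S_def) (meson linear)
    then have "bounded {x. s n x \<noteq> 0}" using bounded_cball bounded_subset by blast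
    then show "compact (closure {x. s n x \<noteq> 0})" by (simp add: compact_closure)
  qed
  have s_deriv: "(s n has_derivative (\<lambda>v. c n (norm x) * (x \<bullet> v))) (at x)" for n x
  proof -
    have i: "((\<lambda>x. x \<bullet> x) has_derivative (\<lambda>h. 2 * (x \<bullet> h))) (at x)"
      by (auto intro!: derivative_eq_intros simp: inner_commute)
    have b: "(bump 0 has_derivative (\<lambda>h. bump 1 y * h)) (at y)" for y
      using bump_deriv[of 0 y] by (simp add: has_field_derivative_def)
    have p: "(poly (P n) has_derivative (\<lambda>h. poly (pderiv (P n)) y * h)) (at y)" for y
      using poly_DERIV[of "P n" y] by (simp add: has_field_derivative_def)
    show ?thesis
      unfolding s_eq
      by (rule has_derivative_eq_rhs,
          rule has_derivative_mult[OF has_derivative_compose[OF has_derivative_mult_left[OF i] b] has_derivative_compose[OF i p]])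
         (auto simp: c_def power2_norm_eq_inner algebra_simps)
  qed
  obtain B0 where B0: "0 < B0" "\<And>x. 0 \<le> x \<Longrightarrow> \<bar>bump 0 x\<bar> \<le> B0" using bump_bounded[of 0] by blast
  obtain B1 where B1: "0 < B1" "\<And>x. 0 \<le> x \<Longrightarrow> \<bar>bump 1 x\<bar> \<le> B1" using bump_bounded[of 1] by blast
  have N_r: "1 / N n \<le> 2 / (1 + r)" "1 / (N n)\<^sup>2 \<le> 4 / (1 + r)\<^sup>2" if "0 \<le> r" "r \<le> N n" for r n
  proof -
    show 1: "1 / N n \<le> 2 / (1 + r)" using that N(1)[of n] by (simp add: field_simps)
    have "(1 / N n)\<^sup>2 \<le> (2 / (1 + r))\<^sup>2" using that N(2)[of n] by (intro power_mono 1) auto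
    then show "1 / (N n)\<^sup>2 \<le> 4 / (1 + r)\<^sup>2" by (simp add: power_divide)
  qed
  have abs3: "\<bar>x\<bar> \<le> \<bar>y\<bar> + \<bar>z\<bar> + \<bar>w\<bar>" if "x = y + z + w" for x y z w :: real using that by linarith
  have abs2: "\<bar>x\<bar> \<le> \<bar>y\<bar> + \<bar>z\<bar>" if "x = y + z" for x y z :: real using that by linarith
  define C1 where "C1 = (B0 + 1) * Ck + 4 * B0 + 8 * B1 * (Cg + 1)"
  define C2 where "C2 = (B0 + 1) * Cg + 2 * B0"
  \<comment> \<open>The terms are the cutoff error, the polynomial error and, for gradients, the
    derivative of the cutoff. The first tends to zero pointwise under a fixed bound; the others are
    uniformly O(N^(-2)).\<close>
  have decomp1: "\<bar>r * (c n r - k r)\<bar> \<le> \<bar>?B 0 n r - 1\<bar> * \<bar>r * k r\<bar> + B0 * (1 / (N n)\<^sup>2) + 2 * B1 * (Cg + 1) * (1 / (N n)\<^sup>2)"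
    and decomp2: "\<bar>S n r - g r\<bar> \<le> \<bar>?B 0 n r - 1\<bar> * \<bar>g r\<bar> + B0 * (1 / (N n)\<^sup>2)"
    if r: "0 \<le> r" "r \<le> N n" for n r
  proof -
    let ?p = "2 * poly (pderiv (P n)) (r\<^sup>2)" and ?P = "poly (P n) (r\<^sup>2)"
    have b: "\<bar>?B 0 n r\<bar> \<le> B0" "\<bar>?B 1 n r\<bar> \<le> B1" by (rule B0(2) B1(2), simp)+
    have N4: "r * (1 / N n^4) \<le> 1 / (N n)\<^sup>2"
    proof -
      have "r * (1 / N n^4) \<le> N n * (1 / N n^4)" using r by (intro mult_right_mono) auto
      also have "\<dots> = 1 / (N n)\<^sup>2 * (1 / N n)" using N(2)[of n] by (simp add: field_simps power2_eq_square power4_eq_xxxx)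
      also have "\<dots> \<le> 1 / (N n)\<^sup>2 * 1" using N(1)[of n] by (intro mult_left_mono) auto
      finally show ?thesis by simp
    qed
    have t1: "\<bar>?B 0 n r * (r * (?p - k r))\<bar> \<le> B0 * (1 / (N n)\<^sup>2)"
    proof -
      have "\<bar>r * (?p - k r)\<bar> \<le> r * (1 / N n^4)"
        unfolding abs_mult[of r] using P1[OF r] r by (intro mult_mono) auto
      then have x: "\<bar>r * (?p - k r)\<bar> \<le> 1 / (N n)\<^sup>2" using N4 by linarith
      show ?thesis unfolding abs_mult[of "?B 0 n r"] by (rule mult_mono[OF b(1) x]) (use B0(1) in auto)
    qed
    have t2: "\<bar>r * ?P\<bar> \<le> Cg + 1"
    proof -
      have "\<bar>r * g r\<bar> \<le> r * (Cg / (1 + r))"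
        unfolding abs_mult using Cg[OF r(1)] r by (intro mult_mono) auto
      also have "\<dots> \<le> Cg" using r Cg0 by (simp add: field_simps)
      finally have 1: "\<bar>r * g r\<bar> \<le> Cg" .
      have "\<bar>r * (?P - g r)\<bar> \<le> N n * (1 / (N n)\<^sup>2)"
        unfolding abs_mult using P0[OF r] r N(2)[of n] by (intro mult_mono) auto
      also have "\<dots> \<le> 1" using N(1)[of n] by (simp add: power2_eq_square)
      finally have 2: "\<bar>r * (?P - g r)\<bar> \<le> 1" .
      have "r * ?P = r * (?P - g r) + r * g r" by (simp add: algebra_simps)
      then show ?thesis using 1 2 by linarith
    qed
    have t3: "\<bar>2 / (N n)\<^sup>2 * (?B 1 n r * (r * ?P))\<bar> \<le> 2 / (N n)\<^sup>2 * (B1 * (Cg + 1))"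
    proof -
      have x: "\<bar>?B 1 n r * (r * ?P)\<bar> \<le> B1 * (Cg + 1)"
        unfolding abs_mult[of "?B 1 n r"] by (rule mult_mono[OF b(2) t2]) (use B1(1) in auto)
      show ?thesis unfolding abs_mult[of "2 / (N n)\<^sup>2"] by (rule mult_mono[OF _ x]) auto
    qed
    have "r * (c n r - k r) = (?B 0 n r - 1) * (r * k r) + ?B 0 n r * (r * (?p - k r)) + 2 / (N n)\<^sup>2 * (?B 1 n r * (r * ?P))"
      by (simp add: c_def algebra_simps)
    then have "\<bar>r * (c n r - k r)\<bar> \<le> \<bar>(?B 0 n r - 1) * (r * k r)\<bar> + \<bar>?B 0 n r * (r * (?p - k r))\<bar> + \<bar>2 / (N n)\<^sup>2 * (?B 1 n r * (r * ?P))\<bar>"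
      by (rule abs3)
    also have "\<dots> \<le> \<bar>?B 0 n r - 1\<bar> * \<bar>r * k r\<bar> + B0 * (1 / (N n)\<^sup>2) + 2 / (N n)\<^sup>2 * (B1 * (Cg + 1))"
      by (intro add_mono t1 t3) (simp add: abs_mult)
    also have "2 / (N n)\<^sup>2 * (B1 * (Cg + 1)) = 2 * B1 * (Cg + 1) * (1 / (N n)\<^sup>2)" by simp
    finally show "\<bar>r * (c n r - k r)\<bar> \<le> \<bar>?B 0 n r - 1\<bar> * \<bar>r * k r\<bar> + B0 * (1 / (N n)\<^sup>2) + 2 * B1 * (Cg + 1) * (1 / (N n)\<^sup>2)" .
    have "S n r - g r = (?B 0 n r - 1) * g r + ?B 0 n r * (?P - g r)" by (simp add: S_def algebra_simps)
    then have "\<bar>S n r - g r\<bar> \<le> \<bar>(?B 0 n r - 1) * g r\<bar> + \<bar>?B 0 n r * (?P - g r)\<bar>" by (rule abs2)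
    also have "\<dots> \<le> \<bar>?B 0 n r - 1\<bar> * \<bar>g r\<bar> + B0 * (1 / (N n)\<^sup>2)"
      unfolding abs_mult by (intro add_mono order_refl mult_mono[OF b(1) P0[OF r]]) (use B0(1) in auto)
    finally show "\<bar>S n r - g r\<bar> \<le> \<bar>?B 0 n r - 1\<bar> * \<bar>g r\<bar> + B0 * (1 / (N n)\<^sup>2)" .
  qed
  have b01: "\<bar>?B 0 n r - 1\<bar> \<le> B0 + 1" for r n
    using B0(2)[of "r\<^sup>2 * (1 / (N n)\<^sup>2)"] by simp
  have dom1: "\<bar>r * (c n r - k r)\<bar> \<le> C1 / (1 + r)\<^sup>2" if r: "0 \<le> r" for n r
  proof (cases "r \<le> N n")
    case True
    have "\<bar>r * (c n r - k r)\<bar> \<le> (B0 + 1) * (Ck / (1 + r)\<^sup>2) + B0 * (1 / (N n)\<^sup>2) + 2 * B1 * (Cg + 1) * (1 / (N n)\<^sup>2)"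
    proof -
      have "\<bar>?B 0 n r - 1\<bar> * \<bar>r * k r\<bar> \<le> (B0 + 1) * (Ck / (1 + r)\<^sup>2)"
        by (rule mult_mono[OF b01 Ck[OF r]]) (use B0(1) in auto)
      then show ?thesis by (intro order_trans[OF decomp1[OF r True]] add_mono order_refl)
    qed
    also have "\<dots> \<le> (B0 + 1) * (Ck / (1 + r)\<^sup>2) + B0 * (4 / (1 + r)\<^sup>2) + 2 * B1 * (Cg + 1) * (4 / (1 + r)\<^sup>2)"
      using B0(1) B1(1) Cg0 by (intro add_mono mult_left_mono N_r r True) auto
    also have "\<dots> = C1 / (1 + r)\<^sup>2" by (simp add: C1_def add_divide_distrib algebra_simps)
    finally show ?thesis .
  next
    case False
    then have "\<bar>r * (c n r - k r)\<bar> = \<bar>r * k r\<bar>" using big[of n r] by (simp add: c_def)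
    also have "\<dots> \<le> Ck / (1 + r)\<^sup>2" by (rule Ck[OF r])
    also have "\<dots> \<le> C1 / (1 + r)\<^sup>2"
      using B0(1) B1(1) Ck0 Cg0 by (intro divide_right_mono) (auto simp: C1_def algebra_simps add_increasing2)
    finally show ?thesis .
  qed
  have dom2: "\<bar>S n r - g r\<bar> \<le> C2 / (1 + r)" if r: "0 \<le> r" for n r
  proof (cases "r \<le> N n")
    case True
    have "1 / (N n)\<^sup>2 \<le> 1 / N n" using N(1)[of n] by (simp add: power2_eq_square field_simps)
    then have N2: "1 / (N n)\<^sup>2 \<le> 2 / (1 + r)" using N_r(1)[OF r True] by simp
    have "\<bar>S n r - g r\<bar> \<le> (B0 + 1) * (Cg / (1 + r)) + B0 * (1 / (N n)\<^sup>2)"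
    proof -
      have "\<bar>?B 0 n r - 1\<bar> * \<bar>g r\<bar> \<le> (B0 + 1) * (Cg / (1 + r))"
        by (rule mult_mono[OF b01 Cg[OF r]]) (use B0(1) in auto)
      then show ?thesis by (intro order_trans[OF decomp2[OF r True]] add_mono order_refl)
    qed
    also have "\<dots> \<le> (B0 + 1) * (Cg / (1 + r)) + B0 * (2 / (1 + r))"
      using B0(1) N2 by (intro add_mono mult_left_mono) auto
    also have "\<dots> = C2 / (1 + r)" by (simp add: C2_def add_divide_distrib algebra_simps)
    finally show ?thesis .
  next
    case False
    then have "\<bar>S n r - g r\<bar> = \<bar>g r\<bar>" using big[of n r] by (simp add: S_def)
    also have "\<dots> \<le> Cg / (1 + r)" by (rule Cg[OF r])
    also have "\<dots> \<le> C2 / (1 + r)"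
      using B0(1) Cg0 r by (intro divide_right_mono) (auto simp: C2_def algebra_simps add_increasing2)
    finally show ?thesis .
  qed
  have N_lim: "(\<lambda>n. 1 / (N n)\<^sup>2) \<longlonglongrightarrow> 0"
    unfolding N_def by real_asymp
  have b_lim: "(\<lambda>n. \<bar>?B 0 n r - 1\<bar>) \<longlonglongrightarrow> 0" for r
  proof -
    have "isCont (bump 0) 0" using bump_deriv DERIV_isCont by blast
    moreover have "(\<lambda>n. r\<^sup>2 * (1 / (N n)\<^sup>2)) \<longlonglongrightarrow> 0" using tendsto_mult_right_zero[OF N_lim] by blast
    ultimately have "(\<lambda>n. ?B 0 n r) \<longlonglongrightarrow> bump 0 0" by (rule isCont_tendsto_compose)
    then have "(\<lambda>n. \<bar>?B 0 n r - 1\<bar>) \<longlonglongrightarrow> \<bar>bump 0 0 - 1\<bar>" by (intro tendsto_intros)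
    then show ?thesis by (simp add: bump_0_0)
  qed
  have ev: "\<forall>\<^sub>F n in sequentially. r \<le> N n" for r
    using eventually_ge_at_top[of "nat \<lceil>r\<rceil>"] by eventually_elim (auto simp: N_def)
  have lim1: "(\<lambda>n. r * (c n r - k r)) \<longlonglongrightarrow> 0" if r: "0 \<le> r" for r
  proof (rule Lim_null_comparison)
    show "\<forall>\<^sub>F n in sequentially. norm (r * (c n r - k r)) \<le>
        \<bar>?B 0 n r - 1\<bar> * \<bar>r * k r\<bar> + B0 * (1 / (N n)\<^sup>2) + 2 * B1 * (Cg + 1) * (1 / (N n)\<^sup>2)"
      using ev[of r] by eventually_elim (use decomp1[OF r] in auto)
    show "(\<lambda>n. \<bar>?B 0 n r - 1\<bar> * \<bar>r * k r\<bar> + B0 * (1 / (N n)\<^sup>2) + 2 * B1 * (Cg + 1) * (1 / (N n)\<^sup>2)) \<longlonglongrightarrow> 0"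
      using tendsto_add[OF tendsto_add[OF tendsto_mult_left_zero[OF b_lim[of r]] tendsto_mult_right_zero[OF N_lim]]
        tendsto_mult_right_zero[OF N_lim], of "\<bar>r * k r\<bar>" B0 "2 * B1 * (Cg + 1)"] by simp
  qed
  have lim2: "(\<lambda>n. S n r - g r) \<longlonglongrightarrow> 0" if r: "0 \<le> r" for r
  proof (rule Lim_null_comparison)
    show "\<forall>\<^sub>F n in sequentially. norm (S n r - g r) \<le>
        \<bar>?B 0 n r - 1\<bar> * \<bar>g r\<bar> + B0 * (1 / (N n)\<^sup>2)"
      using ev[of r] by eventually_elim (use decomp2[OF r] in auto)
    show "(\<lambda>n. \<bar>?B 0 n r - 1\<bar> * \<bar>g r\<bar> + B0 * (1 / (N n)\<^sup>2)) \<longlonglongrightarrow> 0"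
      using tendsto_add[OF tendsto_mult_left_zero[OF b_lim[of r]] tendsto_mult_right_zero[OF N_lim],
        of "\<bar>g r\<bar>" B0] by simp
  qed
  have cont: "continuous_on UNIV (\<lambda>x::real^3. norm x * (c n (norm x) - k (norm x)))"
    "continuous_on UNIV (\<lambda>x::real^3. S n (norm x) - g (norm x))" for n
    unfolding c_def S_def
    by (intro continuous_intros continuous_on_compose2[OF continuous_bump[of UNIV]] continuous_on_poly
        continuous_on_compose2[OF k] continuous_on_compose2[OF g]; simp)+
  define a where "a n = (integral\<^sup>L lborel (?d n))" for n
  have w: "integrable lborel (\<lambda>x::real^3. C * (1 / (1 + norm x)^4))" for C
    by (intro integrable_mult_right integrable_inverse_power4)
  have meas1: "(?d n) \<in> borel_measurable lborel" for n
    using cont(1)[of n] by (simp, intro borel_measurable_power borel_measurable_continuous_onI)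
  have meas2: "(?e n) \<in> borel_measurable lborel" for n
    using cont(2)[of n] by (simp, intro borel_measurable_power borel_measurable_abs borel_measurable_continuous_onI)
  have bound1: "norm (?d n x) \<le> C1\<^sup>2 * (1 / (1 + norm x)^4)" for n and x :: "real^3"
  proof -
    have "\<bar>norm x * (c n (norm x) - k (norm x))\<bar>\<^sup>2 \<le> (C1 / (1 + norm x)\<^sup>2)\<^sup>2"
      by (intro power_mono dom1) auto
    then show ?thesis by (simp add: power_divide flip: power_mult)
  qed
  have bound2: "norm (?e n x) \<le> C2^6 * (1 / (1 + norm x)^4)" for n and x :: "real^3"
  proof -
    have "?e n x \<le> (C2 / (1 + norm x))^6"
      by (intro power_mono dom2) auto
    also have "\<dots> = C2^6 * (1 / (1 + norm x)^6)" by (simp add: power_divide)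
    also have "\<dots> \<le> C2^6 * (1 / (1 + norm x)^4)"
    proof -
      have "0 < 1 + norm x" by (simp add: add_pos_nonneg)
      then show ?thesis by (intro mult_left_mono divide_left_mono power_increasing) auto
    qed
    finally show ?thesis by simp
  qed
  have "(\<lambda>n. a n) \<longlonglongrightarrow> (integral\<^sup>L lborel (\<lambda>x::real^3. 0))"
    unfolding a_def
  proof (rule integral_dominated_convergence[OF _ meas1 w])
    show "AE x in lborel. (\<lambda>n. ?d n x) \<longlonglongrightarrow> 0"
      using tendsto_power[OF lim1[OF norm_ge_zero], of _ 2] by (intro AE_I2) simp
    show "AE x in lborel. norm (?d n x) \<le> C1\<^sup>2 * (1 / (1 + norm x)^4)" for n
      using bound1 by (intro AE_I2)
  qed simp
  then have a_lim: "a \<longlonglongrightarrow> 0" by simp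
  have int1: "integrable lborel (?d n)" for n
  proof (rule Bochner_Integration.integrable_bound[OF w[of "C1\<^sup>2"] meas1], intro AE_I2 order_trans[OF bound1])
    show "C1\<^sup>2 * (1 / (1 + norm x)^4) \<le> norm (C1\<^sup>2 * (1 / (1 + norm x)^4))" for x :: "real^3"
      unfolding real_norm_def by (rule abs_ge_self)
  qed
  have "(\<lambda>n. (integral\<^sup>L lborel (?e n))) \<longlonglongrightarrow> (integral\<^sup>L lborel (\<lambda>x::real^3. 0))"
  proof (rule integral_dominated_convergence[OF _ meas2 w])
    show "AE x in lborel. (\<lambda>n. ?e n x) \<longlonglongrightarrow> 0"
      using tendsto_power[OF tendsto_rabs[OF lim2[OF norm_ge_zero]], of _ 6] by (intro AE_I2) simp
    show "AE x in lborel. norm (?e n x) \<le> C2^6 * (1 / (1 + norm x)^4)" for n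
      using bound2 by (intro AE_I2)
  qed simp
  then have L6: "(\<lambda>n. ennreal (integral\<^sup>L lborel (?e n))) \<longlonglongrightarrow> ennreal 0"
    by (intro tendsto_ennrealI) simp
  have int2: "integrable lborel (?e n)" for n
  proof (rule Bochner_Integration.integrable_bound[OF w[of "C2^6"] meas2], intro AE_I2 order_trans[OF bound2])
    show "C2^6 * (1 / (1 + norm x)^4) \<le> norm (C2^6 * (1 / (1 + norm x)^4))" for x :: "real^3"
      unfolding real_norm_def by (rule abs_ge_self)
  qed
  have "(\<integral>\<^sup>+x. ennreal (\<bar>s n x - g (norm x)\<bar> ^ 6) \<partial>lborel) = ennreal (integral\<^sup>L lborel (?e n))" for n
    unfolding s_def by (rule nn_integral_eq_integral[OF int2]) simp
  with L6 have conv6: "(\<lambda>n. \<integral>\<^sup>+x. ennreal (\<bar>s n x - g (norm x)\<bar> ^ 6) \<partial>lborel) \<longlonglongrightarrow> 0" by simp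
  \<comment> \<open>Both gradients are compared with the common limit \<open>k\<close>, using (a -
    b)^2 <= 2 a^2 + 2 b^2; convergence to \<open>k\<close> thus becomes the Cauchy property.\<close>
  have D: "D_inner (\<lambda>x. s m x - s n x) (\<lambda>x. s m x - s n x) \<le> 2 * a m + 2 * a n" for m n
  proof -
    have gr: "grad (\<lambda>x. s m x - s n x) x = (c m (norm x) - c n (norm x)) *\<^sub>R x" for x
      unfolding grad_def pd_eq[OF has_derivative_diff[OF s_deriv s_deriv]]
      by (simp add: vec_eq_iff inner_axis algebra_simps)
    have "D_inner (\<lambda>x. s m x - s n x) (\<lambda>x. s m x - s n x) = (integral\<^sup>L lborel (\<lambda>x::real^3. (norm x * (c m (norm x) - c n (norm x)))\<^sup>2))"
    proof -
      have "(d *\<^sub>R x) \<bullet> (d *\<^sub>R x) = (norm x * d)\<^sup>2" for d and x :: "real^3"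
        by (simp add: power_mult_distrib power2_norm_eq_inner power2_eq_square[of d])
      then show ?thesis unfolding D_inner_def gr by simp
    qed
    also have "\<dots> \<le> (integral\<^sup>L lborel (\<lambda>x::real^3. 2 * ?d m x + 2 * ?d n x))"
    proof (rule integral_mono')
      fix x :: "real^3"
      have "(norm x * (c m (norm x) - c n (norm x)))\<^sup>2 =
        (norm x * (c m (norm x) - k (norm x)) - norm x * (c n (norm x) - k (norm x)))\<^sup>2" by (simp add: algebra_simps)
      also have "\<dots> \<le> 2 * ?d m x + 2 * ?d n x"
        using zero_le_power2[of "norm x * (c m (norm x) - k (norm x)) + norm x * (c n (norm x) - k (norm x))"]
        unfolding power2_sum power2_diff by linarith
      finally show "(norm x * (c m (norm x) - c n (norm x)))\<^sup>2 \<le>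
        2 * ?d m x + 2 * ?d n x" .
    qed (auto intro!: Bochner_Integration.integrable_add integrable_mult_right int1)
    also have "\<dots> = 2 * a m + 2 * a n" using int1[of m] int1[of n] by (simp add: a_def)
    finally show ?thesis .
  qed
  have cauchy: "\<exists>M. \<forall>m\<ge>M. \<forall>n\<ge>M. sqrt (D_inner (\<lambda>x. s m x - s n x) (\<lambda>x. s m x - s n x)) < e" if e: "0 < e" for e
  proof -
    have "\<forall>\<^sub>F n in sequentially. a n < e\<^sup>2 / 4" by (rule order_tendstoD(2)[OF a_lim]) (use e in auto)
    then obtain M where M: "\<And>n. M \<le> n \<Longrightarrow> a n < e\<^sup>2 / 4" by (auto simp: eventually_sequentially)
    have "sqrt (D_inner (\<lambda>x. s m x - s n x) (\<lambda>x. s m x - s n x)) < e" if "M \<le> m" "M \<le> n" for m n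
    proof -
      have "D_inner (\<lambda>x. s m x - s n x) (\<lambda>x. s m x - s n x) < e\<^sup>2" using D[of m n] M[OF that(1)] M[OF that(2)] by linarith
      then have "sqrt (D_inner (\<lambda>x. s m x - s n x) (\<lambda>x. s m x - s n x)) < sqrt (e\<^sup>2)" by (rule real_sqrt_less_mono)
      then show ?thesis using e by simp
    qed
    then show ?thesis by blast
  qed
  have "(\<lambda>x::real^3. g (norm x)) \<in> borel_measurable lborel"
    by (simp, intro borel_measurable_continuous_onI continuous_on_compose2[OF g]) (auto intro!: continuous_intros)
  then show ?thesis
    unfolding D_space_def using test cauchy conv6 by blast
qed

section \<open>Radial functions\<close>

lemma has_real_derivative_0_if_quadratic:
  fixes g :: "real \<Rightarrow> real"
  assumes "\<And>t. \<bar>t\<bar> \<le> 1 \<Longrightarrow> \<bar>g t - g 0\<bar> \<le> C * t\<^sup>2"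
  shows "(g has_real_derivative 0) (at 0)"
  unfolding DERIV_def
proof (rule Lim_null_comparison[where g="\<lambda>t. C * \<bar>t\<bar>"])
  have "\<forall>\<^sub>F t in at (0::real). \<bar>t\<bar> < 1"
    unfolding eventually_at by (intro exI[of _ 1]) (auto simp: dist_real_def)
  then show "\<forall>\<^sub>F t in at 0. norm ((g (0 + t) - g 0) / t) \<le> C * \<bar>t\<bar>"
    using eventually_neq_at_within[of 0 0 UNIV]
  proof eventually_elim
    case (elim t)
    then have "\<bar>g t - g 0\<bar> \<le> (C * \<bar>t\<bar>) * \<bar>t\<bar>"
      using assms[of t] by (simp add: power2_eq_square mult.assoc)
    then show ?case using elim by (simp add: pos_divide_le_eq)
  qed
  show "((\<lambda>t. C * \<bar>t\<bar>) \<longlongrightarrow> 0) (at 0)"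
    by (rule tendsto_eq_intros refl | simp)+
qed

lemma norm_line_deriv:
  fixes x b :: "'a::euclidean_space"
  assumes "x \<noteq> 0"
  shows "((\<lambda>t. norm (x + t *\<^sub>R b)) has_real_derivative (x \<bullet> b) / norm x) (at 0)"
proof -
  have "((\<lambda>t. x \<bullet> x + 2 * t * (x \<bullet> b) + t\<^sup>2 * (b \<bullet> b)) has_real_derivative 2 * (x \<bullet> b)) (at 0)"
    by (auto intro!: derivative_eq_intros)
  moreover have "x \<bullet> x + 2 * t * (x \<bullet> b) + t\<^sup>2 * (b \<bullet> b) = (x + t *\<^sub>R b) \<bullet> (x + t *\<^sub>R b)" for t
    by (simp add: inner_add_left inner_add_right inner_commute power2_eq_square algebra_simps)
  ultimately have i: "((\<lambda>t. (x + t *\<^sub>R b) \<bullet> (x + t *\<^sub>R b)) has_real_derivative 2 * (x \<bullet> b)) (at 0)" by simp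
  have "0 < (x + 0 *\<^sub>R b) \<bullet> (x + 0 *\<^sub>R b)" using assms by simp
  from DERIV_chain2[OF DERIV_real_sqrt[OF this] i] show ?thesis
    by (simp add: norm_eq_sqrt_inner field_simps)
qed

text \<open>At the origin, where the norm is not differentiable, u(|t b|) - u(0) = O(t^2), so the
  derivative is 0, in agreement with the formula.\<close>

lemma dirderiv_radial:
  fixes u h :: "real \<Rightarrow> real" and b :: "'a::euclidean_space"
  assumes u: "continuous_on UNIV u" and h: "continuous_on UNIV h"
    and d: "\<And>r. 0 < r \<Longrightarrow> (u has_real_derivative r * h r) (at r)"
  shows "dirderiv b (\<lambda>x. u (norm x)) (\<lambda>x. h (norm x) * (x \<bullet> b))"
  unfolding dirderiv_def
proof
  fix x :: 'a
  have "((\<lambda>t. u (norm (x + t *\<^sub>R b))) has_real_derivative h (norm x) * (x \<bullet> b)) (at 0)"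
  proof (cases "x = 0")
    case True
    have "bounded (h ` {0..norm b})"
      by (intro compact_imp_bounded compact_continuous_image continuous_on_subset[OF h]) auto
    then obtain M where "\<forall>r\<in>{0..norm b}. \<bar>h r\<bar> \<le> M" by (auto simp: bounded_iff)
    then have M: "\<And>r. r \<in> {0..norm b} \<Longrightarrow> \<bar>h r\<bar> \<le> M" by blast
    have "\<bar>u (norm (t *\<^sub>R b)) - u (norm (0 *\<^sub>R b))\<bar> \<le> ((norm b)\<^sup>2 * M) * t\<^sup>2" if t: "\<bar>t\<bar> \<le> 1" for t
    proof -
      have le: "norm (t *\<^sub>R b) \<le> norm b" using t by (simp add: mult_left_le_one_le)
      have "\<bar>u (norm (t *\<^sub>R b)) - u 0\<bar> \<le> (norm (t *\<^sub>R b))\<^sup>2 * M"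
        by (rule radial_increment[OF continuous_on_subset[OF u] d M]) (use le in auto)
      then show ?thesis by (simp add: power_mult_distrib algebra_simps)
    qed
    then have "((\<lambda>t. u (norm (t *\<^sub>R b))) has_real_derivative 0) (at 0)"
      by (rule has_real_derivative_0_if_quadratic)
    then show ?thesis by (simp add: True)
  next
    case False
    then have "(u has_real_derivative norm x * h (norm x)) (at (norm (x + 0 *\<^sub>R b)))" by (simp add: d)
    from DERIV_chain2[OF this norm_line_deriv[OF False]] show ?thesis using False by simp
  qed
  then show "((\<lambda>t. u (norm (x + t *\<^sub>R b))) has_vector_derivative h (norm x) * (x \<bullet> b)) (at 0)"
    by (simp add: has_real_derivative_iff_has_vector_derivative)
qed

text \<open>Away from the origin h' = (F - 3 h) / r is read off from (r^3 h)' = r^2 F. At the origin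
  the quotient by (norm x)^2 is 0 by the convention for division, and the formula reduces to the
  right value \<open>h 0 * (b \<bullet> c)\<close>.\<close>

lemma dirderiv_radial_field:
  fixes h F :: "real \<Rightarrow> real" and b c :: "'a::euclidean_space"
  assumes h: "continuous_on UNIV h"
    and d: "\<And>r. 0 < r \<Longrightarrow> ((\<lambda>r. r^3 * h r) has_real_derivative r\<^sup>2 * F r) (at r)"
  shows "dirderiv b (\<lambda>x. h (norm x) * (x \<bullet> c))
    (\<lambda>x. h (norm x) * (b \<bullet> c) + (F (norm x) - 3 * h (norm x)) * ((x \<bullet> b) * (x \<bullet> c) / (norm x)\<^sup>2))"
  unfolding dirderiv_def
proof
  fix x :: 'a
  have "((\<lambda>t. h (norm (x + t *\<^sub>R b)) * ((x + t *\<^sub>R b) \<bullet> c)) has_real_derivative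
     h (norm x) * (b \<bullet> c) + (F (norm x) - 3 * h (norm x)) * ((x \<bullet> b) * (x \<bullet> c) / (norm x)\<^sup>2)) (at 0)"
  proof (cases "x = 0")
    case True
    have "((\<lambda>t. h (norm (t *\<^sub>R b)) * (b \<bullet> c)) \<longlongrightarrow> h (norm (0 *\<^sub>R b)) * (b \<bullet> c)) (at 0)"
    proof -
      have "continuous_on UNIV (\<lambda>t. h (norm (t *\<^sub>R b)) * (b \<bullet> c))"
        by (intro continuous_intros continuous_on_compose2[OF h]) auto
      then show ?thesis unfolding continuous_on_def by blast
    qed
    then have "((\<lambda>t. h (norm (t *\<^sub>R b)) * (b \<bullet> c)) \<longlongrightarrow> h 0 * (b \<bullet> c)) (at 0)" by simp
    then have "((\<lambda>t. (h (norm (t *\<^sub>R b)) * ((t *\<^sub>R b) \<bullet> c) - h 0 * 0) / t) \<longlongrightarrow> h 0 * (b \<bullet> c)) (at 0)"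
      by (rule Lim_transform_eventually) (auto simp: eventually_at_filter)
    then show ?thesis by (simp add: True DERIV_def)
  next
    case False
    then have r: "0 < norm x" by simp
    have "((\<lambda>r. (r^3 * h r) / r^3) has_real_derivative (F (norm x) - 3 * h (norm x)) / norm x) (at (norm x))"
      by (rule derivative_eq_intros d r refl)+
         (use False in \<open>simp_all add: field_simps power2_eq_square power3_eq_cube\<close>)
    then have "(h has_real_derivative (F (norm x) - 3 * h (norm x)) / norm x) (at (norm x))"
      by (rule has_field_derivative_transform_within_open[where S="{0<..}"]) (use r in auto)
    then have "(h has_real_derivative (F (norm x) - 3 * h (norm x)) / norm x) (at (norm (x + 0 *\<^sub>R b)))" by simp
    note 1 = DERIV_chain2[OF this norm_line_deriv[OF False]]
    have 2: "((\<lambda>t. (x + t *\<^sub>R b) \<bullet> c) has_real_derivative b \<bullet> c) (at 0)"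
      by (auto intro!: derivative_eq_intros simp: inner_add_left)
    show ?thesis
      by (rule DERIV_cong[OF DERIV_mult[OF 1 2]]) (use False in \<open>simp add: power2_eq_square field_simps\<close>)
  qed
  then show "((\<lambda>t. h (norm (x + t *\<^sub>R b)) * ((x + t *\<^sub>R b) \<bullet> c)) has_vector_derivative
     h (norm x) * (b \<bullet> c) + (F (norm x) - 3 * h (norm x)) * ((x \<bullet> b) * (x \<bullet> c) / (norm x)\<^sup>2)) (at 0)"
    by (simp add: has_real_derivative_iff_has_vector_derivative)
qed

lemma radial_field_coeff_le:
  fixes x b c :: "'a::euclidean_space"
  assumes "norm b = 1" "norm c = 1"
  shows "\<bar>h * (b \<bullet> c) + G * ((x \<bullet> b) * (x \<bullet> c) / (norm x)\<^sup>2)\<bar> \<le> \<bar>h\<bar> + \<bar>G\<bar>"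
proof -
  have "\<bar>b \<bullet> c\<bar> \<le> 1" using Cauchy_Schwarz_ineq2[of b c] assms by simp
  moreover have "\<bar>x \<bullet> b\<bar> * \<bar>x \<bullet> c\<bar> \<le> norm x * norm x"
    using Cauchy_Schwarz_ineq2[of x b] Cauchy_Schwarz_ineq2[of x c] assms by (intro mult_mono) auto
  then have "\<bar>(x \<bullet> b) * (x \<bullet> c) / (norm x)\<^sup>2\<bar> \<le> 1"
    by (cases "x = 0") (simp_all add: abs_mult power2_eq_square divide_le_eq)
  ultimately have "\<bar>h * (b \<bullet> c)\<bar> \<le> \<bar>h\<bar> * 1" "\<bar>G * ((x \<bullet> b) * (x \<bullet> c) / (norm x)\<^sup>2)\<bar> \<le> \<bar>G\<bar> * 1"
    unfolding abs_mult[of h] abs_mult[of G] by (intro mult_left_mono; simp)+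
  then show ?thesis by linarith
qed

lemma dirderiv_snd: "dirderiv b f g \<Longrightarrow> dirderiv (0, b) (\<lambda>z. f (snd z)) (\<lambda>z. g (snd z))"
  and dirderiv_snd_0: "dirderiv (c, 0) (\<lambda>z. f (snd z)) (\<lambda>_. 0)"
  and dirderiv_fst: "dirderiv c f' g' \<Longrightarrow> dirderiv (c, 0) (\<lambda>z. f' (fst z)) (\<lambda>z. g' (fst z))"
  and dirderiv_fst_0: "dirderiv (0, b) (\<lambda>z. f' (fst z)) (\<lambda>_. 0)"
  by (simp_all add: dirderiv_def)

section \<open>Choice of the shooting parameters\<close>

text \<open>With \<open>A = R0 / 2 * exp (beta * rb\<^sup>2 / 6)\<close> the condition on the
  Gaussian factor holds with R0/2 to spare; the other two say that this exponential exceeds a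
  constant and a multiple of (rb + 1)^2, true for large \<open>rb\<close>.\<close>

lemma shooting_amplitude:
  fixes beta R0 X Y :: real
  assumes "0 < beta" "0 < R0" "0 < Y"
  obtains rb A where "0 < rb" "2 * R0 < A" "A * exp (- (beta * rb\<^sup>2 / 6)) < R0" "X * (rb + 1)\<^sup>2 < Y * A"
proof -
  have "filterlim (\<lambda>r::real. exp (beta * r\<^sup>2 / 6) / (r + 1)\<^sup>2) at_top at_top"
    using assms(1) by real_asymp
  then have 1: "\<forall>\<^sub>F r in at_top. 2 * \<bar>X\<bar> / (Y * R0) < exp (beta * r\<^sup>2 / 6) / (r + 1)\<^sup>2"
    by (simp add: filterlim_at_top_dense)
  have "filterlim (\<lambda>r::real. exp (beta * r\<^sup>2 / 6)) at_top at_top"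
    using assms(1) by real_asymp
  then have 2: "\<forall>\<^sub>F r in at_top. 4 < exp (beta * r\<^sup>2 / 6)"
    by (simp add: filterlim_at_top_dense)
  from eventually_happens'[OF trivial_limit_at_top_linorder
      eventually_conj[OF eventually_conj[OF 1 2] eventually_gt_at_top[of 0]]]
  obtain rb where rb: "0 < rb" "4 < exp (beta * rb\<^sup>2 / 6)"
      "2 * \<bar>X\<bar> / (Y * R0) < exp (beta * rb\<^sup>2 / 6) / (rb + 1)\<^sup>2" by blast
  define A where "A = R0 / 2 * exp (beta * rb\<^sup>2 / 6)"
  have "X * (rb + 1)\<^sup>2 \<le> \<bar>X\<bar> * (rb + 1)\<^sup>2" by (intro mult_right_mono) auto
  also have "\<dots> < Y * A"
    using rb(1,3) assms(2,3) by (simp add: A_def field_simps)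
  finally have "X * (rb + 1)\<^sup>2 < Y * A" .
  moreover have "2 * R0 < A" using rb(2) assms(2) by (simp add: A_def)
  moreover have "A * exp (- (beta * rb\<^sup>2 / 6)) < R0" using assms(2) by (simp add: A_def exp_minus)
  ultimately show ?thesis using that rb(1) by blast
qed

lemma potential_ratio:
  fixes V f f' :: "real \<Rightarrow> real" and m0 m1 c0 :: real
  assumes V: "\<And>s. (V has_real_derivative f s) (at s)" and f: "\<And>s. (f has_real_derivative f' s) (at s)"
    and zero: "V 0 = 0" "f 0 = 0" "f' 0 = m0\<^sup>2"
    and m: "0 < m1" "m1 < m0" and W3: "\<And>s. V s \<le> 1/2 * m1\<^sup>2 * s\<^sup>2 + c0"
    and W4: "\<And>s. 0 \<le> f s * s" "\<And>s. f s * s \<le> 2 * V s"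
  shows "\<And>s t. 0 < s \<Longrightarrow> s \<le> t \<Longrightarrow> V t / t\<^sup>2 \<le> V s / s\<^sup>2"
    and "\<And>s. 0 < s \<Longrightarrow> V s / s\<^sup>2 \<le> m0\<^sup>2 / 2"
    and "\<And>e. 0 < e \<Longrightarrow> \<exists>d>0. \<forall>s. 0 \<le> s \<and> s \<le> d \<longrightarrow> (m0\<^sup>2 - e) * s \<le> f s"
    and "\<exists>s1>0. f s1 * s1 < 2 * V s1"
    and "\<And>s. 0 < s \<Longrightarrow> ((\<lambda>s. V s / s\<^sup>2) has_real_derivative (f s * s - 2 * V s) / s^3) (at s)"
proof -
  show h': "((\<lambda>s. V s / s\<^sup>2) has_real_derivative (f s * s - 2 * V s) / s^3) (at s)" if "0 < s" for s
    by (rule derivative_eq_intros V refl)+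
       (use that in \<open>simp_all add: field_simps power2_eq_square power3_eq_cube\<close>)
  have cont: "continuous_on {s..t} (\<lambda>s. V s / s\<^sup>2)" if "0 < s" for s t
    by (intro continuous_at_imp_continuous_on ballI DERIV_isCont[OF h']) (use that in auto)
  show mono: "V t / t\<^sup>2 \<le> V s / s\<^sup>2" if "0 < s" "s \<le> t" for s t
    by (rule nonincreasing_on_Icc[OF that(2) cont[OF that(1)] h'])
       (use that W4(2) in \<open>auto intro!: divide_nonpos_nonneg\<close>)
  have near: "\<exists>d>0. \<forall>s. 0 \<le> s \<and> s \<le> d \<longrightarrow> (m0\<^sup>2 - e) * s \<le> f s \<and> f s \<le> (m0\<^sup>2 + e) * s" if e: "0 < e" for e
  proof -
    have "((\<lambda>s. f s / s) \<longlongrightarrow> m0\<^sup>2) (at 0)" using f[of 0] by (simp add: DERIV_def zero)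
    from tendstoD[OF this e] obtain d where d: "0 < d" "\<And>s. s \<noteq> 0 \<Longrightarrow> \<bar>s\<bar> < d \<Longrightarrow> \<bar>f s / s - m0\<^sup>2\<bar> < e"
      by (auto simp: eventually_at dist_real_def)
    have "(m0\<^sup>2 - e) * s \<le> f s \<and> f s \<le> (m0\<^sup>2 + e) * s" if "0 \<le> s" "s \<le> d / 2" for s
    proof (cases "s = 0")
      case False
      then have "\<bar>f s / s - m0\<^sup>2\<bar> < e" using that d(1) by (intro d(2)) auto
      then have "m0\<^sup>2 - e < f s / s" "f s / s < m0\<^sup>2 + e" by linarith+
      then show ?thesis using that False by (simp add: pos_less_divide_eq pos_divide_less_eq less_imp_le)
    qed (simp add: zero)
    then show ?thesis using d(1) by (intro exI[of _ "d / 2"]) auto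
  qed
  then show "\<exists>d>0. \<forall>s. 0 \<le> s \<and> s \<le> d \<longrightarrow> (m0\<^sup>2 - e) * s \<le> f s" if "0 < e" for e
    using that by blast
  show le: "V s / s\<^sup>2 \<le> m0\<^sup>2 / 2" if s: "0 < s" for s
  proof (rule field_le_epsilon)
    fix e :: real assume e: "0 < e"
    obtain d where d: "0 < d" "\<And>s. 0 \<le> s \<Longrightarrow> s \<le> d \<Longrightarrow> f s \<le> (m0\<^sup>2 + e) * s" using near[OF e] by blast
    \<comment> \<open>The integrated bound f <= (m0^2 + e) s holds only near zero; monotonicity of
      the quotient carries it from \<open>t\<close> to \<open>s\<close>.\<close>
    define t where "t = min s d"
    have t: "0 < t" "t \<le> s" "t \<le> d" using s d by (auto simp: t_def)
    have "V t - (m0\<^sup>2 + e) * t\<^sup>2 / 2 \<le> V 0 - (m0\<^sup>2 + e) * 0\<^sup>2 / 2"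
    proof (rule nonincreasing_on_Icc[where g="\<lambda>t. V t - (m0\<^sup>2 + e) * t\<^sup>2 / 2" and g'="\<lambda>s. f s - (m0\<^sup>2 + e) * s"])
      have "continuous_on {0..t} V" using V by (meson DERIV_isCont continuous_at_imp_continuous_on)
      then show "continuous_on {0..t} (\<lambda>t. V t - (m0\<^sup>2 + e) * t\<^sup>2 / 2)"
        by (intro continuous_intros) auto
      fix r assume "0 < r" "r < t"
      then show "f r - (m0\<^sup>2 + e) * r \<le> 0" using d(2)[of r] t by simp
      show "((\<lambda>t. V t - (m0\<^sup>2 + e) * t\<^sup>2 / 2) has_real_derivative f r - (m0\<^sup>2 + e) * r) (at r)"
        by (rule V derivative_eq_intros refl | simp)+
    qed (use t in auto)
    then have "V t / t\<^sup>2 \<le> (m0\<^sup>2 + e) / 2" using t by (simp add: zero pos_divide_le_eq)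
    then show "V s / s\<^sup>2 \<le> m0\<^sup>2 / 2 + e" using mono[OF t(1,2)] e by (simp add: add_divide_distrib)
  qed
  show "\<exists>s1>0. f s1 * s1 < 2 * V s1"
  proof -
    \<comment> \<open>Half the gap between m0^2 and m1^2. The quotient is at least (m0^2 - e)/2 at
      \<open>d\<close> and falls below this value for large arguments, so the mean value theorem
      yields a point with negative derivative.\<close>
    define e where "e = (m0\<^sup>2 - m1\<^sup>2) / 2"
    have msq: "m1\<^sup>2 < m0\<^sup>2" using m by (simp add: power_strict_mono)
    then have e: "0 < e" by (simp add: e_def)
    obtain d where d: "0 < d" "\<And>s. 0 \<le> s \<Longrightarrow> s \<le> d \<Longrightarrow> (m0\<^sup>2 - e) * s \<le> f s" using near[OF e] by blast
    have "(m0\<^sup>2 - e) * d * d \<le> f d * d" using d by (intro mult_right_mono) auto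
    then have "(m0\<^sup>2 - e) * d\<^sup>2 \<le> 2 * V d" using W4(2)[of d] by (simp add: power2_eq_square mult.assoc)
    then have lo: "(m0\<^sup>2 - e) / 2 \<le> V d / d\<^sup>2" using d(1) by (simp add: field_simps)
    have "((\<lambda>s::real. m1\<^sup>2 / 2 + c0 / s\<^sup>2) \<longlongrightarrow> m1\<^sup>2 / 2) at_top" by real_asymp
    then have "\<forall>\<^sub>F s in at_top. m1\<^sup>2 / 2 + c0 / s\<^sup>2 < (m0\<^sup>2 - e) / 2"
      by (rule order_tendstoD) (use msq in \<open>simp add: e_def field_simps\<close>)
    from eventually_happens'[OF trivial_limit_at_top_linorder eventually_conj[OF eventually_gt_at_top[of d] this]]
    obtain S where S: "d < S" "m1\<^sup>2 / 2 + c0 / S\<^sup>2 < (m0\<^sup>2 - e) / 2" by blast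
    have "V S / S\<^sup>2 \<le> m1\<^sup>2 / 2 + c0 / S\<^sup>2" using W3[of S] S d by (simp add: field_simps)
    then have less: "V S / S\<^sup>2 < V d / d\<^sup>2" using S lo by linarith
    have "\<exists>z>d. z < S \<and> V S / S\<^sup>2 - V d / d\<^sup>2 = (S - d) * ((f z * z - 2 * V z) / z^3)"
      using S(1) h' d(1) by (intro MVT2) auto
    then obtain z where z: "d < z" "V S / S\<^sup>2 - V d / d\<^sup>2 = (S - d) * ((f z * z - 2 * V z) / z^3)" by blast
    have "f z * z < 2 * V z"
    proof (rule ccontr)
      assume "\<not> ?thesis"
      then have "0 \<le> (S - d) * ((f z * z - 2 * V z) / z^3)" using S z d by (intro mult_nonneg_nonneg divide_nonneg_nonneg) auto
      then show False using z(2) less by linarith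
    qed
    then show ?thesis using z(1) d(1) by (intro exI[of _ z]) auto
  qed
qed

lemma shooting_parameters:
  fixes V f f' :: "real \<Rightarrow> real" and m0 m1 c0 :: real
  assumes V: "\<And>s. (V has_real_derivative f s) (at s)" and f: "\<And>s. (f has_real_derivative f' s) (at s)"
    and f': "continuous_on UNIV f'"
    and zero: "V 0 = 0" "f 0 = 0" "f' 0 = m0\<^sup>2"
    and m: "0 < m1" "m1 < m0" and W3: "\<And>s. V s \<le> 1/2 * m1\<^sup>2 * s\<^sup>2 + c0"
    and W4: "\<And>s. 0 \<le> f s * s" "\<And>s. f s * s \<le> 2 * V s"
  shows "\<exists>b b' eps x1 A gam c del Lf R0 beta rb. shooting V f b b' m0 eps x1 A gam c del Lf R0 beta rb"
proof -
  define h where "h s = V s / s\<^sup>2" for s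
  note R = potential_ratio[OF V f zero m W3 W4]
  have h_mono: "\<And>s t. 0 < s \<Longrightarrow> s \<le> t \<Longrightarrow> h t \<le> h s" unfolding h_def by (rule R(1))
  have h_le: "\<And>s. 0 < s \<Longrightarrow> h s \<le> m0\<^sup>2 / 2" unfolding h_def by (rule R(2))
  have h_deriv: "\<And>s. 0 < s \<Longrightarrow> (h has_real_derivative (f s * s - 2 * V s) / s^3) (at s)"
    unfolding h_def[abs_def] by (rule R(5))
  have V_h: "V s = h s * s\<^sup>2" if "0 < s" for s using that by (simp add: h_def)
  have f_h: "f s \<le> 2 * h s * s" if "0 < s" for s
    using W4(2)[of s] that by (simp add: V_h power2_eq_square)
  have m0: "0 < m0" using m by simp
  have f_nonneg: "0 \<le> f s" if "0 \<le> s" for s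
    using W4(1)[of s] that zero by (cases "s = 0") (auto simp: zero_le_mult_iff)
  have f_le: "f s \<le> m0\<^sup>2 * s" if "0 \<le> s" for s
  proof (cases "s = 0")
    case False
    then have "2 * h s * s \<le> m0\<^sup>2 * s" using h_le[of s] that by (intro mult_right_mono) auto
    then show ?thesis using f_h[of s] False that by linarith
  qed (simp add: zero)
  have f_cont: "continuous_on S f" for S
    using f by (meson DERIV_isCont continuous_at_imp_continuous_on)
  have V_cont: "continuous_on S V" for S
    using V by (meson DERIV_isCont continuous_at_imp_continuous_on)
  obtain s1 where s1: "0 < s1" "f s1 * s1 < 2 * V s1" using R(4) by blast
  have neg: "(f s1 * s1 - 2 * V s1) / s1^3 < 0" using s1 by (simp add: divide_neg_pos)
  \<comment> \<open>The quotient is monotone only in the weak sense; its negative derivative at s1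
    makes the comparison strict across s1.\<close>
  have h_lt: "h s1 < h s" if s: "0 < s" "s < s1" for s
  proof -
    obtain d where d: "0 < d" "\<And>t. 0 < t \<Longrightarrow> t < d \<Longrightarrow> h s1 < h (s1 - t)"
      using DERIV_neg_dec_left[OF h_deriv[OF s1(1)] neg] by auto
    define t where "t = min (d / 2) (s1 - s)"
    have "h s1 < h (s1 - t)" using d(1) s by (intro d(2)) (auto simp: t_def)
    also have "\<dots> \<le> h s" using s by (intro h_mono) (auto simp: t_def)
    finally show ?thesis .
  qed
  have h_gt: "h s < h s1" if s: "s1 < s" for s
  proof -
    obtain d where d: "0 < d" "\<And>t. 0 < t \<Longrightarrow> t < d \<Longrightarrow> h (s1 + t) < h s1"
      using DERIV_neg_dec_right[OF h_deriv[OF s1(1)] neg] by auto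
    define t where "t = min (d / 2) (s - s1)"
    have "h s \<le> h (s1 + t)" using s s1 d(1) by (intro h_mono) (auto simp: t_def)
    also have "\<dots> < h s1" using d(1) s by (intro d(2)) (auto simp: t_def)
    finally show ?thesis .
  qed
  define b where "b = sqrt (2 * h s1)"
  have "0 < V s1" using s1(2) W4(1)[of s1] by linarith
  then have h_pos: "0 < h s1" using s1(1) by (simp add: h_def)
  then have b: "0 < b" "b\<^sup>2 = 2 * h s1" by (auto simp: b_def)
  have b_m0: "b\<^sup>2 < m0\<^sup>2" using h_lt[of "s1/2"] h_le[of "s1/2"] s1 b by auto
  \<comment> \<open>Any point above s1 would serve: the quotient has dropped strictly there, and
    \<open>beta\<close>, twice the drop, measures how far f stays below b^2 s from then on.\<close>
  define R0 where "R0 = 2 * s1"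
  define beta where "beta = 2 * (h s1 - h R0)"
  have R0: "0 < R0" "0 < beta" using s1 h_gt[of R0] by (auto simp: R0_def beta_def)
  have Y: "0 < beta / (6 * m0^3)" using R0 m0 by simp
  obtain rb A where A: "0 < rb" "2 * R0 < A" "A * exp (- (beta * rb\<^sup>2 / 6)) < R0"
      "(m0\<^sup>2 * R0 + R0) * (rb + 1)\<^sup>2 < beta / (6 * m0^3) * A"
    using shooting_amplitude[OF R0(2,1) Y] by blast
  have A0: "0 < A" "s1 < A" using A(2) R0 s1 by (auto simp: R0_def)
  have large: "f s - b\<^sup>2 * s \<le> - beta * s" if "s \<in> {R0..A}" for s
  proof -
    have s: "0 < s" "R0 \<le> s" using that R0 by auto
    have "f s \<le> 2 * h s * s" by (rule f_h[OF s(1)])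
    also have "\<dots> \<le> 2 * h R0 * s" using h_mono[OF R0(1) s(2)] s by (intro mult_right_mono) auto
    finally show ?thesis by (simp add: b beta_def algebra_simps)
  qed
  define g where "g s = b\<^sup>2 * s - f s" for s
  have g_cont: "continuous_on S g" for S unfolding g_def by (intro continuous_intros f_cont)
  have "g s1 * s1 = b\<^sup>2 * s1\<^sup>2 - f s1 * s1" by (simp add: g_def power2_eq_square[of s1] left_diff_distrib)
  also have "\<dots> = 2 * V s1 - f s1 * s1" by (simp add: b(2) V_h[OF s1(1)])
  finally have "0 < g s1 * s1" using s1(2) by simp
  then have "0 < g s1" using s1 by (simp add: zero_less_mult_iff)
  moreover have "isCont g s1" using g_cont[of UNIV] by (simp add: continuous_on_eq_continuous_at)
  ultimately have "\<forall>\<^sub>F s in at s1. 0 < g s" unfolding isCont_def by (intro order_tendstoD(1))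
  then obtain d where d: "0 < d" "\<And>s. s \<noteq> s1 \<Longrightarrow> \<bar>s - s1\<bar> < d \<Longrightarrow> 0 < g s"
    by (auto simp: eventually_at dist_real_def)
  \<comment> \<open>Slightly below s1 the force is still downward by continuity, while V/s^2 already
    exceeds b^2/2 strictly. Hence the zone of downward force and the zone of negative potential can
    meet at \<open>x1\<close>.\<close>
  define x1 where "x1 = max (s1 / 2) (s1 - d / 2)"
  have x1: "0 < x1" "x1 < s1" "x1 < A" "s1 - d < x1" using s1 d A0 by (auto simp: x1_def)
  have g_pos: "0 < g s" if "x1 \<le> s" for s
  proof -
    consider "s < s1" | "s = s1" | "s1 < s" by linarith
    then show ?thesis
    proof cases
      case 1
      then show ?thesis using that x1 by (intro d(2)) auto
    next
      case 3
      have "f s \<le> 2 * h s * s" using 3 s1 by (intro f_h) auto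
      also have "\<dots> < 2 * h s1 * s" using h_gt[OF 3] 3 s1 by auto
      finally show ?thesis by (simp add: g_def b)
    qed (use \<open>0 < g s1\<close> in simp)
  qed
  obtain y where y: "y \<in> {x1..A}" "\<And>s. s \<in> {x1..A} \<Longrightarrow> g y \<le> g s"
    using continuous_attains_inf[of "{x1..A}" g] g_cont x1 by auto
  define gam where "gam = g y"
  have gam: "0 < gam" using y(1) g_pos[of y] by (simp add: gam_def)
  have zone1: "f s - b\<^sup>2 * s \<le> - gam" if "s \<in> {x1..A}" for s
    using y(2)[OF that] by (simp add: gam_def g_def)
  \<comment> \<open>A quarter of the gap m0^2 - b^2: one share goes to the linearisation of f at
    zero, at most one to enlarging b to b', and two remain for \<open>del\<close>.\<close>
  define \<eta> where "\<eta> = (m0\<^sup>2 - b\<^sup>2) / 4"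
  have \<eta>: "0 < \<eta>" using b_m0 by (simp add: \<eta>_def)
  obtain e where e: "0 < e" "\<And>s. 0 \<le> s \<Longrightarrow> s \<le> e \<Longrightarrow> (m0\<^sup>2 - \<eta>) * s \<le> f s" using R(3)[OF \<eta>] by blast
  define eps where "eps = min e (x1 / 2)"
  have eps: "0 < eps" "eps < x1" "eps \<le> e" using e x1 by (auto simp: eps_def)
  define G where "G s = b\<^sup>2 * s\<^sup>2 / 2 - V s" for s
  have G_cont: "continuous_on S G" for S unfolding G_def by (intro continuous_intros V_cont) auto
  have G_neg: "G s < 0" if "0 < s" "s < s1" for s
  proof -
    have "G s = s\<^sup>2 * (h s1 - h s)" using that by (simp add: G_def b V_h algebra_simps)
    then show ?thesis using h_lt[OF that] that by (simp add: mult_pos_neg)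
  qed
  obtain w where w: "w \<in> {eps..x1}" "\<And>s. s \<in> {eps..x1} \<Longrightarrow> G s \<le> G w"
    using continuous_attains_sup[of "{eps..x1}" G] G_cont eps by auto
  \<comment> \<open>Half of the margin of \<open>G\<close>; the other half pays for replacing b by
    b'.\<close>
  define c where "c = - G w / 2"
  have c: "0 < c" "\<And>s. s \<in> {eps..x1} \<Longrightarrow> G s \<le> - 2 * c"
    using w(1) w(2) G_neg[of w] eps x1 by (simp_all add: c_def)
  \<comment> \<open>The increment b'^2 - b^2 has to respect both lower zones: \<tau> s^2 / 2 <= c
    for s <= A, and \<tau> <= \<eta>. There is no circularity, since \<open>A\<close> was chosen
    without reference to b'.\<close>
  define \<tau> where "\<tau> = min \<eta> (2 * c / A\<^sup>2)"
  have \<tau>: "0 < \<tau>" "\<tau> \<le> \<eta>" "\<tau> * A\<^sup>2 \<le> 2 * c"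
  proof -
    show "0 < \<tau>" "\<tau> \<le> \<eta>" using \<eta> c A0 by (auto simp: \<tau>_def)
    have "\<tau> * A\<^sup>2 \<le> 2 * c / A\<^sup>2 * A\<^sup>2" by (intro mult_right_mono) (auto simp: \<tau>_def)
    then show "\<tau> * A\<^sup>2 \<le> 2 * c" using A0 by simp
  qed
  define b' where "b' = sqrt (b\<^sup>2 + \<tau>)"
  have b': "b'\<^sup>2 = b\<^sup>2 + \<tau>" "0 \<le> b'" using \<tau> by (auto simp: b'_def)
  have bb': "b < b'" using \<tau> b(1) b' by (intro power2_less_imp_less[of b b']) auto
  have b'm0: "b' \<le> m0" using b' \<tau> b_m0 m0 by (intro power2_le_imp_le[of b' m0]) (auto simp: \<eta>_def)
  have "bounded (f' ` {0..A})"
    by (intro compact_imp_bounded compact_continuous_image continuous_on_subset[OF f']) auto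
  then obtain Lf where Lf: "\<forall>s\<in>{0..A}. \<bar>f' s\<bar> \<le> Lf" by (auto simp: bounded_iff)
  have "\<bar>f s - f t\<bar> \<le> Lf * \<bar>s - t\<bar>" if "s \<in> {0..A}" "t \<in> {0..A}" for s t
  proof -
    have "norm (f s - f t) \<le> Lf * norm (s - t)"
      by (rule field_differentiable_bound[of "{0..A}" f f'])
         (use Lf that in \<open>auto intro: has_field_derivative_at_within[OF f]\<close>)
    then show ?thesis by simp
  qed
  moreover have "0 \<le> Lf" using Lf[rule_format, of 0] A0 by force
  moreover have "b'\<^sup>2 * s\<^sup>2 / 2 - V s \<le> - c" if s: "s \<in> {eps..x1}" for s
  proof -
    have "s\<^sup>2 \<le> A\<^sup>2" using s eps x1 by (intro power_mono) auto
    then have "\<tau> * s\<^sup>2 \<le> \<tau> * A\<^sup>2" using \<tau> by (intro mult_left_mono) auto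
    then show ?thesis using \<tau>(3) c(2)[OF s]
      unfolding G_def b' distrib_right add_divide_distrib by linarith
  qed
  moreover have "2 * \<eta> * s \<le> f s - b'\<^sup>2 * s" if s: "s \<in> {0..eps}" for s
  proof -
    have "\<tau> * s \<le> \<eta> * s" using \<tau> s by (intro mult_right_mono) auto
    moreover have "(m0\<^sup>2 - \<eta>) * s \<le> f s" using s eps by (intro e(2)) auto
    moreover have "m0\<^sup>2 = b\<^sup>2 + 4 * \<eta>" by (simp add: \<eta>_def field_simps)
    ultimately show ?thesis by (simp add: b' algebra_simps)
  qed
  ultimately have "shooting V f b b' m0 eps x1 A gam c (2 * \<eta>) Lf R0 beta rb"
    using V zero f_nonneg f_le b(1) bb' b'm0 eps x1 gam zone1 c(1) \<eta> R0 A large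
    by unfold_locales auto
  then show ?thesis by blast
qed

section \<open>Weak solutions\<close>

text \<open>Differentiating the invariance in z makes the derivative of \<open>W\<close> equivariant
  under rotations, which reduces the claim to the positive real axis. Differentiating it in \<theta>
  there shows that the derivative in direction \<i> vanishes.\<close>

lemma W_grad_gauge:
  fixes W :: "complex \<Rightarrow> real"
  assumes W: "\<And>z. W differentiable (at z)"
    and gauge: "\<And>\<theta> z. W (exp (\<i> * complex_of_real \<theta>) * z) = W z" and "0 < s"
  shows "W_grad W (of_real s * exp (- \<i> * of_real \<theta>)) = of_real (pd 1 W (of_real s)) * exp (- \<i> * of_real \<theta>)"
proof -
  define D where "D z = frechet_derivative W (at z)" for z
  have D: "(W has_derivative D z) (at z)" for z
    using W by (simp add: D_def frechet_derivative_works)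
  have lin: "linear (D z)" for z using D has_derivative_linear by blast
  have rot: "D (cis \<alpha> * z) (cis \<alpha> * v) = D z v" for \<alpha> z v
  proof -
    have "((\<lambda>z. cis \<alpha> * z) has_derivative (\<lambda>v. cis \<alpha> * v)) (at z)" by (auto intro!: derivative_eq_intros)
    from diff_chain_at[OF this D] have "(W has_derivative (\<lambda>v. D (cis \<alpha> * z) (cis \<alpha> * v))) (at z)"
      using gauge by (simp add: o_def cis_conv_exp)
    from has_derivative_unique[OF this D] show ?thesis by metis
  qed
  have "D (of_real s) \<i> = 0"
  proof -
    have "((\<lambda>z. exp (\<i> * z) * of_real s) has_field_derivative \<i> * of_real s) (at (of_real 0))"
      by (auto intro!: derivative_eq_intros)
    then have "((\<lambda>\<theta>. exp (\<i> * of_real \<theta>) * of_real s) has_vector_derivative \<i> * of_real s) (at 0)"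
      by (rule has_vector_derivative_real_field)
    then have c: "((\<lambda>\<theta>. cis \<theta> * of_real s) has_derivative (\<lambda>t. t *\<^sub>R (\<i> * of_real s))) (at 0)"
      by (simp add: has_vector_derivative_def cis_conv_exp)
    have "(W has_derivative D (of_real s)) (at (cis 0 * of_real s))" using D by simp
    from diff_chain_at[OF c this]
    have "((\<lambda>\<theta>. W (cis \<theta> * of_real s)) has_derivative (\<lambda>t. D (of_real s) (t *\<^sub>R (\<i> * of_real s)))) (at 0)"
      by (simp add: o_def)
    then have "((\<lambda>\<theta>. W (of_real s)) has_derivative (\<lambda>t. D (of_real s) (t *\<^sub>R (\<i> * of_real s)))) (at (0::real))"
      using gauge by (simp add: cis_conv_exp)
    from has_derivative_unique[OF this has_derivative_const] have "D (of_real s) (1 *\<^sub>R (\<i> * of_real s)) = 0" by metis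
    moreover have "1 *\<^sub>R (\<i> * of_real s) = s *\<^sub>R \<i>" by (simp add: scaleR_conv_of_real)
    ultimately show ?thesis using \<open>0 < s\<close> by (simp add: linear_cmul[OF lin])
  qed
  then have val: "D (of_real s) w = Re w * D (of_real s) 1" for w
  proof -
    have w: "w = Re w *\<^sub>R 1 + Im w *\<^sub>R \<i>" by (simp add: complex_eq_iff)
    have "D (of_real s) w = D (of_real s) (Re w *\<^sub>R 1 + Im w *\<^sub>R \<i>)" using w by (rule arg_cong)
    also have "\<dots> = Re w *\<^sub>R D (of_real s) 1 + Im w *\<^sub>R D (of_real s) \<i>"
      by (simp only: linear_add[OF lin] linear_cmul[OF lin])
    finally have "D (of_real s) w = Re w *\<^sub>R D (of_real s) 1 + Im w *\<^sub>R D (of_real s) \<i>" .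
    then show ?thesis using \<open>D (of_real s) \<i> = 0\<close> by simp
  qed
  have e: "exp (- \<i> * of_real \<theta>) = cis (- \<theta>)" by (simp add: cis_conv_exp)
  have pd: "pd v W (of_real s * cis (- \<theta>)) = Re (v * cis \<theta>) * pd 1 W (of_real s)" for v
  proof -
    have "cis (- \<theta>) * (v * cis \<theta>) = v * (cis \<theta> * cis (- \<theta>))" by (simp only: mult_ac)
    then have c: "cis (- \<theta>) * (v * cis \<theta>) = v" by (simp add: cis_mult)
    have "D (of_real s * cis (- \<theta>)) v = D (of_real s) (v * cis \<theta>)"
      using rot[of "- \<theta>" "of_real s" "v * cis \<theta>"] unfolding c by (simp only: mult.commute[of "of_real s"])
    then show ?thesis unfolding pd_def D_def[symmetric] using val[of "v * cis \<theta>"] by simp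
  qed
  show ?thesis
    unfolding W_grad_def e pd by (simp add: complex_eq_iff)
qed

text \<open>A trace: the diagonal entries sum to 3 h plus (F - 3 h) |x|^2 / |x|^2. At x = 0 the
  quotient is 0 by convention, and there 3 h = F is what closes the identity.\<close>

lemma radial_divergence:
  fixes x :: "real^3" and h F :: real
  assumes "x = 0 \<Longrightarrow> 3 * h = F"
  shows "(\<Sum>j\<in>UNIV. h * (axis j 1 \<bullet> (axis j 1 :: real^3)) + (F - 3 * h) * ((x \<bullet> axis j 1) * (x \<bullet> axis j 1) / (norm x)\<^sup>2)) = F"
proof -
  have "(\<Sum>j\<in>UNIV. (x \<bullet> axis j 1) * (x \<bullet> axis j 1)) = (norm x)\<^sup>2"
    by (simp add: power2_norm_eq_inner inner_vec_def[of x x] inner_axis)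
  then have c: "(\<Sum>j\<in>UNIV. (x \<bullet> axis j 1) * (x \<bullet> axis j 1) / (norm x)\<^sup>2) = (norm x)\<^sup>2 / (norm x)\<^sup>2"
    by (simp flip: sum_divide_distrib)
  have a: "(\<Sum>j\<in>(UNIV::3 set). h * (axis j 1 \<bullet> (axis j 1 :: real^3))) = 3 * h"
    by (simp add: inner_axis_axis)
  have b: "(\<Sum>j\<in>UNIV. (F - 3 * h) * ((x \<bullet> axis j 1) * (x \<bullet> axis j 1) / (norm x)\<^sup>2)) = (F - 3 * h) * ((norm x)\<^sup>2 / (norm x)\<^sup>2)"
    unfolding sum_distrib_left[symmetric] c ..
  show ?thesis
    unfolding sum.distrib a b using assms by (cases "x = 0") auto
qed

lemma dirderiv_cong: "dirderiv b f g \<Longrightarrow> (\<And>x. g x = g' x) \<Longrightarrow> dirderiv b f g'"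
  by (simp add: dirderiv_def)

lemma Basis_spacetime: "e_t \<in> Basis" "e_x j \<in> Basis"
  by (auto simp: e_t_def e_x_def Basis_prod_def axis_in_Basis_iff)

lemma curl_zero: "curl (\<lambda>j. 0) = 0"
  by (simp add: curl_def vec_eq_iff forall_3)

lemma weak_pd_zero: "weak_pd b (\<lambda>_. 0) (\<lambda>_. 0)"
  by (simp add: weak_pd_def locally_integrable_def set_integrable_def)

lemma square_integrable_decay:
  fixes f :: "real^3 \<Rightarrow> real"
  assumes f: "continuous_on UNIV f" and "\<And>x. \<bar>f x\<bar> \<le> C / (1 + norm x)\<^sup>2"
  shows "square_integrable f"
proof -
  have m: "f \<in> borel_measurable lborel" using f by (simp add: borel_measurable_continuous_onI)
  have "integrable lborel (\<lambda>x. (f x)\<^sup>2)"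
  proof (rule Bochner_Integration.integrable_bound)
    show "integrable lborel (\<lambda>x::real^3. C\<^sup>2 * (1 / (1 + norm x)^4))"
      by (intro integrable_mult_right integrable_inverse_power4)
    show "AE x in lborel. norm ((f x)\<^sup>2) \<le> norm (C\<^sup>2 * (1 / (1 + norm x)^4))"
    proof (rule AE_I2)
      fix x :: "real^3"
      have "\<bar>f x\<bar>\<^sup>2 \<le> (C / (1 + norm x)\<^sup>2)\<^sup>2" by (intro power_mono assms) simp
      then show "norm ((f x)\<^sup>2) \<le> norm (C\<^sup>2 * (1 / (1 + norm x)^4))"
        by (simp add: power_divide abs_mult flip: power_mult)
    qed
  qed (use m in measurable)
  with m show ?thesis by (simp add: square_integrable_def)
qed

text \<open>\<open>w\<close> stands for \<omega>, \<open>v\<close> for \<open>Om\<close>, and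
  \<open>a\<close>, \<open>e\<close> for the conjugates of the time derivative of \<eta> and of
  \<eta>. The covariant time derivative of U E is -\<i> v U E, so on the right \<omega> survives
  only inside a total time derivative.\<close>

lemma KGM_reduction:
  fixes w v U E a e f :: complex
  shows "- (U * E * (- \<i> * w) + \<i> * (w - v) * (U * E)) * (a - \<i> * (w - v) * e) + f * E * e
    = (\<i> * v * (U * E) * a + \<i> * v * (U * E * (- \<i> * w)) * e) + (f - v\<^sup>2 * U) * E * e"
  by (simp add: algebra_simps power2_eq_square)

lemma soliton_is_weak_solution:
  fixes W :: "complex \<Rightarrow> real"
  assumes prof: "soliton_profile f q u h Om k \<omega>" and q: "0 < q"
    and W: "\<And>z. W differentiable (at z)"
    and gauge: "\<And>\<theta> z. W (exp (\<i> * complex_of_real \<theta>) * z) = W z"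
    and f: "\<And>s. f s = pd 1 W (of_real s)" "continuous_on UNIV f"
  shows "weak_KGM_solution W q (\<lambda>(t, x). complex_of_real (u (norm x)) * exp (- \<i> * complex_of_real (\<omega> * t)))
    (\<lambda>(t, x). (\<omega> - Om (norm x)) / q) (\<lambda>_. 0)"
proof -
  have cu: "continuous_on UNIV u" and ch: "continuous_on UNIV h" and cO: "continuous_on UNIV Om" and ck: "continuous_on UNIV k"
    and P: "\<forall>r>0. (u has_real_derivative r * h r) (at r)"
     "\<forall>r>0. ((\<lambda>r. r^3 * h r) has_real_derivative r\<^sup>2 * (f (u r) - (Om r)\<^sup>2 * u r)) (at r)"
     "\<forall>r>0. (Om has_real_derivative r * k r) (at r)"
     "\<forall>r>0. ((\<lambda>r. r^3 * k r) has_real_derivative r\<^sup>2 * (q\<^sup>2 * (u r)\<^sup>2 * Om r)) (at r)"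
     "3 * h 0 = f (u 0) - (Om 0)\<^sup>2 * u 0" "3 * k 0 = q\<^sup>2 * (u 0)\<^sup>2 * Om 0" "\<forall>r\<ge>0. 0 < u r"
    using prof unfolding soliton_profile_def by - (elim conjE, assumption)+
  have du: "\<And>r. 0 < r \<Longrightarrow> (u has_real_derivative r * h r) (at r)"
    and dO: "\<And>r. 0 < r \<Longrightarrow> (Om has_real_derivative r * k r) (at r)"
    using P(1,3) by simp_all
  define F where "F r = f (u r) - (Om r)\<^sup>2 * u r" for r
  define F2 where "F2 r = q\<^sup>2 * (u r)\<^sup>2 * Om r" for r
  have dh: "\<And>r. 0 < r \<Longrightarrow> ((\<lambda>r. r^3 * h r) has_real_derivative r\<^sup>2 * F r) (at r)"
    and dk: "\<And>r. 0 < r \<Longrightarrow> ((\<lambda>r. r^3 * k r) has_real_derivative r\<^sup>2 * F2 r) (at r)"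
    unfolding F_def F2_def using P(2,4) by simp_all
  have h0: "3 * h 0 = F 0" and k0: "3 * k 0 = F2 0" unfolding F_def F2_def using P(5,6) by simp_all
  have u_pos: "\<And>r. 0 \<le> r \<Longrightarrow> 0 < u r" using P(7) by simp
  have cF: "continuous_on UNIV F" "continuous_on UNIV F2"
    unfolding F_def F2_def
    by (intro continuous_intros cu cO continuous_on_compose2[OF f(2) cu]; simp)+
  have radial: "continuous_on UNIV (\<lambda>z::spacetime. g (norm (snd z)))" if "continuous_on UNIV g" for g :: "real \<Rightarrow> real"
    by (intro continuous_on_compose2[OF that] continuous_intros) auto
  note cs = radial[OF cu] radial[OF ch] radial[OF cO] radial[OF ck] radial[OF cF(1)] radial[OF cF(2)]
  define E where "E t = exp (- \<i> * complex_of_real (\<omega> * t))" for t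
  have cE: "continuous_on UNIV (\<lambda>z::spacetime. E (fst z))" unfolding E_def by (intro continuous_intros)
  have norm_E: "cmod (E t) = 1" for t by (simp add: E_def)
  define \<psi> where "\<psi> z = of_real (u (norm (snd z))) * E (fst z)" for z :: spacetime
  define \<phi> where "\<phi> z = (\<omega> - Om (norm (snd z))) / q" for z :: spacetime
  define \<psi>t where "\<psi>t z = \<psi> z * (- \<i> * of_real \<omega>)" for z
  define \<psi>x where "\<psi>x j z = of_real (h (norm (snd z)) * (snd z \<bullet> axis j 1)) * E (fst z)" for j and z :: spacetime
  define \<phi>x where "\<phi>x j z = - (k (norm (snd z)) * (snd z \<bullet> axis j 1)) / q" for j and z :: spacetime
  \<comment> \<open>\<open>G j\<close> is the derivative of h(|x|) x_j in direction j. Only its sum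
    over j, which is \<open>F\<close>, and a continuous majorant enter the integration by
    parts.\<close>
  define G where "G j z = h (norm (snd z)) * (axis j 1 \<bullet> (axis j 1 :: real^3)) + (F (norm (snd z)) - 3 * h (norm (snd z))) *
      ((snd z \<bullet> axis j 1) * (snd z \<bullet> axis j 1) / (norm (snd z))\<^sup>2)" for j and z :: spacetime
  define G2 where "G2 j z = k (norm (snd z)) * (axis j 1 \<bullet> (axis j 1 :: real^3)) + (F2 (norm (snd z)) - 3 * k (norm (snd z))) *
      ((snd z \<bullet> axis j 1) * (snd z \<bullet> axis j 1) / (norm (snd z))\<^sup>2)" for j and z :: spacetime
  have sumG: "(\<Sum>j\<in>UNIV. G j z) = F (norm (snd z))" "(\<Sum>j\<in>UNIV. G2 j z) = F2 (norm (snd z))" for z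
    unfolding G_def G2_def by (rule radial_divergence; use h0 k0 in simp)+
  have bndG: "\<bar>G j z\<bar> \<le> \<bar>h (norm (snd z))\<bar> + \<bar>F (norm (snd z)) - 3 * h (norm (snd z))\<bar>"
    "\<bar>G2 j z\<bar> \<le> \<bar>k (norm (snd z))\<bar> + \<bar>F2 (norm (snd z)) - 3 * k (norm (snd z))\<bar>" for j z
    unfolding G_def G2_def by (rule radial_field_coeff_le; simp add: norm_axis_1)+
  have c\<psi>: "continuous_on UNIV \<psi>" and c\<psi>t: "continuous_on UNIV \<psi>t" and c\<psi>x: "continuous_on UNIV (\<psi>x j)"
    and c\<phi>: "continuous_on UNIV \<phi>" and c\<phi>x: "continuous_on UNIV (\<phi>x j)" for j
    unfolding \<psi>_def \<psi>t_def \<psi>x_def \<phi>_def \<phi>x_def using q by (intro continuous_intros cs cE; simp)+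
  have dE: "dirderiv e_t (\<lambda>z. E (fst z)) (\<lambda>z. E (fst z) * (- \<i> * of_real \<omega>))"
    unfolding e_t_def
  proof (rule dirderiv_fst)
    show "dirderiv 1 E (\<lambda>t. E t * (- \<i> * of_real \<omega>))"
      unfolding dirderiv_def
    proof
      fix t
      have "((\<lambda>z. exp (- \<i> * of_real \<omega> * (of_real t + z))) has_field_derivative E t * (- \<i> * of_real \<omega>)) (at (of_real 0))"
        by (auto intro!: derivative_eq_intros simp: E_def mult.assoc)
      then have "((\<lambda>s. exp (- \<i> * of_real \<omega> * (of_real t + of_real s))) has_vector_derivative E t * (- \<i> * of_real \<omega>)) (at 0)"
        by (rule has_vector_derivative_real_field)
      then show "((\<lambda>s. E (t + s *\<^sub>R 1)) has_vector_derivative E t * (- \<i> * of_real \<omega>)) (at 0)"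
        by (simp add: E_def mult.assoc)
    qed
  qed
  have d0: "dirderiv e_t (\<lambda>z. g (snd z)) (\<lambda>_. 0)" for g :: "real^3 \<Rightarrow> 'b::real_normed_vector"
    unfolding e_t_def by (rule dirderiv_snd_0)
  have dE0: "dirderiv (e_x j) (\<lambda>z. E (fst z)) (\<lambda>_. 0)" for j
    unfolding e_x_def by (rule dirderiv_fst_0)
  have dux: "dirderiv (e_x j) (\<lambda>z. u (norm (snd z))) (\<lambda>z. h (norm (snd z)) * (snd z \<bullet> axis j 1))" for j
    unfolding e_x_def by (rule dirderiv_snd[OF dirderiv_radial[OF cu ch du]])
  have dOx: "dirderiv (e_x j) (\<lambda>z. Om (norm (snd z))) (\<lambda>z. k (norm (snd z)) * (snd z \<bullet> axis j 1))" for j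
    unfolding e_x_def by (rule dirderiv_snd[OF dirderiv_radial[OF cO ck dO]])
  have dhx: "dirderiv (e_x j) (\<lambda>z. h (norm (snd z)) * (snd z \<bullet> axis j 1)) (G j)" for j
    unfolding e_x_def G_def[abs_def] by (rule dirderiv_snd[OF dirderiv_radial_field[OF ch dh]])
  have dkx: "dirderiv (e_x j) (\<lambda>z. k (norm (snd z)) * (snd z \<bullet> axis j 1)) (G2 j)" for j
    unfolding e_x_def G2_def[abs_def] by (rule dirderiv_snd[OF dirderiv_radial_field[OF ck dk]])
  have product_E: "dirderiv (e_x j) (\<lambda>z. of_real (g z) * E (fst z)) (\<lambda>z. of_real (g' z) * E (fst z))"
    if "dirderiv (e_x j) g g'" for j g g'
    using dirderiv_bilinear[OF bounded_bilinear_mult dirderiv_bounded_linear[OF bounded_linear_of_real that] dE0[of j]]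
    by simp
  have d\<psi>t: "dirderiv e_t \<psi> \<psi>t"
    unfolding \<psi>_def[abs_def] \<psi>t_def
    by (rule dirderiv_cong[OF dirderiv_bilinear[OF bounded_bilinear_mult d0 dE]]) (simp add: \<psi>_def)
  have d\<psi>x: "dirderiv (e_x j) \<psi> (\<psi>x j)" for j
    unfolding \<psi>_def[abs_def] \<psi>x_def[abs_def] by (rule product_E[OF dux])
  have d\<psi>xx: "dirderiv (e_x j) (\<psi>x j) (\<lambda>z. of_real (G j z) * E (fst z))" for j
    unfolding \<psi>x_def[abs_def] by (rule product_E[OF dhx])
  have lin_q: "bounded_linear (\<lambda>y. - y / q)" "bounded_linear (\<lambda>y. y / q)"
    using bounded_linear_minus[OF bounded_linear_divide[of q]] bounded_linear_divide[of q] by simp_all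
  have d\<phi>x: "dirderiv (e_x j) \<phi> (\<phi>x j)" for j
  proof -
    have "dirderiv (e_x j) (\<lambda>z. \<omega> + - 1 * Om (norm (snd z))) (\<lambda>z. - 1 * (k (norm (snd z)) * (snd z \<bullet> axis j 1)))"
      using dOx[of j] unfolding dirderiv_def by (auto intro!: derivative_eq_intros)
    from dirderiv_bounded_linear[OF lin_q(2) this] show ?thesis
      unfolding \<phi>_def[abs_def] \<phi>x_def[abs_def] by simp
  qed
  have d\<phi>xx: "dirderiv (e_x j) (\<phi>x j) (\<lambda>z. - G2 j z / q)" for j
    unfolding \<phi>x_def[abs_def] by (rule dirderiv_bounded_linear[OF lin_q(1) dkx])
  have d\<phi>xt: "dirderiv e_t (\<lambda>z. \<chi> j. \<phi>x j z) (\<lambda>_. 0)"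
    unfolding \<phi>x_def by (rule d0)
  let ?L = "\<lambda>\<eta> z.
          - (\<psi>t z + \<i> * of_real (q * \<phi> z) * \<psi> z) * cnj (pd e_t \<eta> z + \<i> * of_real (q * \<phi> z) * \<eta> z)
          + (\<Sum>j\<in>UNIV. (\<psi>x j z - \<i> * of_real (q * (0::real^3) $ j) * \<psi> z)
                       * cnj (pd (e_x j) \<eta> z - \<i> * of_real (q * (0::real^3) $ j) * \<eta> z))
          + W_grad W (\<psi> z) * cnj (\<eta> z)"
  have eq1: "has_bochner_integral lborel (?L \<eta>) 0"
    if \<eta>: "test_function \<eta>" for \<eta> :: "spacetime \<Rightarrow> complex"
  proof -
    let ?O = "\<lambda>z::spacetime. complex_of_real (Om (norm (snd z)))"
    have bil: "bounded_bilinear (\<lambda>x y. x * cnj y)"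
      using bounded_bilinear.comp[OF bounded_bilinear_mult bounded_linear_ident bounded_linear_cnj] by simp
    \<comment> \<open>The time part of the equation is the divergence of
      \<open>\<i> * Om * \<psi>\<close>; \<open>Om\<close> is static, so only the phase is
      differentiated.\<close>
    have dO\<psi>: "dirderiv e_t (\<lambda>z. \<i> * ?O z * \<psi> z) (\<lambda>z. \<i> * ?O z * \<psi>t z)"
      by (rule dirderiv_cong[OF dirderiv_bilinear[OF bounded_bilinear_mult d0[of "\<lambda>x. \<i> * of_real (Om (norm x))"] d\<psi>t]]) simp
    have I0: "has_bochner_integral lborel (\<lambda>z. \<i> * ?O z * \<psi> z * cnj (pd e_t \<eta> z) + \<i> * ?O z * \<psi>t z * cnj (\<eta> z)) 0"
      by (rule integral_divergence_eq_0[OF bil Basis_spacetime(1) _ dO\<psi> _ order_refl \<eta>])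
         (intro continuous_intros cs c\<psi> c\<psi>t)+
    have Ij: "has_bochner_integral lborel (\<lambda>z. \<psi>x j z * cnj (pd (e_x j) \<eta> z) + of_real (G j z) * E (fst z) * cnj (\<eta> z)) 0" for j
    proof (rule integral_divergence_eq_0[OF bil Basis_spacetime(2) c\<psi>x d\<psi>xx _ _ \<eta>])
      show "continuous_on UNIV (\<lambda>z::spacetime. \<bar>h (norm (snd z))\<bar> + \<bar>F (norm (snd z)) - 3 * h (norm (snd z))\<bar>)"
        by (intro continuous_intros cs)
      show "cmod (of_real (G j z) * E (fst z)) \<le> \<bar>h (norm (snd z))\<bar> + \<bar>F (norm (snd z)) - 3 * h (norm (snd z))\<bar>" for z
        using bndG(1)[of j z] by (simp add: norm_mult norm_E)
    qed
    have "has_bochner_integral lborel (\<lambda>z. (\<i> * ?O z * \<psi> z * cnj (pd e_t \<eta> z) + \<i> * ?O z * \<psi>t z * cnj (\<eta> z)) +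
        (\<Sum>j\<in>UNIV. \<psi>x j z * cnj (pd (e_x j) \<eta> z) + of_real (G j z) * E (fst z) * cnj (\<eta> z))) (0 + (\<Sum>j\<in>(UNIV::3 set). 0))"
      by (intro has_bochner_integral_add I0 has_bochner_integral_sum Ij)
    moreover have "(\<i> * ?O z * \<psi> z * cnj (pd e_t \<eta> z) + \<i> * ?O z * \<psi>t z * cnj (\<eta> z)) +
        (\<Sum>j\<in>UNIV. \<psi>x j z * cnj (pd (e_x j) \<eta> z) + of_real (G j z) * E (fst z) * cnj (\<eta> z))
      = ?L \<eta> z" for z
    proof -
      let ?U = "complex_of_real (u (norm (snd z)))" and ?f = "complex_of_real (f (u (norm (snd z))))"
      have "(\<Sum>j\<in>UNIV. of_real (G j z) * E (fst z) * cnj (\<eta> z)) = of_real (F (norm (snd z))) * E (fst z) * cnj (\<eta> z)"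
        by (simp flip: sum_distrib_right of_real_sum add: sumG)
      then have s: "(\<Sum>j\<in>UNIV. \<psi>x j z * cnj (pd (e_x j) \<eta> z) + of_real (G j z) * E (fst z) * cnj (\<eta> z))
        = (\<Sum>j\<in>UNIV. \<psi>x j z * cnj (pd (e_x j) \<eta> z)) + (?f - (?O z)\<^sup>2 * ?U) * E (fst z) * cnj (\<eta> z)"
        by (simp add: sum.distrib F_def)
      have w: "W_grad W (\<psi> z) = ?f * E (fst z)"
        using W_grad_gauge[OF W gauge u_pos[OF norm_ge_zero], of "snd z" "\<omega> * fst z"]
        by (simp add: \<psi>_def E_def f(1))
      have qp: "complex_of_real (q * \<phi> z) = of_real \<omega> - ?O z" using q by (simp add: \<phi>_def)
      have c: "cnj (pd e_t \<eta> z + \<i> * (of_real \<omega> - ?O z) * \<eta> z) = cnj (pd e_t \<eta> z) - \<i> * (of_real \<omega> - ?O z) * cnj (\<eta> z)"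
        by simp
      show ?thesis
        unfolding s w qp c unfolding \<psi>t_def \<psi>_def
        using KGM_reduction[of ?U "E (fst z)" "of_real \<omega>" "?O z" "cnj (pd e_t \<eta> z)" "cnj (\<eta> z)" ?f]
        by (simp add: add_ac)
    qed
    ultimately show ?thesis by simp
  qed
  let ?L2 = "\<lambda>\<eta> z.
          (0 + (\<chi> j. \<phi>x j z)) \<bullet> (\<chi> j. pd (e_x j) \<eta> z)
          + q * (Im (cnj (\<psi> z) * \<psi>t z) + q * \<phi> z * (cmod (\<psi> z))\<^sup>2) * \<eta> z"
  have eq2: "has_bochner_integral lborel (?L2 \<eta>) 0"
    if \<eta>: "test_function \<eta>" for \<eta> :: "spacetime \<Rightarrow> real"
  proof -
    have Ij: "has_bochner_integral lborel (\<lambda>z. \<phi>x j z * pd (e_x j) \<eta> z + (- G2 j z / q) * \<eta> z) 0" for j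
    proof (rule integral_divergence_eq_0[OF bounded_bilinear_mult Basis_spacetime(2) c\<phi>x d\<phi>xx _ _ \<eta>])
      show "continuous_on UNIV (\<lambda>z::spacetime. (\<bar>k (norm (snd z))\<bar> + \<bar>F2 (norm (snd z)) - 3 * k (norm (snd z))\<bar>) / q)"
        using q by (intro continuous_intros cs) auto
      show "norm (- G2 j z / q) \<le> (\<bar>k (norm (snd z))\<bar> + \<bar>F2 (norm (snd z)) - 3 * k (norm (snd z))\<bar>) / q" for z
        using bndG(2)[of j z] q by (simp add: divide_right_mono)
    qed
    have "has_bochner_integral lborel (\<lambda>z. \<Sum>j\<in>UNIV. \<phi>x j z * pd (e_x j) \<eta> z + (- G2 j z / q) * \<eta> z) (\<Sum>j\<in>(UNIV::3 set). 0)"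
      by (intro has_bochner_integral_sum Ij)
    moreover have "(\<Sum>j\<in>UNIV. \<phi>x j z * pd (e_x j) \<eta> z + (- G2 j z / q) * \<eta> z)
      = ?L2 \<eta> z" for z
    proof -
      let ?U = "u (norm (snd z))"
      have "(\<Sum>j\<in>UNIV. (- G2 j z / q) * \<eta> z) = - F2 (norm (snd z)) / q * \<eta> z"
        by (simp flip: sum_distrib_right sum_divide_distrib add: sum_negf sumG)
      also have "\<dots> = - (q * ?U\<^sup>2 * Om (norm (snd z))) * \<eta> z"
        using q by (simp add: F2_def power2_eq_square)
      finally have s: "(\<Sum>j\<in>UNIV. (- G2 j z / q) * \<eta> z) = - (q * ?U\<^sup>2 * Om (norm (snd z))) * \<eta> z" .
      have n: "(cmod (\<psi> z))\<^sup>2 = ?U\<^sup>2" by (simp add: \<psi>_def norm_mult norm_E)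
      have "cnj (\<psi> z) * \<psi> z = of_real (?U\<^sup>2)" using complex_norm_square[of "\<psi> z"] n by (simp add: mult.commute)
      then have "cnj (\<psi> z) * \<psi>t z = of_real (?U\<^sup>2) * (- \<i> * of_real \<omega>)" by (simp add: \<psi>t_def flip: mult.assoc)
      then have i: "Im (cnj (\<psi> z) * \<psi>t z) = - \<omega> * ?U\<^sup>2" by simp
      have qp: "q * \<phi> z = \<omega> - Om (norm (snd z))" using q by (simp add: \<phi>_def)
      show ?thesis
        unfolding sum.distrib s i n qp by (simp add: inner_vec_def algebra_simps)
    qed
    ultimately show ?thesis by simp
  qed
  \<comment> \<open>The phase of \<psi> does not depend on x, so the current vanishes, and A = 0.
    What remains is the time derivative of \<zeta> paired with a static field, which integrates to
    zero.\<close>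
  have eq3: "has_bochner_integral lborel (\<lambda>z.
          curl (\<lambda>j. 0) \<bullet> curl (\<lambda>j. pd (e_x j) \<zeta> z)
          - (0 + (\<chi> j. \<phi>x j z)) \<bullet> pd e_t \<zeta> z
          - (q *\<^sub>R ((\<chi> j. Im (cnj (\<psi> z) * \<psi>x j z)) - (q * (cmod (\<psi> z))\<^sup>2) *\<^sub>R 0)) \<bullet> \<zeta> z) 0"
    if \<zeta>: "test_function \<zeta>" for \<zeta> :: "spacetime \<Rightarrow> real^3"
  proof -
    have "has_bochner_integral lborel (\<lambda>z. (\<chi> j. \<phi>x j z) \<bullet> pd e_t \<zeta> z + 0 \<bullet> \<zeta> z) 0"
      by (rule integral_divergence_eq_0[OF bounded_bilinear_inner Basis_spacetime(1) _ d\<phi>xt continuous_on_const _ \<zeta>])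
         (auto intro!: continuous_on_vec_lambda c\<phi>x)
    from has_bochner_integral_minus[OF this]
    have "has_bochner_integral lborel (\<lambda>z. - ((\<chi> j. \<phi>x j z) \<bullet> pd e_t \<zeta> z)) 0" by simp
    moreover have "Im (cnj (\<psi> z) * \<psi>x j z) = 0" for j z
    proof -
      have "cnj (\<psi> z) * \<psi>x j z = of_real (u (norm (snd z)) * (h (norm (snd z)) * (snd z \<bullet> axis j 1))) * (E (fst z) * cnj (E (fst z)))"
        by (simp add: \<psi>_def \<psi>x_def)
      also have "E (fst z) * cnj (E (fst z)) = of_real ((cmod (E (fst z)))\<^sup>2)" by (rule complex_norm_square[symmetric])
      finally show ?thesis by (simp only: norm_E of_real_mult[symmetric] Im_complex_of_real)
    qed
    then have "(\<chi> j. Im (cnj (\<psi> z) * \<psi>x j z)) = 0" for z by (simp add: vec_eq_iff)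
    ultimately show ?thesis by (simp add: curl_zero)
  qed
  have wp: "weak_pd e_t \<psi> \<psi>t" "weak_pd (e_x j) \<psi> (\<psi>x j)" "weak_pd (e_x j) \<phi> (\<phi>x j)" for j
    by (intro weak_pd_classical Basis_spacetime c\<psi> c\<psi>t c\<psi>x c\<phi> c\<phi>x d\<psi>t d\<psi>x d\<phi>x)+
  have "weak_KGM_solution W q \<psi> \<phi> (\<lambda>_. 0)"
    unfolding weak_KGM_solution_def
    by (rule exI[of _ \<psi>t], rule exI[of _ \<psi>x], rule exI[of _ \<phi>x], rule exI[of _ "\<lambda>_. 0"],
        rule exI[of _ "\<lambda>_ _. 0"], intro conjI allI impI weak_pd_zero wp eq1 eq2 eq3; assumption)
  then show ?thesis by (simp add: \<psi>_def[abs_def] \<phi>_def[abs_def] E_def case_prod_unfold)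
qed

theorem theorem3:
  fixes W :: "complex \<Rightarrow> real" and W\<^sub>r :: "real \<Rightarrow> real" and m\<^sub>0 :: real
  defines "W\<^sub>r \<equiv> \<lambda>s. W (complex_of_real s)"
  assumes W_C2: "class_C 2 W"
    and W_gauge: "\<And>\<theta> \<psi>. W (exp (\<i> * complex_of_real \<theta>) * \<psi>) = W \<psi>"
    and W1: "\<And>\<psi>. 0 \<le> W \<psi>" "W\<^sub>r 0 = 0" "deriv W\<^sub>r 0 = 0"
    and W2: "m\<^sub>0 > 0" "deriv (deriv W\<^sub>r) 0 = m\<^sub>0\<^sup>2"
    and W3: "\<exists>m\<^sub>1 c. 0 < m\<^sub>1 \<and> m\<^sub>1 < m\<^sub>0 \<and> 0 < c \<and> (\<forall>s. W\<^sub>r s \<le> 1/2 * m\<^sub>1\<^sup>2 * s\<^sup>2 + c)"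
    and W4: "\<And>s. 0 \<le> 1/2 * deriv W\<^sub>r s * s" "\<And>s. 1/2 * deriv W\<^sub>r s * s \<le> W\<^sub>r s"
    and W5: "\<exists>c\<^sub>1 c\<^sub>2 p. 0 < c\<^sub>1 \<and> 0 < c\<^sub>2 \<and> p < 4 \<and>
               (\<forall>s. \<bar>deriv (deriv W\<^sub>r) s\<bar> \<le> c\<^sub>1 * \<bar>s\<bar> powr p + c\<^sub>2)"
  shows "\<exists>q0>0. \<forall>q. 0 < q \<and> q < q0 \<longrightarrow>
    (\<exists>(u :: real^3 \<Rightarrow> real) (\<omega> :: real) (\<phi> :: real^3 \<Rightarrow> real).
       (\<forall>x. 0 \<le> u x) \<and> \<not> (AE x in lborel. u x = 0) \<and> u \<in> H1 \<and> \<phi> \<in> D_space \<and>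
       weak_KGM_solution W q
         (\<lambda>(t, x). complex_of_real (u x) * exp (- \<i> * complex_of_real (\<omega> * t)))
         (\<lambda>(t, x). \<phi> x)
         (\<lambda>_. 0))"
proof -
  define f where "f s = pd 1 W (complex_of_real s)" for s
  define f' where "f' s = pd 1 (pd 1 W) (complex_of_real s)" for s
  have two: "(2::nat) = Suc (Suc 0)" by simp
  have C1: "class_C (Suc 0) W" using W_C2 unfolding two by (rule class_C_SucD)
  have C1': "class_C (Suc 0) (pd 1 W)"
    using W_C2 unfolding two by (simp add: Basis_complex_def)
  have line: "((\<lambda>s. g (complex_of_real s)) has_real_derivative pd 1 g (of_real s)) (at s)"
    if "class_C (Suc 0) g" for g :: "complex \<Rightarrow> real" and s
    using dirderiv_line[OF class_C_1(3)[OF that], of 0 1 s UNIV]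
    by (simp add: has_real_derivative_iff_has_vector_derivative scaleR_conv_of_real)
  have V: "(W\<^sub>r has_real_derivative f s) (at s)" for s
    unfolding W\<^sub>r_def f_def by (rule line[OF C1])
  have f: "(f has_real_derivative f' s) (at s)" for s
    unfolding f_def[abs_def] f'_def by (rule line[OF C1'])
  have one: "(1::complex) \<in> Basis" by (simp add: Basis_complex_def)
  have cf': "continuous_on UNIV f'"
    unfolding f'_def[abs_def]
    by (intro continuous_on_compose2[OF class_C_1(2)[OF C1' one]] continuous_intros) auto
  have deriv: "deriv W\<^sub>r = f" "deriv f = f'"
    using DERIV_imp_deriv[OF V] DERIV_imp_deriv[OF f] by auto
  obtain m1 c where m1: "0 < m1" "m1 < m\<^sub>0" and c: "\<And>s. W\<^sub>r s \<le> 1/2 * m1\<^sup>2 * s\<^sup>2 + c" using W3 by blast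
  have W4': "0 \<le> f s * s" "f s * s \<le> 2 * W\<^sub>r s" for s
    using W4[of s] by (simp_all add: deriv)
  have f0: "f 0 = 0" "f' 0 = m\<^sub>0\<^sup>2" using W1(3) W2(2) by (simp_all add: deriv)
  obtain b b' eps x1 A gam c' del Lf R0 beta rb where "shooting W\<^sub>r f b b' m\<^sub>0 eps x1 A gam c' del Lf R0 beta rb"
    using shooting_parameters[OF V f cf' W1(2) f0 m1 c W4'] by (elim exE) (rule that)
  from shooting.soliton_profiles[OF this] obtain q0 where q0: "0 < q0"
    and prof: "\<And>q. 0 < q \<Longrightarrow> q < q0 \<Longrightarrow> \<exists>u h Om k \<omega>. soliton_profile f q u h Om k \<omega>" by blast
  have "\<exists>(u :: real^3 \<Rightarrow> real) (\<omega> :: real) (\<phi> :: real^3 \<Rightarrow> real).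
       (\<forall>x. 0 \<le> u x) \<and> \<not> (AE x in lborel. u x = 0) \<and> u \<in> H1 \<and> \<phi> \<in> D_space \<and>
       weak_KGM_solution W q
         (\<lambda>(t, x). complex_of_real (u x) * exp (- \<i> * complex_of_real (\<omega> * t)))
         (\<lambda>(t, x). \<phi> x)
         (\<lambda>_. 0)" if q: "0 < q" "q < q0" for q
  proof -
    obtain u h Om k \<omega> where pr: "soliton_profile f q u h Om k \<omega>" using prof[OF q] by blast
    have cont: "continuous_on UNIV u" "continuous_on UNIV h" "continuous_on UNIV Om" "continuous_on UNIV k"
      and P: "\<forall>r>0. (u has_real_derivative r * h r) (at r)" "\<forall>r>0. (Om has_real_derivative r * k r) (at r)"
       "\<forall>r\<ge>0. 0 < u r"
       "\<exists>C. \<forall>r\<ge>0. \<bar>u r\<bar> \<le> C / (1 + r)^2" "\<exists>C. \<forall>r\<ge>0. \<bar>r * h r\<bar> \<le> C / (1 + r)^2"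
       "\<exists>C. \<forall>r\<ge>0. \<bar>r * k r\<bar> \<le> C / (1 + r)^2" "\<exists>C. \<forall>r\<ge>0. \<bar>\<omega> - Om r\<bar> \<le> C / (1 + r)^1"
      using pr unfolding soliton_profile_def by - (elim conjE, assumption)+
    obtain Cu where Cu: "\<forall>r\<ge>0. \<bar>u r\<bar> \<le> Cu / (1 + r)^2" using P(4) ..
    obtain Ch where Ch: "\<forall>r\<ge>0. \<bar>r * h r\<bar> \<le> Ch / (1 + r)^2" using P(5) ..
    obtain Ck where Ck: "\<forall>r\<ge>0. \<bar>r * k r\<bar> \<le> Ck / (1 + r)^2" using P(6) ..
    obtain CO where CO: "\<forall>r\<ge>0. \<bar>\<omega> - Om r\<bar> \<le> CO / (1 + r)^1" using P(7) ..
    note C = Cu[rule_format] Ch[rule_format] Ck[rule_format] CO[rule_format]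
    let ?u = "\<lambda>x::real^3. u (norm x)" and ?\<phi> = "\<lambda>x::real^3. (\<omega> - Om (norm x)) / q"
    have cn: "continuous_on UNIV (\<lambda>x::real^3. g (norm x))" if "continuous_on UNIV g" for g :: "real \<Rightarrow> real"
      by (intro continuous_on_compose2[OF that] continuous_intros) auto
    have pos: "0 < ?u x" for x using P(3) by simp
    have nonneg: "\<forall>x. 0 \<le> ?u x" by (intro allI less_imp_le pos)
    have ne: "?u x \<noteq> 0" for x using pos[of x] by simp
    have nontriv: "\<not> (AE x in lborel. ?u x = 0)"
    proof
      assume "AE x in lborel. ?u x = 0"
      then have "AE x::real^3 in lborel. x \<notin> UNIV" using ne by simp
      then have "(UNIV :: (real^3) set) \<in> null_sets lborel" by (subst AE_iff_null_sets) auto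
      then show False by (simp add: null_sets_def)
    qed
    have du: "\<And>r. 0 < r \<Longrightarrow> (u has_real_derivative r * h r) (at r)"
      and dO: "\<And>r. 0 < r \<Longrightarrow> (Om has_real_derivative r * k r) (at r)"
      using P(1,2) by simp_all
    have uH1: "?u \<in> H1"
      unfolding H1_def
    proof (intro CollectI conjI allI exI)
      show "square_integrable ?u" by (rule square_integrable_decay[OF cn[OF cont(1)]]) (rule C(1), simp)
      fix j
      have cg: "continuous_on UNIV (\<lambda>x::real^3. h (norm x) * (x \<bullet> axis j 1))"
        by (intro continuous_intros cn cont)
      show "weak_pd (axis j 1) ?u (\<lambda>x. h (norm x) * (x \<bullet> axis j 1))"
        by (intro weak_pd_classical cn cont cg dirderiv_radial[OF cont(1,2) du]) (auto simp: axis_in_Basis_iff)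
      show "square_integrable (\<lambda>x::real^3. h (norm x) * (x \<bullet> axis j 1))"
      proof (rule square_integrable_decay[OF cg])
        fix x :: "real^3"
        have "\<bar>x \<bullet> axis j 1\<bar> \<le> norm x" using Cauchy_Schwarz_ineq2[of x "axis j 1"] by (simp add: norm_axis_1)
        then have "\<bar>h (norm x) * (x \<bullet> axis j 1)\<bar> \<le> \<bar>norm x * h (norm x)\<bar>"
          using mult_left_mono[of "\<bar>x \<bullet> axis j 1\<bar>" "norm x" "\<bar>h (norm x)\<bar>"] by (simp add: abs_mult mult.commute)
        also have "\<dots> \<le> Ch / (1 + norm x)\<^sup>2" by (rule C(2)) simp
        finally show "\<bar>h (norm x) * (x \<bullet> axis j 1)\<bar> \<le> Ch / (1 + norm x)\<^sup>2" .
      qed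
    qed
    have \<phi>D: "?\<phi> \<in> D_space"
    proof (rule radial_in_D_space[where g="\<lambda>r. (\<omega> - Om r) / q" and k="\<lambda>r. - k r / q" and Cg="CO / q" and Ck="Ck / q"])
      show "continuous_on UNIV (\<lambda>r. (\<omega> - Om r) / q)" "continuous_on UNIV (\<lambda>r. - k r / q)"
        using q by (auto intro!: continuous_intros cont)
      fix r :: real
      show "((\<lambda>r. (\<omega> - Om r) / q) has_real_derivative r * (- k r / q)) (at r)" if "0 < r"
        using q by (auto intro!: derivative_eq_intros dO[OF that])
      show "\<bar>(\<omega> - Om r) / q\<bar> \<le> CO / q / (1 + r)" if "0 \<le> r"
        using divide_right_mono[OF C(4)[OF that], of q] q by (simp add: mult.commute)
      show "\<bar>r * (- k r / q)\<bar> \<le> Ck / q / (1 + r)\<^sup>2" if "0 \<le> r"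
        using divide_right_mono[OF C(3)[OF that], of q] q by (simp add: abs_mult mult.commute)
    qed
    have sol: "weak_KGM_solution W q (\<lambda>(t, x). complex_of_real (?u x) * exp (- \<i> * complex_of_real (\<omega> * t)))
         (\<lambda>(t, x). ?\<phi> x) (\<lambda>_. 0)"
    proof (rule soliton_is_weak_solution[OF pr q(1) _ W_gauge f_def])
      show "W differentiable (at z)" for z using C1 by simp
      show "continuous_on UNIV f" using f by (meson DERIV_isCont continuous_at_imp_continuous_on)
    qed
    show ?thesis
      by (intro exI[of _ ?u] exI[of _ \<omega>] exI[of _ ?\<phi>] conjI nonneg nontriv uH1 \<phi>D sol)
  qed
  with q0 show ?thesis by blast
qed

end
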